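(* Let $\ell=0$, let $G$ be an admissible kernel of order $m$ with parameters $d>m$, $L>0$, $T_*\in(0,\infty]$, and let $F$ satisfy the structure condition of order $0$ (all as defined in the context, with associated $A$, ${\bf p}$, $|{\bf p}|$, $\langle{\bf p}\rangle_0$ and $r_0$). Assume $r_0>1$. Then, for any $q>1$, there exists $\gamma>0$ such that for every locally integrable function $\phi$ on $\mathbb{R}^N$ there is a constant $C>0$, independent of $T$, with the following property: if $$\sup_{x\in\mathbb{R}^N}\ \sup_{0<\sigma<T^{1/d}}\ \sigma^{\frac N{r_0}}\left(\frac1{|B(x,\sigma)|}\int_{B(x,\sigma)}|\phi(y)|^q\,dy\right)^{\frac1q}\le\gamma$$ for some $T\in(0,T_*]$ (with $T^{1/d}=\infty$ if $T=\infty$), then the integral equation (I) displayed in the context possesses a solution $u$ in $\mathbb{R}^N\times[0,T)$ such that $$|\nabla^ju(x,t)|\le C\,t^{-\frac N{dr_0}-\frac jd}$$ for $(x,t)\in\mathbb{R}^N\times(0,T)$ and $j\in\{0,\dots,m\}$.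
   Context: Setting. $N\ge1$, $m\in\{0,1,2,\dots\}$, $a_0\in\mathbb{R}$. $\nabla^j=\nabla_x^j$ denotes the collection of all $j$-th order partial derivatives in $x$. $B(x,\sigma)$ is the open ball of centre $x$ and radius $\sigma$. $D_m:=\sum_{j=0}^mN^j$. Integral equation (I) (case $\ell=0$): $$u(x,t)=\int_{\mathbb{R}^N}G(x,y,t)\phi(y)\,dy+a_0\int_0^t\int_{\mathbb{R}^N}G(x,y,t-s)\,F\bigl(y,s,u(y,s),\dots,\nabla^mu(y,s)\bigr)\,dy\,ds.$$ Admissible kernel of order $m$ with parameters $d>m$, $L>0$, $T_*\in(0,\infty]$: a real function $G=G(x,y,t)$ such that (i) $G\in C^{m}(\mathbb{R}^{2N}\times(0,T_* ))$; (ii) there is $C_G>0$ with $|\nabla_x^jG(x,y,t)|\le C_G\,t^{-\frac{N+j}{d}}(1+t^{-\frac1d}|x-y|)^{-N-L-j}$ for $(x,y,t)\in\mathbb{R}^{2N}\times(0,T_* )$, $j\in\{0,\dots,m\}$; (iii) $G(x,z,t)=\int_{\mathbb{R}^N}G(x,y,t-s)G(y,z,s)\,dy$ for $x,z\in\mathbb{R}^N$, $0<s<t<T_*$. Structure condition of order $0$ on $F$ (with $\ell=0$): (i) $F$ is a continuous real function on $\mathbb{R}^N\times[0,\infty)\times\mathbb{R}^{D_m}$; (ii) there exist $J\subset\{0,\dots,m\}$, ${\bf p}=\{p_j\}_{j\in J}\subset(0,\infty)$ and $A>-1$ such that $|{\bf p}|:=\sum_{j\in J}p_j>1$ and $|F(x,t,z_0,\dots,z_m)|\le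 t^A\prod_{j\in J}|z_j|^{p_j}$ for $(x,t)\in\mathbb{R}^N\times[0,\infty)$, $z_j\in\mathbb{R}^{N^j}$; (iii) with $\langle{\bf p}\rangle_0:=\sum_{j\in J}j\,p_j$, one has $d(1+A)>\langle{\bf p}\rangle_0$. Define $r_0:=\dfrac{N(|{\bf p}|-1)}{d(1+A)-\langle{\bf p}\rangle_0}$. Solution: $u$ is a solution of (I) in $\mathbb{R}^N\times[0,T)$, $0<T\le\infty$, if for every $\tau\in(0,T)$ and $j\in\{0,\dots,m\}$, $\nabla_x^ju$ exists and is bounded and continuous on $\mathbb{R}^N\times(\tau,T)$, and $u$ satisfies (I) for all $(x,t)\in\mathbb{R}^N\times(0,T)$. *)

theory Defs
  imports "HOL-Analysis.Analysis"
begin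

(* R^N is modelled by a type of class euclidean_space, N = DIM('a).  A list of basis vectors
   indexes an iterated partial derivative, so the lists of length j index the N^j
   components of the j-th order derivative, and those of length at most m index the
   D_m = sum_{j=0..m} N^j coordinates of R^{D_m}. *)

definition words :: "nat \<Rightarrow> 'a::euclidean_space list set" where
  "words j = {w. set w \<subseteq> Basis \<and> length w = j}"

definition words_upto :: "nat \<Rightarrow> 'a::euclidean_space list set" where
  "words_upto m = {w. set w \<subseteq> Basis \<and> length w \<le> m}"

definition partial_differentiable ::
    "'a::euclidean_space \<Rightarrow> ('a \<Rightarrow> real) \<Rightarrow> 'a \<Rightarrow> bool" where
  "partial_differentiable b f x \<longleftrightarrow> (\<lambda>h. f (x + h *\<^sub>R b)) differentiable (at 0)"

definition partial :: "'a::euclidean_space \<Rightarrow> ('a \<Rightarrow> real) \<Rightarrow> 'a \<Rightarrow> real" where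
  "partial b f x = deriv (\<lambda>h. f (x + h *\<^sub>R b)) 0"

primrec iter_partial :: "'a::euclidean_space list \<Rightarrow> ('a \<Rightarrow> real) \<Rightarrow> 'a \<Rightarrow> real" where
  "iter_partial [] f = f"
| "iter_partial (b # w) f = partial b (iter_partial w f)"

definition partials_exist_on :: "nat \<Rightarrow> 'a::euclidean_space set \<Rightarrow> ('a \<Rightarrow> real) \<Rightarrow> bool" where
  "partials_exist_on k S f \<longleftrightarrow>
     (\<forall>w b. b # w \<in> words_upto k \<longrightarrow> (\<forall>x\<in>S. partial_differentiable b (iter_partial w f) x))"

(* Intended for open S only. *)
definition Ck_on :: "nat \<Rightarrow> 'a::euclidean_space set \<Rightarrow> ('a \<Rightarrow> real) \<Rightarrow> bool" where
  "Ck_on k S f \<longleftrightarrow> partials_exist_on k S f \<and>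
     (\<forall>w\<in>words_upto k. continuous_on S (iter_partial w f))"

(* Euclidean norm of the component z_j in R^{N^j}. *)
definition block_norm :: "nat \<Rightarrow> ('a::euclidean_space list \<Rightarrow> real) \<Rightarrow> real" where
  "block_norm j z = L2_set z (words j)"

definition nabla_norm :: "nat \<Rightarrow> ('a::euclidean_space \<Rightarrow> real) \<Rightarrow> 'a \<Rightarrow> real" where
  "nabla_norm j f x = block_norm j (\<lambda>w. iter_partial w f x)"

(* R^{D_m}, with the topology inherited from the product topology on the function type. *)
definition jet_space :: "nat \<Rightarrow> ('a::euclidean_space list \<Rightarrow> real) set" where
  "jet_space m = words_upto m \<rightarrow>\<^sub>E UNIV"

definition jet :: "nat \<Rightarrow> ('a::euclidean_space \<Rightarrow> real) \<Rightarrow> 'a \<Rightarrow> 'a list \<Rightarrow> real" where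
  "jet m f x = (\<lambda>w\<in>words_upto m. iter_partial w f x)"

definition admissible_kernel ::
    "nat \<Rightarrow> real \<Rightarrow> real \<Rightarrow> ereal \<Rightarrow> ('a::euclidean_space \<Rightarrow> 'a \<Rightarrow> real \<Rightarrow> real) \<Rightarrow> bool" where
  "admissible_kernel m d L Tstar G \<longleftrightarrow>
     Ck_on m {(x, y, t) | x y t. 0 < t \<and> ereal t < Tstar} (\<lambda>(x, y, t). G x y t) \<and>
     (\<exists>C_G>0. \<forall>x y t. \<forall>j\<le>m. 0 < t \<and> ereal t < Tstar \<longrightarrow>
        nabla_norm j (\<lambda>x. G x y t) x
          \<le> C_G * t powr (- (real DIM('a) + real j) / d)
             * (1 + t powr (- 1 / d) * norm (x - y)) powr (- real DIM('a) - L - real j)) \<and>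
     (\<forall>x z s t. 0 < s \<and> s < t \<and> ereal t < Tstar \<longrightarrow>
        G x z t = (LINT y|lebesgue. G x y (t - s) * G y z s))"

definition p_sum :: "nat set \<Rightarrow> (nat \<Rightarrow> real) \<Rightarrow> real" where
  "p_sum J p = (\<Sum>j\<in>J. p j)"

definition p_weight :: "nat set \<Rightarrow> (nat \<Rightarrow> real) \<Rightarrow> real" where
  "p_weight J p = (\<Sum>j\<in>J. real j * p j)"

(* The growth bound is imposed for t > 0 only.  At t = 0 the mathematical bound follows
   by continuity of F, with t^A read as 0, 1 or infinity for A > 0, A = 0, A < 0;
   the formal value "0 powr A = 0" would instead force F to vanish there for every A. *)
definition structure_condition ::
    "nat \<Rightarrow> real \<Rightarrow> nat set \<Rightarrow> (nat \<Rightarrow> real) \<Rightarrow> real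
      \<Rightarrow> ('a::euclidean_space \<Rightarrow> real \<Rightarrow> ('a list \<Rightarrow> real) \<Rightarrow> real) \<Rightarrow> bool" where
  "structure_condition m d J p A F \<longleftrightarrow>
     continuous_on (UNIV \<times> {0..} \<times> jet_space m) (\<lambda>(x, t, z). F x t z) \<and>
     J \<subseteq> {0..m} \<and> (\<forall>j\<in>J. 0 < p j) \<and> - 1 < A \<and> 1 < p_sum J p \<and>
     (\<forall>x. \<forall>t>0. \<forall>z\<in>jet_space m.
        \<bar>F x t z\<bar> \<le> t powr A * (\<Prod>j\<in>J. block_norm j z powr p j)) \<and>
     p_weight J p < d * (1 + A)"

definition r_zero :: "nat \<Rightarrow> real \<Rightarrow> nat set \<Rightarrow> (nat \<Rightarrow> real) \<Rightarrow> real \<Rightarrow> real" where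
  "r_zero N d J p A = real N * (p_sum J p - 1) / (d * (1 + A) - p_weight J p)"

definition locally_integrable :: "('a::euclidean_space \<Rightarrow> real) \<Rightarrow> bool" where
  "locally_integrable \<phi> \<longleftrightarrow> (\<forall>K. compact K \<longrightarrow> \<phi> absolutely_integrable_on K)"

(* Convergence of each integral is required explicitly, since a divergent integral
   has the formal value 0. *)
definition satisfies_integral_eq ::
    "nat \<Rightarrow> real \<Rightarrow> ('a::euclidean_space \<Rightarrow> 'a \<Rightarrow> real \<Rightarrow> real)
      \<Rightarrow> ('a \<Rightarrow> real \<Rightarrow> ('a list \<Rightarrow> real) \<Rightarrow> real) \<Rightarrow> ('a \<Rightarrow> real)
      \<Rightarrow> ('a \<Rightarrow> real \<Rightarrow> real) \<Rightarrow> 'a \<Rightarrow> real \<Rightarrow> bool" where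
  "satisfies_integral_eq m a0 G F \<phi> u x t \<longleftrightarrow>
     integrable lebesgue (\<lambda>y. G x y t * \<phi> y) \<and>
     (\<forall>s. 0 < s \<and> s < t \<longrightarrow>
        integrable lebesgue (\<lambda>y. G x y (t - s) * F y s (jet m (\<lambda>y. u y s) y))) \<and>
     set_integrable lebesgue {0<..<t}
       (\<lambda>s. LINT y|lebesgue. G x y (t - s) * F y s (jet m (\<lambda>y. u y s) y)) \<and>
     u x t = (LINT y|lebesgue. G x y t * \<phi> y)
       + a0 * (LINT s:{0<..<t}|lebesgue.
                 (LINT y|lebesgue. G x y (t - s) * F y s (jet m (\<lambda>y. u y s) y)))"

definition is_solution ::
    "nat \<Rightarrow> real \<Rightarrow> ('a::euclidean_space \<Rightarrow> 'a \<Rightarrow> real \<Rightarrow> real)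
      \<Rightarrow> ('a \<Rightarrow> real \<Rightarrow> ('a list \<Rightarrow> real) \<Rightarrow> real) \<Rightarrow> ('a \<Rightarrow> real)
      \<Rightarrow> ereal \<Rightarrow> ('a \<Rightarrow> real \<Rightarrow> real) \<Rightarrow> bool" where
  "is_solution m a0 G F \<phi> T u \<longleftrightarrow>
     (\<forall>\<tau>. 0 < \<tau> \<and> ereal \<tau> < T \<longrightarrow>
        (\<forall>t. \<tau> < t \<and> ereal t < T \<longrightarrow> partials_exist_on m UNIV (\<lambda>x. u x t)) \<and>
        (\<forall>w\<in>words_upto m.
           bounded ((\<lambda>(x, t). iter_partial w (\<lambda>x. u x t) x) ` (UNIV \<times> {t. \<tau> < t \<and> ereal t < T})) \<and>
           continuous_on (UNIV \<times> {t. \<tau> < t \<and> ereal t < T})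
             (\<lambda>(x, t). iter_partial w (\<lambda>x. u x t) x))) \<and>
     (\<forall>x t. 0 < t \<and> ereal t < T \<longrightarrow> satisfies_integral_eq m a0 G F \<phi> u x t)"

definition ereal_root :: "real \<Rightarrow> ereal \<Rightarrow> ereal" where
  "ereal_root d T = (if T = \<infinity> then \<infinity> else ereal (real_of_ereal T powr (1 / d)))"

(* The value is infinite as soon as |phi|^q fails to be integrable over one of the balls. *)
definition local_morrey_norm ::
    "real \<Rightarrow> real \<Rightarrow> ereal \<Rightarrow> ('a::euclidean_space \<Rightarrow> real) \<Rightarrow> ennreal" where
  "local_morrey_norm q r R \<phi> =
     (SUP x. SUP \<sigma>\<in>{\<sigma>. 0 < \<sigma> \<and> ereal \<sigma> < R}.
        if (\<lambda>y. \<bar>\<phi> y\<bar> powr q) absolutely_integrable_on ball x \<sigma>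
        then ennreal (\<sigma> powr (real DIM('a) / r)
               * (1 / measure lebesgue (ball x \<sigma>)
                   * (LINT y:ball x \<sigma>|lebesgue. \<bar>\<phi> y\<bar> powr q)) powr (1 / q))
        else \<infinity>)"

end

theory Submission
  imports Defs "HOL-Complex_Analysis.Great_Picard"
begin

text \<open>
  All estimates are reduced to the positive kernel
  \<open>K\<^sub>\<rho>(x,y) = \<rho>\<^sup>L (\<rho> + |x-y|)\<^bsup>-(N+L)\<^esup>\<close> with \<open>\<rho>\<^sup>d = t\<close>, which dominates
  \<open>t\<^bsup>j/d\<^esup>|\<nabla>\<^sup>jG|\<close>, has bounded mass, and satisfies \<open>K\<^sub>\<rho> * K\<^sub>\<rho>' \<le> C K\<^bsub>max\<^esub>\<close>.
  Decreasing \<open>q\<close>, one may assume \<open>1 < q \<le> |p|\<close>. With \<open>\<theta>\<^sub>t = K\<^sub>\<rho> * |\<phi>|\<^sup>q\<close>, the bound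
  \<open>|\<nabla>\<^sup>ju| \<le> M t\<^bsup>-j/d\<^esup> \<theta>\<^sub>t\<^bsup>1/q\<^esup>\<close> is reproduced by the integral equation: the Morrey
  condition gives \<open>\<theta>\<^sub>t \<le> C \<gamma>\<^sup>q t\<^bsup>-\<nu>q\<^esup>\<close> with \<open>\<nu> = N/(d r\<^sub>0)\<close>, so that
  \<open>|F| \<le> \<kappa> t\<^bsup>\<beta>-1\<^esup> \<theta>\<^sub>t\<close> with \<open>\<beta> = \<nu>(q-1) > 0\<close> and \<open>\<kappa>\<close> small; the choice
  \<open>q > 1\<close> is what makes this integrable at \<open>t = 0\<close>.

  As \<open>F\<close> is merely continuous, the solution is obtained by compactness. Instead of a fixed
  point theorem, Tonelli's device is used: delaying the argument of \<open>F\<close> by \<open>\<delta>\<close> makes the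
  equation explicitly solvable in time steps. The jets of the delayed solutions are
  equicontinuous, because \<open>\<nabla>\<^sup>jG\<close> varies continuously in the \<open>L\<^sup>1\<close> space weighted by the
  majorant of \<open>F\<close>, and a pointwise limit along a subsequence solves the original equation.
\<close>

section \<open>The model kernel\<close>

text \<open>The decay \<open>t powr (-\<nu> - j/d)\<close> claimed for the solution cannot itself
  serve as ansatz: by the scaling that defines \<open>r0\<close> it bounds the nonlinearity only by
  a multiple of \<open>s powr (-\<nu> - 1)\<close>, which is not integrable at \<open>s = 0\<close>.
  The profile \<theta> keeps the spatial information that this bound discards. It works because
  averaging \<open>\<theta> s\<close> once more against the kernel at time \<open>t - s\<close>
  returns at most a constant times \<open>\<theta> t\<close>, the larger of \<open>s\<close> and
  \<open>t - s\<close> being at least \<open>t / 2\<close>. So \<theta> can stay inside the time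
  integral instead of being replaced by its supremum. This averaging is a linear operation, hence
  the forcing must be bounded linearly in \<theta>; that is possible when the power
  \<open>|p| / q\<close> of \<theta> is at least one, which is the reason for lowering
  \<open>q\<close>. The result is then turned from \<theta> back into
  \<open>\<theta> powr (1/q)\<close> by the Morrey bound at time \<open>t\<close>. All constants
  involved are independent of \<phi> and \<open>T\<close>, so the smallness of the data can be fixed
  before either is given.\<close>

definition kern :: "real \<Rightarrow> real \<Rightarrow> 'a::euclidean_space \<Rightarrow> 'a \<Rightarrow> real" where
  "kern L \<rho> x y = \<rho> powr L * (\<rho> + dist x y) powr (- (real DIM('a) + L))"

lemma kern_nonneg [simp]: "0 \<le> kern L \<rho> x y"
  by (simp add: kern_def)

lemma kern_commute: "kern L \<rho> x y = kern L \<rho> y x"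
  by (simp add: kern_def dist_commute)

lemma kern_measurable [measurable]:
  fixes f g :: "'b \<Rightarrow> 'a::euclidean_space"
  assumes [measurable]: "r \<in> borel_measurable M" "f \<in> borel_measurable M" "g \<in> borel_measurable M"
  shows "(\<lambda>z. kern L (r z) (f z) (g z)) \<in> borel_measurable M"
  unfolding kern_def by measurable

text \<open>The two power factors are monotone in opposite directions; each hypothesis costs its own
  exponent of \<open>c\<close>, whence \<open>L + (N + L) = N + 2L\<close>. Every later change of
  radius or of base point goes through this inequality.\<close>

lemma kern_compare:
  fixes x y x' y' :: "'a::euclidean_space"
  assumes "0 < \<rho>" "0 < \<rho>'" "0 < L" "0 < c" "\<rho> \<le> c * \<rho>'"
    and "\<rho>' + dist x' y' \<le> c * (\<rho> + dist x y)"
  shows "kern L \<rho> x y \<le> c powr (real DIM('a) + 2 * L) * kern L \<rho>' x' y'"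
proof -
  let ?n = "real DIM('a) + L"
  have pos: "0 < \<rho> + dist x y" "0 < \<rho>' + dist x' y'"
    using assms by (auto intro: add_pos_nonneg)
  have 1: "\<rho> powr L \<le> c powr L * \<rho>' powr L"
    using assms by (subst powr_mult[symmetric]) (auto intro: powr_mono2)
  have "(c * (\<rho> + dist x y)) powr (- ?n) \<le> (\<rho>' + dist x' y') powr (- ?n)"
    using assms pos by (intro powr_mono2') auto
  then have "c powr (- ?n) * (\<rho> + dist x y) powr (- ?n) \<le> (\<rho>' + dist x' y') powr (- ?n)"
    using assms pos by (simp add: powr_mult)
  then have "c powr ?n * (c powr (- ?n) * (\<rho> + dist x y) powr (- ?n))
      \<le> c powr ?n * (\<rho>' + dist x' y') powr (- ?n)"
    by (intro mult_left_mono) auto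
  then have 2: "(\<rho> + dist x y) powr (- ?n) \<le> c powr ?n * (\<rho>' + dist x' y') powr (- ?n)"
    using assms by (simp add: mult.assoc[symmetric] flip: powr_add)
  have "kern L \<rho> x y \<le> (c powr L * \<rho>' powr L) * (c powr ?n * (\<rho>' + dist x' y') powr (- ?n))"
    unfolding kern_def by (intro mult_mono 1 2) auto
  also have "\<dots> = (c powr L * c powr ?n) * kern L \<rho>' x' y'"
    by (simp add: kern_def mult_ac)
  also have "c powr L * c powr ?n = c powr (real DIM('a) + 2 * L)"
    by (simp add: algebra_simps flip: powr_add)
  finally show ?thesis .
qed

text \<open>The value of a geometric series of ratio \<open>2 powr (-L)\<close>, one term for each
  dyadic shell. The dimension enters through the type alone, hence the \<open>itself\<close>
  argument.\<close>

definition kern_mass :: "real \<Rightarrow> 'a::euclidean_space itself \<Rightarrow> real" where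
  "kern_mass L _ = unit_ball_vol DIM('a) * 2 ^ DIM('a) / (1 - 2 powr (- L))"

lemma kern_mass_pos: "0 < L \<Longrightarrow> 0 < kern_mass L TYPE('a::euclidean_space)"
  unfolding kern_mass_def by (auto intro!: divide_pos_pos mult_pos_pos simp: powr_minus_divide)

lemma ennreal_le_suminf: "f n \<le> (\<Sum>n. f n)" for f :: "nat \<Rightarrow> ennreal"
  using sum_le_suminf[of f "{n}"] by simp

lemma dyadic_bracket:
  fixes X :: real
  assumes "1 \<le> X"
  obtains n :: nat where "2 ^ n \<le> X" "X < 2 ^ Suc n"
proof -
  obtain k where k: "X < 2 ^ k" using real_arch_pow[of 2 X] by auto
  define n where "n = (LEAST n. X < 2 ^ Suc n)"
  have ex: "X < 2 ^ Suc k"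
    using k by (rule less_le_trans) simp
  have 1: "X < 2 ^ Suc n"
    unfolding n_def by (rule LeastI[of "\<lambda>n. X < 2 ^ Suc n", OF ex])
  have 2: "2 ^ n \<le> X"
  proof (cases n)
    case 0
    then show ?thesis using assms by simp
  next
    case (Suc j)
    then have "\<not> X < 2 ^ Suc j"
      unfolding n_def using not_less_Least[of j "\<lambda>n. X < 2 ^ Suc n"] by auto
    then show ?thesis using Suc by simp
  qed
  show ?thesis using that[OF 2 1] .
qed

text \<open>Where \<open>\<rho> + |x - y|\<close> is comparable to \<open>2^n \<rho>\<close>, the
  kernel is at most \<open>\<rho>^(-N) 2^(-n(N+L))\<close>, while the ball containing this shell has
  volume of order \<open>2^(nN) \<rho>^N\<close>. The radius cancels and \<open>2^(-nL)\<close>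
  remains, which is summable as \<open>L > 0\<close>.\<close>

lemma nn_integral_kern:
  fixes x :: "'a::euclidean_space"
  assumes "0 < \<rho>" "0 < L"
  shows "(\<integral>\<^sup>+y. ennreal (kern L \<rho> x y) \<partial>lborel) \<le> ennreal (kern_mass L TYPE('a))"
proof -
  let ?N = "real DIM('a)"
  let ?c = "\<lambda>n::nat. \<rho> powr (- ?N) * (2 ^ n) powr (- (?N + L))"
  let ?B = "\<lambda>n::nat. ball x (2 ^ Suc n * \<rho>)"
  let ?v = "unit_ball_vol DIM('a)"
  have pt: "ennreal (kern L \<rho> x y) \<le> (\<Sum>n. ennreal (?c n) * indicator (?B n) y)" for y
  proof -
    obtain n :: nat where n: "2 ^ n \<le> (\<rho> + dist x y) / \<rho>" "(\<rho> + dist x y) / \<rho> < 2 ^ Suc n"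
      using dyadic_bracket[of "(\<rho> + dist x y) / \<rho>"] assms by auto
    have n1: "2 ^ n * \<rho> \<le> \<rho> + dist x y" "dist x y < 2 ^ Suc n * \<rho>"
      using n assms by (auto simp: field_simps)
    have "(\<rho> + dist x y) powr (- (?N + L)) \<le> (2 ^ n * \<rho>) powr (- (?N + L))"
      using n1 assms by (intro powr_mono2') auto
    then have "kern L \<rho> x y \<le> \<rho> powr L * (2 ^ n * \<rho>) powr (- (?N + L))"
      unfolding kern_def by (intro mult_left_mono) auto
    also have "\<dots> = (\<rho> powr L * \<rho> powr (- (?N + L))) * (2 ^ n) powr (- (?N + L))"
      using assms by (simp add: powr_mult)
    also have "\<rho> powr L * \<rho> powr (- (?N + L)) = \<rho> powr (- ?N)"
      using assms by (simp flip: powr_add)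
    finally have "ennreal (kern L \<rho> x y) \<le> ennreal (?c n) * indicator (?B n) y"
      using n1 by (auto simp: ennreal_leI)
    also have "\<dots> \<le> (\<Sum>n. ennreal (?c n) * indicator (?B n) y)"
      by (rule ennreal_le_suminf)
    finally show ?thesis .
  qed
  have term_eq: "(\<integral>\<^sup>+y. ennreal (?c n) * indicator (?B n) y \<partial>lborel)
      = ennreal (?v * 2 ^ DIM('a) * (2 powr (- L)) ^ n)" for n
  proof -
    have "(\<integral>\<^sup>+y. ennreal (?c n) * indicator (?B n) y \<partial>lborel) = ennreal (?c n) * emeasure lborel (?B n)"
      by (subst nn_integral_cmult_indicator) auto
    also have "\<dots> = ennreal (?c n) * ennreal (?v * (2 ^ Suc n * \<rho>) ^ DIM('a))"
      using assms by (subst emeasure_ball) auto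
    also have "\<dots> = ennreal (?c n * (?v * (2 ^ Suc n * \<rho>) ^ DIM('a)))"
      using assms by (subst ennreal_mult) auto
    also have "?c n * (?v * (2 ^ Suc n * \<rho>) ^ DIM('a)) = ?v * 2 ^ DIM('a) * (2 powr (- L)) ^ n"
    proof -
      have a: "\<rho> powr (- ?N) * \<rho> ^ DIM('a) = 1"
        using assms by (simp add: powr_minus powr_realpow)
      have b: "(2 ^ n) powr (- (?N + L)) * (2 ^ n) ^ DIM('a) = (2 powr (- L)) ^ n"
      proof -
        have "(2 ^ n) powr (- (?N + L)) * (2 ^ n) ^ DIM('a) = (2 ^ n) powr (- (?N + L)) * (2 ^ n) powr ?N"
          by (simp add: powr_realpow)
        also have "\<dots> = (2 ^ n) powr (- L)" by (simp flip: powr_add)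
        also have "\<dots> = (2 powr (- L)) ^ n"
          by (simp add: powr_powr mult.commute flip: powr_realpow)
        finally show ?thesis .
      qed
      have "?c n * (?v * (2 ^ Suc n * \<rho>) ^ DIM('a)) = (\<rho> powr (- ?N) * \<rho> ^ DIM('a)) * ((2 ^ n) powr (- (?N + L)) * (2 ^ n) ^ DIM('a)) * (?v * 2 ^ DIM('a))"
        by (simp add: power_mult_distrib)
      also have "\<dots> = ?v * 2 ^ DIM('a) * (2 powr (- L)) ^ n"
        unfolding a b by simp
      finally show ?thesis .
    qed
    finally show ?thesis .
  qed
  have r: "0 \<le> 2 powr (- L)" "2 powr (- L) < 1"
    using assms by (auto simp: powr_minus_divide)
  have "(\<integral>\<^sup>+y. ennreal (kern L \<rho> x y) \<partial>lborel)
      \<le> (\<integral>\<^sup>+y. (\<Sum>n. ennreal (?c n) * indicator (?B n) y) \<partial>lborel)"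
    by (intro nn_integral_mono pt)
  also have "\<dots> = (\<Sum>n. ennreal (?v * 2 ^ DIM('a) * (2 powr (- L)) ^ n))"
    unfolding term_eq[symmetric]
    by (rule nn_integral_suminf) (intro borel_measurable_times_ennreal borel_measurable_const borel_measurable_indicator, simp)
  also have "\<dots> = ennreal (\<Sum>n. ?v * 2 ^ DIM('a) * (2 powr (- L)) ^ n)"
    using r by (intro suminf_ennreal2 summable_mult summable_geometric) auto
  also have "(\<Sum>n. ?v * 2 ^ DIM('a) * (2 powr (- L)) ^ n) = kern_mass L TYPE('a)"
    using r by (subst suminf_mult) (auto simp: suminf_geometric kern_mass_def intro!: summable_geometric)
  finally show ?thesis by simp
qed

text \<open>A pointwise substitute for the semigroup law (a "3G inequality"): on a path from
  \<open>x\<close> to \<open>z\<close> through \<open>y\<close>, one of the two legs is so long,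
  compared with the larger radius, that its kernel is already bounded by the kernel of
  \<open>(x, z)\<close>. The other factor is kept, so integrating in \<open>y\<close> later costs
  only the masses.\<close>

lemma kern_mult_le:
  fixes x y z :: "'a::euclidean_space"
  assumes "0 < \<rho>" "0 < \<rho>'" "0 < L"
  shows "kern L \<rho> x y * kern L \<rho>' y z
    \<le> 3 powr (real DIM('a) + 2 * L) * kern L (max \<rho> \<rho>') x z * (kern L \<rho> x y + kern L \<rho>' y z)"
proof -
  have main: "kern L r a b * kern L r' b c
      \<le> 3 powr (real DIM('a) + 2 * L) * kern L r a c * (kern L r a b + kern L r' b c)"
    if r: "0 < r'" "r' \<le> r" for r r' and a b c :: 'a
  proof -
    let ?K = "3 powr (real DIM('a) + 2 * L) * kern L r a c"
    have tri: "dist a c \<le> dist a b + dist b c" by (rule dist_triangle)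
    have K0: "0 \<le> ?K" by simp
    have arith3: "r + C \<le> 3 * (r + A)" if "0 \<le> A" "B \<le> r" "C \<le> A + B" for A B C :: real
      using that r by argo
    have arith2: "r + C \<le> 3 * (r' + B)" if "A \<le> B" "r \<le> B" "C \<le> A + B" for A B C :: real
      using that r by argo
    have arith: "r + C \<le> 3 * (r + A)" if "0 \<le> A" "B \<le> A" "C \<le> A + B" for A B C :: real
      using that r by argo
    \<comment> \<open>The leg from \<open>a\<close> to \<open>b\<close> carries the larger radius
      \<open>r\<close> and suffices when it is the longer one. If the leg from \<open>b\<close> to
      \<open>c\<close> is longer, it compensates for its smaller radius only when its length exceeds
      \<open>r\<close>; otherwise both legs are at most \<open>r\<close>, and the first leg suffices
      through its radius.\<close>
    consider "dist b c \<le> dist a b" | "dist a b \<le> dist b c" "r \<le> dist b c" | "dist a b \<le> dist b c" "dist b c \<le> r"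
      by linarith
    then have "kern L r a b \<le> ?K \<or> kern L r' b c \<le> ?K"
    proof cases
      case 1
      then have "r + dist a c \<le> 3 * (r + dist a b)"
        using arith[of "dist a b" "dist b c"] tri r by force
      then have "kern L r a b \<le> ?K" using r assms by (intro kern_compare) auto
      then show ?thesis ..
    next
      case 2
      then have "r + dist a c \<le> 3 * (r' + dist b c)"
        using arith2[of "dist a b" "dist b c"] tri by force
      moreover have "r' \<le> 3 * r" using r by linarith
      ultimately have "kern L r' b c \<le> ?K" using r assms by (intro kern_compare) auto
      then show ?thesis ..
    next
      case 3
      then have "r + dist a c \<le> 3 * (r + dist a b)"
        using arith3[of "dist a b" "dist b c"] tri r by force
      then have "kern L r a b \<le> ?K" using r assms by (intro kern_compare) auto
      then show ?thesis ..
    qed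
    then show ?thesis
    proof
      assume "kern L r a b \<le> ?K"
      then have "kern L r a b * kern L r' b c \<le> ?K * kern L r' b c"
        by (intro mult_right_mono) auto
      also have "\<dots> \<le> ?K * (kern L r a b + kern L r' b c)"
        using K0 by (intro mult_left_mono) auto
      finally show ?thesis .
    next
      assume "kern L r' b c \<le> ?K"
      then have "kern L r a b * kern L r' b c \<le> kern L r a b * ?K"
        by (intro mult_left_mono) auto
      also have "\<dots> = ?K * kern L r a b" by simp
      also have "\<dots> \<le> ?K * (kern L r a b + kern L r' b c)"
        using K0 by (intro mult_left_mono) auto
      finally show ?thesis .
    qed
  qed
  show ?thesis
  proof (cases "\<rho>' \<le> \<rho>")
    case True
    then show ?thesis using main[of \<rho>' \<rho> x y z] assms by (simp add: max_def)
  next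
    case False
    then show ?thesis using main[of \<rho> \<rho>' z y x] assms
      by (simp add: max_def kern_commute[of L _ y x] kern_commute[of L _ z y] kern_commute[of L _ z x] mult.commute add.commute)
  qed
qed

lemma nn_integral_kern_kern:
  fixes x z :: "'a::euclidean_space"
  assumes "0 < \<rho>" "0 < \<rho>'" "0 < L"
  shows "(\<integral>\<^sup>+y. ennreal (kern L \<rho> x y) * ennreal (kern L \<rho>' y z) \<partial>lborel)
    \<le> ennreal (3 powr (real DIM('a) + 2 * L) * (2 * kern_mass L TYPE('a)) * kern L (max \<rho> \<rho>') x z)"
proof -
  let ?K = "3 powr (real DIM('a) + 2 * L) * kern L (max \<rho> \<rho>') x z"
  let ?m = "kern_mass L TYPE('a)"
  have m0: "0 \<le> ?m" using kern_mass_pos[OF assms(3)] less_imp_le by blast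
  have "(\<integral>\<^sup>+y. ennreal (kern L \<rho> x y) * ennreal (kern L \<rho>' y z) \<partial>lborel)
     \<le> (\<integral>\<^sup>+y. ennreal ?K * (ennreal (kern L \<rho> x y) + ennreal (kern L \<rho>' z y)) \<partial>lborel)"
    using kern_mult_le[OF assms, of x _ z]
    by (intro nn_integral_mono)
       (simp add: kern_commute[of L \<rho>' z] ennreal_leI flip: ennreal_mult ennreal_plus)
  also have "\<dots> = ennreal ?K * ((\<integral>\<^sup>+y. ennreal (kern L \<rho> x y) \<partial>lborel) + (\<integral>\<^sup>+y. ennreal (kern L \<rho>' z y) \<partial>lborel))"
    by (simp add: nn_integral_cmult nn_integral_add)
  also have "\<dots> \<le> ennreal ?K * (ennreal ?m + ennreal ?m)"
    using assms by (intro mult_left_mono add_mono nn_integral_kern) auto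
  also have "\<dots> = ennreal (?K * (2 * ?m))"
    using m0 by (simp flip: ennreal_plus ennreal_mult)
  finally show ?thesis by (simp add: mult_ac)
qed

section \<open>Averages of nonnegative data\<close>

text \<open>Extended values make Tonelli and the changes of scale available without integrability of
  \<Phi>; finiteness enters later through the Morrey condition.\<close>

definition smear :: "real \<Rightarrow> real \<Rightarrow> ('a::euclidean_space \<Rightarrow> real) \<Rightarrow> 'a \<Rightarrow> ennreal" where
  "smear L \<rho> \<Phi> x = (\<integral>\<^sup>+z. ennreal (kern L \<rho> x z) * ennreal (\<Phi> z) \<partial>lborel)"

lemma smear_measurable [measurable]:
  fixes f :: "'b \<Rightarrow> 'a::euclidean_space"
  assumes [measurable]: "r \<in> borel_measurable M" "f \<in> borel_measurable M" "\<Phi> \<in> borel_measurable borel"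
  shows "(\<lambda>z. smear L (r z) \<Phi> (f z)) \<in> borel_measurable M"
  unfolding smear_def by measurable

text \<open>At distance less than \<rho> the kernel of radius \<rho> changes by a bounded factor
  only, so it may be replaced by its mean over such a ball. Exchanging the integrals then moves the
  averaging onto \<Phi>. Only averages at the single scale \<rho> are used.\<close>

lemma smear_le_average:
  fixes x :: "'a::euclidean_space"
  assumes \<rho>: "0 < \<rho>" "0 < L" and E: "0 \<le> E" and [measurable]: "\<Phi> \<in> borel_measurable borel"
    and av: "\<And>x. (\<integral>\<^sup>+y. ennreal (\<Phi> y) * indicator (ball x \<rho>) y \<partial>lborel) \<le> ennreal (E * measure lborel (ball x \<rho>))"
  shows "smear L \<rho> \<Phi> x \<le> ennreal (2 powr (real DIM('a) + 2 * L) * kern_mass L TYPE('a) * E)"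
proof -
  let ?c = "2 powr (real DIM('a) + 2 * L)"
  let ?m = "kern_mass L TYPE('a)"
  define b where "b = measure lborel (ball x \<rho>)"
  have m0: "0 \<le> ?m" using kern_mass_pos[OF \<rho>(2)] less_imp_le by blast
  have b: "0 < b" unfolding b_def using \<rho> by (simp add: content_ball_pos)
  have bb: "measure lborel (ball y \<rho>) = b" for y :: 'a
    unfolding b_def using \<rho> by (simp add: content_ball)
  have eb: "emeasure lborel (ball y \<rho>) = ennreal b" for y :: 'a
    using emeasure_eq_ennreal_measure[of lborel "ball y \<rho>"] emeasure_lborel_ball_finite[of y \<rho>] bb[of y]
    by (auto simp: less_top)
  have pt: "ennreal b * (ennreal (kern L \<rho> x y) * ennreal (\<Phi> y))
      \<le> (\<integral>\<^sup>+z. ennreal ?c * ennreal (kern L \<rho> x z) * (ennreal (\<Phi> y) * indicator (ball z \<rho>) y) \<partial>lborel)" for y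
  proof -
    have k: "kern L \<rho> x y \<le> ?c * kern L \<rho> x z" if "z \<in> ball y \<rho>" for z
    proof -
      have "dist x z \<le> dist x y + dist y z" by (rule dist_triangle)
      moreover have "dist y z < \<rho>" "0 \<le> dist x y" using that by auto
      ultimately have "\<rho> + dist x z \<le> 2 * (\<rho> + dist x y)" by argo
      then show ?thesis using \<rho> by (intro kern_compare) auto
    qed
    have "ennreal b * (ennreal (kern L \<rho> x y) * ennreal (\<Phi> y))
        = (\<integral>\<^sup>+z. (ennreal (kern L \<rho> x y) * ennreal (\<Phi> y)) * indicator (ball y \<rho>) z \<partial>lborel)"
      by (subst nn_integral_cmult_indicator) (auto simp: eb mult.commute)
    also have "\<dots> \<le> (\<integral>\<^sup>+z. ennreal ?c * ennreal (kern L \<rho> x z) * (ennreal (\<Phi> y) * indicator (ball z \<rho>) y) \<partial>lborel)"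
    proof (intro nn_integral_mono)
      fix z
      show "(ennreal (kern L \<rho> x y) * ennreal (\<Phi> y)) * indicator (ball y \<rho>) z
        \<le> ennreal ?c * ennreal (kern L \<rho> x z) * (ennreal (\<Phi> y) * indicator (ball z \<rho>) y)"
      proof (cases "z \<in> ball y \<rho>")
        case True
        then have "y \<in> ball z \<rho>" by (simp add: dist_commute)
        moreover have "ennreal (kern L \<rho> x y) \<le> ennreal ?c * ennreal (kern L \<rho> x z)"
          using k[OF True] by (simp add: ennreal_leI flip: ennreal_mult)
        ultimately show ?thesis using True by (simp add: mult_right_mono flip: mult.assoc)
      qed auto
    qed
    finally show ?thesis .
  qed
  have meas: "(\<lambda>(y, z). ennreal ?c * ennreal (kern L \<rho> x z) * (ennreal (\<Phi> y) * indicator (ball z \<rho>) y))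
      \<in> borel_measurable (lborel \<Otimes>\<^sub>M lborel)"
  proof -
    have "(\<lambda>p. indicator {p. dist (snd p) (fst p) < \<rho>} p :: ennreal)
        \<in> borel_measurable (lborel \<Otimes>\<^sub>M (lborel :: 'a measure))"
      by measurable
    then have [measurable]: "(\<lambda>p. indicator (ball (snd p) \<rho>) (fst p) :: ennreal)
        \<in> borel_measurable (lborel \<Otimes>\<^sub>M (lborel :: 'a measure))"
      by (rule measurable_cong[THEN iffD1, rotated]) (auto simp: indicator_def)
    show ?thesis by (simp add: case_prod_unfold)
  qed
  have "ennreal b * smear L \<rho> \<Phi> x = (\<integral>\<^sup>+y. ennreal b * (ennreal (kern L \<rho> x y) * ennreal (\<Phi> y)) \<partial>lborel)"
    unfolding smear_def by (subst nn_integral_cmult) auto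
  also have "\<dots> \<le> (\<integral>\<^sup>+y. (\<integral>\<^sup>+z. ennreal ?c * ennreal (kern L \<rho> x z) * (ennreal (\<Phi> y) * indicator (ball z \<rho>) y) \<partial>lborel) \<partial>lborel)"
    by (intro nn_integral_mono pt)
  also have "\<dots> = (\<integral>\<^sup>+z. (\<integral>\<^sup>+y. ennreal ?c * ennreal (kern L \<rho> x z) * (ennreal (\<Phi> y) * indicator (ball z \<rho>) y) \<partial>lborel) \<partial>lborel)"
    using lborel_pair.Fubini'[OF meas] by simp
  also have "\<dots> = (\<integral>\<^sup>+z. ennreal ?c * ennreal (kern L \<rho> x z) * (\<integral>\<^sup>+y. ennreal (\<Phi> y) * indicator (ball z \<rho>) y \<partial>lborel) \<partial>lborel)"
    by (intro nn_integral_cong nn_integral_cmult borel_measurable_times_ennreal borel_measurable_indicator) auto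
  also have "\<dots> \<le> (\<integral>\<^sup>+z. ennreal ?c * ennreal (kern L \<rho> x z) * ennreal (E * b) \<partial>lborel)"
    using av by (intro nn_integral_mono mult_left_mono) (auto simp: bb)
  also have "\<dots> = ennreal ?c * ennreal (E * b) * (\<integral>\<^sup>+z. ennreal (kern L \<rho> x z) \<partial>lborel)"
    by (subst nn_integral_cmult[symmetric]) (auto simp: mult_ac)
  also have "\<dots> \<le> ennreal ?c * ennreal (E * b) * ennreal ?m"
    using \<rho> by (intro mult_left_mono nn_integral_kern) auto
  also have "\<dots> = ennreal b * ennreal (?c * ?m * E)"
    using m0 E b by (simp add: mult_ac flip: ennreal_mult)
  finally show ?thesis
    using b by (simp add: ennreal_mult_le_mult_iff)
qed

lemma smear_compare:
  fixes x :: "'a::euclidean_space"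
  assumes "0 < \<rho>" "0 < \<rho>'" "0 < L" "1 \<le> c" "\<rho> \<le> c * \<rho>'" "\<rho>' \<le> c * \<rho>"
    and [measurable]: "\<Phi> \<in> borel_measurable borel"
  shows "smear L \<rho> \<Phi> x \<le> ennreal (c powr (real DIM('a) + 2 * L)) * smear L \<rho>' \<Phi> x"
proof -
  let ?c = "c powr (real DIM('a) + 2 * L)"
  have k: "kern L \<rho> x z \<le> ?c * kern L \<rho>' x z" for z
    using assms mult_right_mono[of 1 c "dist x z"] by (intro kern_compare) (auto simp: distrib_left)
  have "smear L \<rho> \<Phi> x \<le> (\<integral>\<^sup>+z. ennreal ?c * (ennreal (kern L \<rho>' x z) * ennreal (\<Phi> z)) \<partial>lborel)"
    unfolding smear_def using k
    by (intro nn_integral_mono) (simp add: mult.assoc[symmetric] mult_right_mono ennreal_leI flip: ennreal_mult)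
  then show ?thesis unfolding smear_def by (subst (asm) nn_integral_cmult) auto
qed

text \<open>After Tonelli this is the composition bound for two kernels. With radii belonging to the
  times \<open>t - s\<close> and \<open>s\<close> it shows that the forcing at time \<open>s\<close>
  produces at time \<open>t\<close> a multiple of the profile at a comparable time.\<close>

lemma nn_integral_kern_smear:
  fixes x :: "'a::euclidean_space"
  assumes "0 < \<rho>" "0 < \<rho>'" "0 < L" and [measurable]: "\<Phi> \<in> borel_measurable borel"
  shows "(\<integral>\<^sup>+y. ennreal (kern L \<rho> x y) * smear L \<rho>' \<Phi> y \<partial>lborel)
    \<le> ennreal (3 powr (real DIM('a) + 2 * L) * (2 * kern_mass L TYPE('a))) * smear L (max \<rho> \<rho>') \<Phi> x"
proof -
  let ?C = "3 powr (real DIM('a) + 2 * L) * (2 * kern_mass L TYPE('a))"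
  have C0: "0 \<le> ?C" using kern_mass_pos[OF assms(3), where 'a='a] by simp
  have "(\<integral>\<^sup>+y. ennreal (kern L \<rho> x y) * smear L \<rho>' \<Phi> y \<partial>lborel)
     = (\<integral>\<^sup>+y. (\<integral>\<^sup>+z. ennreal (kern L \<rho> x y) * (ennreal (kern L \<rho>' y z) * ennreal (\<Phi> z)) \<partial>lborel) \<partial>lborel)"
    unfolding smear_def by (intro nn_integral_cong nn_integral_cmult[symmetric]) auto
  also have "\<dots> = (\<integral>\<^sup>+z. (\<integral>\<^sup>+y. ennreal (kern L \<rho> x y) * (ennreal (kern L \<rho>' y z) * ennreal (\<Phi> z)) \<partial>lborel) \<partial>lborel)"
    by (rule lborel_pair.Fubini'[symmetric]) measurable
  also have "\<dots> = (\<integral>\<^sup>+z. (\<integral>\<^sup>+y. ennreal (kern L \<rho> x y) * ennreal (kern L \<rho>' y z) \<partial>lborel) * ennreal (\<Phi> z) \<partial>lborel)"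
    by (intro nn_integral_cong) (subst nn_integral_multc[symmetric], auto simp: mult_ac)
  also have "\<dots> \<le> (\<integral>\<^sup>+z. ennreal (?C * kern L (max \<rho> \<rho>') x z) * ennreal (\<Phi> z) \<partial>lborel)"
    using nn_integral_kern_kern[OF assms(1-3)] by (intro nn_integral_mono mult_right_mono) auto
  also have "\<dots> = ennreal ?C * smear L (max \<rho> \<rho>') \<Phi> x"
    unfolding smear_def ennreal_mult[OF C0 kern_nonneg] mult.assoc[of "ennreal ?C"]
    by (rule nn_integral_cmult) simp
  finally show ?thesis .
qed

text \<open>A Young inequality with a free level \<open>v\<close>: below \<open>v\<close> by
  monotonicity, above it since \<open>w powr s \<le> w\<close> for \<open>w \<ge> 1\<close>. With
  \<open>v\<close> taken as a bound for the mean of \<open>b\<close>, integration gives Jensen's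
  inequality up to a constant.\<close>

lemma powr_le_one_plus:
  fixes b v s :: real
  assumes v: "0 < v" and b: "0 \<le> b" and s: "0 \<le> s" "s \<le> 1"
  shows "b powr s \<le> v powr s * (1 + b / v)"
proof (cases "b \<le> v")
  case True
  then have "b powr s \<le> v powr s" using b s by (intro powr_mono2) auto
  also have "\<dots> \<le> v powr s * (1 + b / v)" using v b by (simp add: distrib_left)
  finally show ?thesis .
next
  case False
  define w where "w = b / v"
  have w: "1 \<le> w" using False v by (simp add: w_def)
  have "b powr s = v powr s * w powr s"
    using v b by (subst powr_mult[symmetric]) (auto simp: w_def)
  also have "w powr s \<le> w powr 1" using w s by (intro powr_mono) auto
  also have "w powr 1 \<le> 1 + w" using w by simp
  finally show ?thesis by (simp add: w_def mult_left_mono)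
qed

text \<open>Hoelder's inequality, up to a constant: integrate
  \<open>\<bar>f\<bar> \<le> v powr (1/q) * (1 + \<bar>f\<bar> powr q / v)\<close>.\<close>

lemma nn_integral_kern_le_smear_powr:
  fixes x :: "'a::euclidean_space"
  assumes "0 < \<rho>" "0 < L" "1 \<le> q" "0 \<le> v" and [measurable]: "f \<in> borel_measurable borel"
    and v: "smear L \<rho> (\<lambda>z. \<bar>f z\<bar> powr q) x = ennreal v"
  shows "(\<integral>\<^sup>+z. ennreal (kern L \<rho> x z) * ennreal \<bar>f z\<bar> \<partial>lborel)
    \<le> ennreal ((kern_mass L TYPE('a) + 1) * v powr (1 / q))"
proof (cases "v = 0")
  case True
  have kpos: "kern L \<rho> x z > 0" for z
    unfolding kern_def using assms add_pos_nonneg[of \<rho> "dist x z"] by auto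
  have "(\<integral>\<^sup>+z. ennreal (kern L \<rho> x z) * ennreal (\<bar>f z\<bar> powr q) \<partial>lborel) = 0"
    using v True unfolding smear_def by simp
  then have "AE z in lborel. ennreal (kern L \<rho> x z) * ennreal (\<bar>f z\<bar> powr q) = 0"
    by (subst (asm) nn_integral_0_iff_AE) auto
  then have "AE z in lborel. ennreal (kern L \<rho> x z) * ennreal \<bar>f z\<bar> = 0"
    by eventually_elim (use kpos in \<open>auto simp: ennreal_mult_eq_top_iff not_le[symmetric] dest: leD\<close>)
  then have "(\<integral>\<^sup>+z. ennreal (kern L \<rho> x z) * ennreal \<bar>f z\<bar> \<partial>lborel) = 0"
    by (subst nn_integral_0_iff_AE) auto
  then show ?thesis by simp
next
  case False
  then have vp: "0 < v" using assms by simp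
  have m0: "0 \<le> kern_mass L TYPE('a)" using kern_mass_pos[OF assms(2), where 'a='a] by simp
  have pt: "\<bar>a\<bar> \<le> v powr (1 / q) * (1 + \<bar>a\<bar> powr q / v)" for a :: real
    using powr_le_one_plus[of v "\<bar>a\<bar> powr q" "1 / q"] vp assms by (simp add: powr_powr)
  let ?w = "v powr (1 / q)"
  have "(\<integral>\<^sup>+z. ennreal (kern L \<rho> x z) * ennreal \<bar>f z\<bar> \<partial>lborel)
      \<le> (\<integral>\<^sup>+z. ennreal ?w * (ennreal (kern L \<rho> x z) + ennreal (1 / v) * (ennreal (kern L \<rho> x z) * ennreal (\<bar>f z\<bar> powr q))) \<partial>lborel)"
  proof (intro nn_integral_mono)
    fix z
    have "kern L \<rho> x z * \<bar>f z\<bar> \<le> kern L \<rho> x z * (?w * (1 + \<bar>f z\<bar> powr q / v))"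
      by (intro mult_left_mono pt) auto
    also have "\<dots> = ?w * (kern L \<rho> x z + 1 / v * (kern L \<rho> x z * \<bar>f z\<bar> powr q))"
      by (simp add: algebra_simps)
    finally show "ennreal (kern L \<rho> x z) * ennreal \<bar>f z\<bar> \<le> ennreal ?w * (ennreal (kern L \<rho> x z)
        + ennreal (1 / v) * (ennreal (kern L \<rho> x z) * ennreal (\<bar>f z\<bar> powr q)))"
      using vp by (simp add: ennreal_leI flip: ennreal_mult ennreal_plus)
  qed
  also have "\<dots> = ennreal ?w * ((\<integral>\<^sup>+z. ennreal (kern L \<rho> x z) \<partial>lborel) + ennreal (1 / v) * smear L \<rho> (\<lambda>z. \<bar>f z\<bar> powr q) x)"
    unfolding smear_def by (simp add: nn_integral_cmult nn_integral_add)
  also have "\<dots> \<le> ennreal ?w * (ennreal (kern_mass L TYPE('a)) + ennreal (1 / v) * ennreal v)"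
    unfolding v using assms by (intro mult_left_mono add_right_mono nn_integral_kern) auto
  also have "\<dots> = ennreal ((kern_mass L TYPE('a) + 1) * ?w)"
    using vp m0 by (simp add: mult.commute flip: ennreal_mult ennreal_plus ennreal_1)
  finally show ?thesis .
qed

section \<open>Time integrals of beta type\<close>

lemma nn_integral_powr_from_0:
  assumes "-1 < a" "0 \<le> t"
  shows "(\<integral>\<^sup>+s. ennreal (s powr a) * indicator {0<..<t} s \<partial>lborel) = ennreal (t powr (a + 1) / (a + 1))"
proof -
  have "((\<lambda>s. s powr a) has_integral (t powr (a+1) / (a+1))) {0<..<t}"
    using has_integral_powr_from_0[OF assms] by (simp add: has_integral_Icc_iff_Ioo)
  then have "((\<lambda>s. if s \<in> {0<..<t} then s powr a else 0) has_integral (t powr (a+1) / (a+1))) UNIV"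
    by (subst has_integral_restrict_UNIV)
  then have "(\<integral>\<^sup>+s. ennreal (if s \<in> {0<..<t} then s powr a else 0) \<partial>lborel) = ennreal (t powr (a + 1) / (a + 1))"
    by (intro nn_integral_has_integral_lborel) auto
  then show ?thesis
    by (subst (asm) nn_integral_cong[where v = "\<lambda>s. ennreal (s powr a) * indicator {0<..<t} s"]) auto
qed

lemma nn_integral_powr_to:
  assumes "\<alpha> < 1" "0 \<le> r"
  shows "(\<integral>\<^sup>+s. ennreal ((t - s) powr (- \<alpha>)) * indicator {t-r<..<t} s \<partial>lborel) = ennreal (r powr (1 - \<alpha>) / (1 - \<alpha>))"
proof -
  have "(\<integral>\<^sup>+s. ennreal ((t - s) powr (- \<alpha>)) * indicator {t-r<..<t} s \<partial>lborel)
      = (\<integral>\<^sup>+s. ennreal (s powr (- \<alpha>)) * indicator {0<..<r} s \<partial>lborel)"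
    by (subst nn_integral_real_affine[where c = "-1" and t = t])
       (auto intro!: nn_integral_cong simp: indicator_def)
  also have "\<dots> = ennreal (r powr (1 - \<alpha>) / (1 - \<alpha>))"
    using nn_integral_powr_from_0[of "- \<alpha>" r] assms by simp
  finally show ?thesis .
qed

text \<open>An explicit upper bound for the beta function B(1-\<alpha>, \<beta>). The first summand
  comes from \<open>s \<le> t/2\<close>, where \<open>(t - s) powr (-\<alpha>)\<close> is nearly
  constant, the second from \<open>s > t/2\<close>, where \<open>s powr (\<beta> - 1)\<close> is;
  the absolute value treats both signs of \<open>\<beta> - 1\<close> at once.\<close>

definition beta_const :: "real \<Rightarrow> real \<Rightarrow> real" where
  "beta_const \<alpha> \<beta> = 2 powr \<alpha> / \<beta> + 2 powr \<bar>\<beta> - 1\<bar> / (1 - \<alpha>)"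

lemma beta_const_pos: "\<alpha> < 1 \<Longrightarrow> 0 < \<beta> \<Longrightarrow> 0 < beta_const \<alpha> \<beta>"
  unfolding beta_const_def by (intro add_pos_pos divide_pos_pos) auto

lemma nn_integral_beta:
  assumes \<alpha>: "0 \<le> \<alpha>" "\<alpha> < 1" and \<beta>: "0 < \<beta>" and t: "0 < t"
  shows "(\<integral>\<^sup>+s. ennreal ((t - s) powr (- \<alpha>) * s powr (\<beta> - 1)) * indicator {0<..<t} s \<partial>lborel)
    \<le> ennreal (beta_const \<alpha> \<beta> * t powr (\<beta> - \<alpha>))"
proof -
  let ?a = "2 powr \<alpha> * t powr (- \<alpha>)" and ?b = "2 powr \<bar>\<beta> - 1\<bar> * t powr (\<beta> - 1)"
  have pt: "(t - s) powr (- \<alpha>) * s powr (\<beta> - 1) \<le> ?a * s powr (\<beta> - 1) + ?b * (t - s) powr (- \<alpha>)"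
    if s: "0 < s" "s < t" for s
  proof (cases "s \<le> t / 2")
    case True
    have "(t - s) powr (- \<alpha>) \<le> (t / 2) powr (- \<alpha>)"
      using True t \<alpha> by (intro powr_mono2') auto
    also have "\<dots> = ?a" using t by (simp add: powr_divide powr_minus field_simps)
    finally have "(t - s) powr (- \<alpha>) * s powr (\<beta> - 1) \<le> ?a * s powr (\<beta> - 1)"
      by (intro mult_right_mono) auto
    then show ?thesis by (simp add: add_increasing2)
  next
    case False
    have "s powr (\<beta> - 1) \<le> ?b"
    proof (cases "\<beta> \<ge> 1")
      case True
      then have "s powr (\<beta> - 1) \<le> t powr (\<beta> - 1)"
        using s by (intro powr_mono2) auto
      also have "\<dots> \<le> ?b" using ge_one_powr_ge_zero[of 2 "\<bar>\<beta> - 1\<bar>"] mult_right_mono[of 1 "2 powr \<bar>\<beta> - 1\<bar>" "t powr (\<beta> - 1)"] by simp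
      finally show ?thesis .
    next
      case b: False
      then have "s powr (\<beta> - 1) \<le> (t / 2) powr (\<beta> - 1)"
        using s False t by (intro powr_mono2') auto
      also have "\<dots> = ?b" using t b by (simp add: powr_divide powr_diff abs_if field_simps)
      finally show ?thesis .
    qed
    then have "s powr (\<beta> - 1) * (t - s) powr (- \<alpha>) \<le> ?b * (t - s) powr (- \<alpha>)"
      by (intro mult_right_mono) auto
    then show ?thesis by (simp add: add_increasing mult.commute)
  qed
  have "(\<integral>\<^sup>+s. ennreal ((t - s) powr (- \<alpha>) * s powr (\<beta> - 1)) * indicator {0<..<t} s \<partial>lborel)
     \<le> (\<integral>\<^sup>+s. ennreal ?a * (ennreal (s powr (\<beta> - 1)) * indicator {0<..<t} s)
          + ennreal ?b * (ennreal ((t - s) powr (- \<alpha>)) * indicator {t-t<..<t} s) \<partial>lborel)"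
    using pt by (intro nn_integral_mono)
      (auto simp: indicator_def ennreal_leI simp flip: ennreal_mult ennreal_plus)
  also have "\<dots> = ennreal ?a * ennreal (t powr (\<beta> - 1 + 1) / (\<beta> - 1 + 1)) + ennreal ?b * ennreal (t powr (1 - \<alpha>) / (1 - \<alpha>))"
    using nn_integral_powr_from_0[of "\<beta> - 1" t] nn_integral_powr_to[of \<alpha> t t] assms
    by (simp add: nn_integral_add nn_integral_cmult)
  also have "\<dots> = ennreal (?a * (t powr \<beta> / \<beta>) + ?b * (t powr (1 - \<alpha>) / (1 - \<alpha>)))"
    using assms by (simp flip: ennreal_mult ennreal_plus)
  also have "?a * (t powr \<beta> / \<beta>) + ?b * (t powr (1 - \<alpha>) / (1 - \<alpha>)) = beta_const \<alpha> \<beta> * t powr (\<beta> - \<alpha>)"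
  proof -
    have "t powr (- \<alpha>) * t powr \<beta> = t powr (\<beta> - \<alpha>)" "t powr (\<beta> - 1) * t powr (1 - \<alpha>) = t powr (\<beta> - \<alpha>)"
      using t by (simp_all flip: powr_add)
    moreover have "?a * (t powr \<beta> / \<beta>) + ?b * (t powr (1 - \<alpha>) / (1 - \<alpha>))
        = 2 powr \<alpha> * (t powr (- \<alpha>) * t powr \<beta>) / \<beta> + 2 powr \<bar>\<beta> - 1\<bar> * (t powr (\<beta> - 1) * t powr (1 - \<alpha>)) / (1 - \<alpha>)"
      by (simp only: times_divide_eq_right mult.assoc)
    ultimately show ?thesis unfolding beta_const_def
      by (simp only: distrib_right times_divide_eq_left)
  qed
  finally show ?thesis .
qed

section \<open>Potentials of a kernel with derivatives\<close>

text \<open>Difference quotients of singular kernels have no convenient pointwise majorant, so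
  dominated convergence is avoided. Instead \<open>f'\<close> is integrated in \<open>h\<close>,
  Fubini needs only the uniform L1 bound, and the fundamental theorem of calculus is applied to the
  integrated derivative, whose continuity is assumed.\<close>

lemma has_real_derivative_integral_parameter:
  fixes f f' :: "real \<Rightarrow> 'b \<Rightarrow> real"
  assumes "sigma_finite_measure M"
    and der: "\<And>h \<omega>. \<omega> \<in> space M \<Longrightarrow> ((\<lambda>h. f h \<omega>) has_real_derivative f' h \<omega>) (at h)"
    and cont: "\<And>\<omega>. \<omega> \<in> space M \<Longrightarrow> continuous_on UNIV (\<lambda>h. f' h \<omega>)"
    and meas: "(\<lambda>(h, \<omega>). f' h \<omega>) \<in> borel_measurable (lborel \<Otimes>\<^sub>M M)"
    and int: "\<And>h. integrable M (f h)"
    and bd: "\<And>h. (\<integral>\<^sup>+\<omega>. ennreal \<bar>f' h \<omega>\<bar> \<partial>M) \<le> ennreal C"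
    and c: "continuous_on UNIV (\<lambda>h. \<integral>\<omega>. f' h \<omega> \<partial>M)"
  shows "((\<lambda>h. \<integral>\<omega>. f h \<omega> \<partial>M) has_real_derivative (\<integral>\<omega>. f' h \<omega> \<partial>M)) (at h)"
proof -
  interpret M: sigma_finite_measure M by fact
  interpret P: pair_sigma_finite lborel M ..
  let ?F = "\<lambda>h. \<integral>\<omega>. f h \<omega> \<partial>M" and ?R = "\<lambda>h. \<integral>\<omega>. f' h \<omega> \<partial>M"
  have meas': "(\<lambda>p. f' (fst p) (snd p)) \<in> borel_measurable (lborel \<Otimes>\<^sub>M M)"
    using meas by (simp add: case_prod_unfold)
  have diff: "?F b - ?F a = integral {a..b} ?R" if ab: "a \<le> b" for a b
  proof -
    have mp: "(\<lambda>p. indicator {a..b} (fst p) *\<^sub>R f' (fst p) (snd p)) \<in> borel_measurable (lborel \<Otimes>\<^sub>M M)"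
      using meas' by measurable
    have fin: "(\<integral>\<^sup>+\<eta>. (\<integral>\<^sup>+\<omega>. ennreal (norm (indicator {a..b} \<eta> *\<^sub>R f' \<eta> \<omega>)) \<partial>M) \<partial>lborel) < \<infinity>"
    proof -
      have "(\<integral>\<^sup>+\<eta>. (\<integral>\<^sup>+\<omega>. ennreal (norm (indicator {a..b} \<eta> *\<^sub>R f' \<eta> \<omega>)) \<partial>M) \<partial>lborel)
          \<le> (\<integral>\<^sup>+\<eta>. ennreal C * indicator {a..b} \<eta> \<partial>lborel)"
      proof (intro nn_integral_mono)
        fix \<eta>
        show "(\<integral>\<^sup>+\<omega>. ennreal (norm (indicator {a..b} \<eta> *\<^sub>R f' \<eta> \<omega>)) \<partial>M) \<le> ennreal C * indicator {a..b} \<eta>"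
          using bd[of \<eta>] by (cases "\<eta> \<in> {a..b}") auto
      qed
      also have "\<dots> = ennreal C * emeasure lborel {a..b}"
        by (rule nn_integral_cmult_indicator) auto
      also have "\<dots> < \<infinity>" using ab by (simp add: ennreal_mult_less_top)
      finally show ?thesis .
    qed
    have ip: "integrable (lborel \<Otimes>\<^sub>M M) (\<lambda>p. indicator {a..b} (fst p) *\<^sub>R f' (fst p) (snd p))"
    proof (rule integrableI_bounded[OF mp])
      have "(\<integral>\<^sup>+p. ennreal (norm (indicator {a..b} (fst p) *\<^sub>R f' (fst p) (snd p))) \<partial>(lborel \<Otimes>\<^sub>M M))
          = (\<integral>\<^sup>+\<eta>. (\<integral>\<^sup>+\<omega>. ennreal (norm (indicator {a..b} \<eta> *\<^sub>R f' \<eta> \<omega>)) \<partial>M) \<partial>lborel)"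
        using mp by (subst M.nn_integral_fst[symmetric]) auto
      then show "(\<integral>\<^sup>+p. ennreal (norm (indicator {a..b} (fst p) *\<^sub>R f' (fst p) (snd p))) \<partial>(lborel \<Otimes>\<^sub>M M)) < \<infinity>"
        using fin by simp
    qed
    have ftc: "f b \<omega> - f a \<omega> = (\<integral>\<eta>. indicator {a..b} \<eta> *\<^sub>R f' \<eta> \<omega> \<partial>lborel)" if "\<omega> \<in> space M" for \<omega>
    proof -
      have "has_bochner_integral lborel (\<lambda>\<eta>. indicator {a..b} \<eta> *\<^sub>R f' \<eta> \<omega>) (f b \<omega> - f a \<omega>)"
        using ab der[OF that] cont[OF that]
        by (intro has_bochner_integral_FTC_Icc)
           (auto simp: has_real_derivative_iff_has_vector_derivative[symmetric]
             intro: has_field_derivative_at_within continuous_on_subset)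
      then show ?thesis by (simp add: has_bochner_integral_integral_eq)
    qed
    have ip': "integrable (lborel \<Otimes>\<^sub>M M) (case_prod (\<lambda>\<eta> \<omega>. indicator {a..b} \<eta> *\<^sub>R f' \<eta> \<omega>))"
      using ip by (simp add: case_prod_unfold)
    have "?F b - ?F a = (\<integral>\<omega>. f b \<omega> - f a \<omega> \<partial>M)"
      using int by simp
    also have "\<dots> = (\<integral>\<omega>. (\<integral>\<eta>. indicator {a..b} \<eta> *\<^sub>R f' \<eta> \<omega> \<partial>lborel) \<partial>M)"
      using ftc by (intro Bochner_Integration.integral_cong) auto
    also have "\<dots> = (\<integral>\<eta>. (\<integral>\<omega>. indicator {a..b} \<eta> *\<^sub>R f' \<eta> \<omega> \<partial>M) \<partial>lborel)"
      by (rule P.Fubini_integral[OF ip'])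
    also have "\<dots> = (\<integral>\<eta>. indicator {a..b} \<eta> *\<^sub>R ?R \<eta> \<partial>lborel)"
      by simp
    also have "\<dots> = integral {a..b} ?R"
      using set_borel_integral_eq_integral(2)[OF borel_integrable_atLeastAtMost'[of a b ?R]]
        continuous_on_subset[OF c] by (simp add: set_lebesgue_integral_def)
    finally show ?thesis .
  qed
  have "((\<lambda>x. ?F (h-1) + integral {h-1..x} ?R) has_real_derivative 0 + ?R h) (at h within {h-1..h+1})"
    by (intro DERIV_add DERIV_const integral_has_real_derivative continuous_on_subset[OF c]) auto
  then have "((\<lambda>x. ?F (h-1) + integral {h-1..x} ?R) has_real_derivative ?R h) (at h)"
    by (simp add: at_within_Icc_at)
  then show ?thesis
  proof (rule has_field_derivative_transform_within_open[where S = "{h-1<..<h+1}"])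
    fix x assume "x \<in> {h-1<..<h+1}"
    then show "?F (h-1) + integral {h-1..x} ?R = ?F x" using diff[of "h-1" x] by auto
  qed auto
qed

section \<open>Kernels given with their space derivatives, and their potentials\<close>

lemma open_time_slab: "open {(x, y, t) |x y t. 0 < t \<and> ereal t < T}"
proof -
  have "{(x, y, t) |x y t. 0 < t \<and> ereal t < T} = {p. 0 < snd (snd p)} \<inter> {p. ereal (snd (snd p)) < T}"
    by auto
  also have "open \<dots>"
    by (intro open_Int open_Collect_less continuous_intros)
  finally show ?thesis .
qed

text \<open>The derivatives are treated as a family of functions linked by \<open>g_deriv\<close>,
  so that potentials of all orders can be handled by the same lemmas. The bound is already in terms
  of the model kernel.\<close>

locale jet_kernel =
  fixes m :: nat and d L CG :: real and T :: ereal
    and g :: "'a::euclidean_space list \<Rightarrow> 'a \<Rightarrow> 'a \<Rightarrow> real \<Rightarrow> real"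
  assumes d: "real m < d" and L: "0 < L" and CG: "0 < CG"
    and g_cont: "w \<in> words_upto m \<Longrightarrow>
      continuous_on {(x, y, t) |x y t. 0 < t \<and> ereal t < T} (\<lambda>(x, y, t). g w x y t)"
    and g_bound: "w \<in> words_upto m \<Longrightarrow> 0 < t \<Longrightarrow> ereal t < T \<Longrightarrow>
      \<bar>g w x y t\<bar> \<le> CG * (t powr (- real (length w) / d) * kern L (t powr (1 / d)) x y)"
    and g_deriv: "b # w \<in> words_upto m \<Longrightarrow> 0 < t \<Longrightarrow> ereal t < T \<Longrightarrow>
      ((\<lambda>h. g w (x + h *\<^sub>R b) y t) has_real_derivative g (b # w) x y t) (at 0)"
begin

lemma d_pos: "0 < d" using d by linarith

text \<open>The extension by zero encodes causality: a source emitting at or after the time of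
  observation contributes nothing, so that potentials may integrate over all sources. It also makes
  the kernel measurable on the whole space.\<close>

definition gz :: "'a list \<Rightarrow> 'a \<Rightarrow> 'a \<Rightarrow> real \<Rightarrow> real" where
  "gz w x y t = (if 0 < t \<and> ereal t < T then g w x y t else 0)"

definition decay :: "nat \<Rightarrow> 'a \<Rightarrow> 'a \<Rightarrow> real \<Rightarrow> real" where
  "decay j x y t = (if 0 < t then t powr (- real j / d) * kern L (t powr (1 / d)) x y else 0)"

lemma decay_nonneg [simp]: "0 \<le> decay j x y t"
  by (simp add: decay_def)

lemma decay_measurable [measurable]:
  assumes [measurable]: "f1 \<in> borel_measurable M" "f2 \<in> borel_measurable M" "r \<in> borel_measurable M"
  shows "(\<lambda>\<omega>. decay j (f1 \<omega>) (f2 \<omega>) (r \<omega>)) \<in> borel_measurable M"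
  unfolding decay_def by measurable

lemma gz_bound: "w \<in> words_upto m \<Longrightarrow> \<bar>gz w x y t\<bar> \<le> CG * decay (length w) x y t"
  using g_bound CG by (auto simp: gz_def decay_def)

lemma gz_measurable:
  assumes w: "w \<in> words_upto m"
    and [measurable]: "f1 \<in> borel_measurable M" "f2 \<in> borel_measurable M" "r \<in> borel_measurable M"
  shows "(\<lambda>\<omega>. gz w (f1 \<omega>) (f2 \<omega>) (r \<omega>)) \<in> borel_measurable M"
proof -
  let ?S = "{(x, y, t) |x y t. 0 < t \<and> ereal t < T} :: ('a \<times> 'a \<times> real) set"
  have "(\<lambda>p. indicator ?S p *\<^sub>R (case p of (x, y, t) \<Rightarrow> g w x y t)) \<in> borel_measurable borel"
    by (rule borel_measurable_continuous_on_indicator[OF _ g_cont[OF w]])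
       (simp add: open_time_slab borel_open)
  moreover have "(\<lambda>\<omega>. (f1 \<omega>, f2 \<omega>, r \<omega>)) \<in> M \<rightarrow>\<^sub>M borel"
    by measurable
  ultimately have "(\<lambda>\<omega>. (\<lambda>p. indicator ?S p *\<^sub>R (case p of (x, y, t) \<Rightarrow> g w x y t)) (f1 \<omega>, f2 \<omega>, r \<omega>)) \<in> borel_measurable M"
    using measurable_compose by blast
  then show ?thesis
    by (rule measurable_cong[THEN iffD1, rotated]) (auto simp: gz_def indicator_def)
qed

text \<open>The majorant changes by a bounded factor when the elapsed time changes by at most a
  factor two and the point moves by at most the matching distance \<open>t0 powr (1/d)\<close>. This
  gives one dominating function for a whole neighbourhood of \<open>(x0, t0)\<close>.\<close>

lemma decay_compare:
  fixes x x0 y :: 'a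
  assumes t: "0 < t0" "t0 / 2 \<le> t" "t \<le> 2 * t0" and x: "dist x x0 \<le> t0 powr (1 / d)"
  shows "decay j x y t \<le> 2 powr (real j / d) * (2 * 2 powr (1 / d)) powr (real DIM('a) + 2 * L) * decay j x0 y t0"
proof -
  let ?c = "2 powr (1 / d)" and ?r = "t powr (1 / d)" and ?s = "t0 powr (1 / d)"
  have tp: "0 < t" using t by simp
  have c1: "1 \<le> ?c" using d_pos by (simp add: ge_one_powr_ge_zero)
  have 1: "?r \<le> ?c * ?s"
    using t tp d_pos by (subst powr_mult[symmetric]) (auto intro!: powr_mono2)
  have 2: "?s \<le> ?c * ?r"
    using t tp d_pos by (subst powr_mult[symmetric]) (auto intro!: powr_mono2)
  have "dist x0 y \<le> dist x x0 + dist x y"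
    using dist_triangle[of x0 y x] by (simp add: dist_commute)
  then have "?s + dist x0 y \<le> 2 * ?s + dist x y" using x by argo
  also have "\<dots> \<le> 2 * ?c * ?r + 2 * ?c * dist x y"
    using 2 c1 mult_right_mono[of 1 "2 * ?c" "dist x y"] by (intro add_mono) auto
  finally have 3: "?s + dist x0 y \<le> (2 * ?c) * (?r + dist x y)" by (simp add: distrib_left)
  have 4: "?r \<le> (2 * ?c) * ?s" using 1 c1 by (smt (verit) mult_right_mono powr_ge_zero)
  have k: "kern L ?r x y \<le> (2 * ?c) powr (real DIM('a) + 2 * L) * kern L ?s x0 y"
    using 3 4 tp t L c1 by (intro kern_compare) auto
  have "t powr (- real j / d) \<le> (t0 / 2) powr (- real j / d)"
    using t d_pos by (intro powr_mono2') auto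
  also have "\<dots> = 2 powr (real j / d) * t0 powr (- real j / d)"
    using t by (simp add: powr_divide powr_minus field_simps)
  finally have p: "t powr (- real j / d) \<le> 2 powr (real j / d) * t0 powr (- real j / d)" .
  have "t powr (- real j / d) * kern L ?r x y
      \<le> (2 powr (real j / d) * t0 powr (- real j / d)) * ((2 * ?c) powr (real DIM('a) + 2 * L) * kern L ?s x0 y)"
    using p k by (intro mult_mono) auto
  then show ?thesis using tp t by (simp add: decay_def mult_ac)
qed

end

text \<open>A source \<open>\<omega>\<close> emits at time \<open>\<sigma> \<omega>\<close> from the point \<open>Y \<omega>\<close>. This covers both the initial datum
  (\<open>\<sigma> = 0\<close>) and the forcing on space-time. The condition \<open>tail\<close> controls the singularity of
  the kernel at the emission time, where dominated convergence is not available.\<close>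

locale jet_source = jet_kernel m d L CG T g + sigma_finite_measure M
  for m d L CG T and g :: "'a::euclidean_space list \<Rightarrow> 'a \<Rightarrow> 'a \<Rightarrow> real \<Rightarrow> real" and M :: "'b measure" +
  fixes \<sigma> :: "'b \<Rightarrow> real" and Y :: "'b \<Rightarrow> 'a" and B :: "'b \<Rightarrow> real" and Q :: "nat \<Rightarrow> real \<Rightarrow> real"
  assumes meas [measurable]: "\<sigma> \<in> borel_measurable M" "Y \<in> borel_measurable M" "B \<in> borel_measurable M"
    and \<sigma>_nonneg: "\<And>\<omega>. 0 \<le> \<sigma> \<omega>" and B_nonneg: "\<And>\<omega>. 0 \<le> B \<omega>"
    and total: "\<And>j x t. j \<le> m \<Longrightarrow> 0 < t \<Longrightarrow> ereal t < T \<Longrightarrow>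
      (\<integral>\<^sup>+\<omega>. ennreal (decay j x (Y \<omega>) (t - \<sigma> \<omega>) * B \<omega>) \<partial>M) \<le> ennreal (Q j t)"
    and tail: "\<And>j t0 \<epsilon>. j \<le> m \<Longrightarrow> 0 < t0 \<Longrightarrow> ereal t0 < T \<Longrightarrow> 0 < \<epsilon> \<Longrightarrow>
      \<exists>\<eta>>0. \<forall>x t. \<bar>t - t0\<bar> < \<eta> \<longrightarrow>
        (\<integral>\<^sup>+\<omega>. ennreal (decay j x (Y \<omega>) (t - \<sigma> \<omega>) * B \<omega>) * indicator {\<omega>. t0 - \<eta> < \<sigma> \<omega>} \<omega> \<partial>M) \<le> ennreal \<epsilon>"
begin

definition dominated :: "('b \<Rightarrow> real) \<Rightarrow> bool" where
  "dominated \<psi> \<longleftrightarrow> \<psi> \<in> borel_measurable M \<and> (\<forall>\<omega>. \<bar>\<psi> \<omega>\<bar> \<le> B \<omega>)"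

definition pot :: "'a list \<Rightarrow> ('b \<Rightarrow> real) \<Rightarrow> 'a \<Rightarrow> real \<Rightarrow> real" where
  "pot w \<psi> x t = (\<integral>\<omega>. gz w x (Y \<omega>) (t - \<sigma> \<omega>) * \<psi> \<omega> \<partial>M)"

lemma length_le: "w \<in> words_upto m \<Longrightarrow> length w \<le> m"
  by (simp add: words_upto_def)

lemma integrand_measurable:
  assumes w: "w \<in> words_upto m" and "\<psi> \<in> borel_measurable M"
  shows "(\<lambda>\<omega>. gz w x (Y \<omega>) (t - \<sigma> \<omega>) * \<psi> \<omega>) \<in> borel_measurable M"
  using assms gz_measurable[OF w, of "\<lambda>_. x" M Y "\<lambda>\<omega>. t - \<sigma> \<omega>"] by simp

lemma integrand_bound:
  assumes w: "w \<in> words_upto m" and \<psi>: "\<bar>\<psi> \<omega>\<bar> \<le> B \<omega>"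
  shows "\<bar>gz w x (Y \<omega>) t * \<psi> \<omega>\<bar> \<le> CG * (decay (length w) x (Y \<omega>) t * B \<omega>)"
proof -
  have "\<bar>gz w x (Y \<omega>) t\<bar> * \<bar>\<psi> \<omega>\<bar> \<le> (CG * decay (length w) x (Y \<omega>) t) * B \<omega>"
    using CG by (intro mult_mono gz_bound[OF w] \<psi>) auto
  then show ?thesis by (simp add: abs_mult mult_ac)
qed

lemma nn_integrand_bound:
  assumes w: "w \<in> words_upto m" and \<psi>: "dominated \<psi>"
  shows "(\<integral>\<^sup>+\<omega>. ennreal \<bar>gz w x (Y \<omega>) (t - \<sigma> \<omega>) * \<psi> \<omega>\<bar> \<partial>M)
    \<le> ennreal CG * (\<integral>\<^sup>+\<omega>. ennreal (decay (length w) x (Y \<omega>) (t - \<sigma> \<omega>) * B \<omega>) \<partial>M)"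
proof -
  have "(\<integral>\<^sup>+\<omega>. ennreal \<bar>gz w x (Y \<omega>) (t - \<sigma> \<omega>) * \<psi> \<omega>\<bar> \<partial>M)
    \<le> (\<integral>\<^sup>+\<omega>. ennreal CG * ennreal (decay (length w) x (Y \<omega>) (t - \<sigma> \<omega>) * B \<omega>) \<partial>M)"
    using integrand_bound[OF w] \<psi> CG B_nonneg
    by (intro nn_integral_mono) (auto simp: dominated_def ennreal_leI simp flip: ennreal_mult)
  then show ?thesis by (subst (asm) nn_integral_cmult) auto
qed

lemma integrable_integrand:
  assumes w: "w \<in> words_upto m" and \<psi>: "dominated \<psi>" and t: "0 < t" "ereal t < T"
  shows "integrable M (\<lambda>\<omega>. gz w x (Y \<omega>) (t - \<sigma> \<omega>) * \<psi> \<omega>)"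
proof (rule integrableI_bounded)
  show "(\<lambda>\<omega>. gz w x (Y \<omega>) (t - \<sigma> \<omega>) * \<psi> \<omega>) \<in> borel_measurable M"
    using \<psi> by (intro integrand_measurable[OF w]) (simp add: dominated_def)
  have "ennreal CG * (\<integral>\<^sup>+\<omega>. ennreal (decay (length w) x (Y \<omega>) (t - \<sigma> \<omega>) * B \<omega>) \<partial>M) \<le> ennreal CG * ennreal (Q (length w) t)"
    using total[OF length_le[OF w] t] by (intro mult_left_mono) auto
  also have "\<dots> < \<infinity>" by (simp add: ennreal_mult_less_top)
  finally show "(\<integral>\<^sup>+\<omega>. ennreal (norm (gz w x (Y \<omega>) (t - \<sigma> \<omega>) * \<psi> \<omega>)) \<partial>M) < \<infinity>"
    using nn_integrand_bound[OF w \<psi>, of x t] by simp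
qed

lemma pot_bound:
  assumes w: "w \<in> words_upto m" and \<psi>: "dominated \<psi>"
  shows "ennreal \<bar>pot w \<psi> x t\<bar>
    \<le> ennreal CG * (\<integral>\<^sup>+\<omega>. ennreal (decay (length w) x (Y \<omega>) (t - \<sigma> \<omega>) * B \<omega>) \<partial>M)"
proof (cases "integrable M (\<lambda>\<omega>. gz w x (Y \<omega>) (t - \<sigma> \<omega>) * \<psi> \<omega>)")
  case True
  then show ?thesis
    using integral_norm_bound_ennreal[OF True] nn_integrand_bound[OF w \<psi>, of x t]
    unfolding pot_def by (auto intro: order_trans simp only: real_norm_def)
next
  case False
  \<comment> \<open>A non-integrable integrand has integral 0 by convention, so the bound holds at
    every \<open>t\<close>.\<close>
  then show ?thesis unfolding pot_def by (simp add: not_integrable_integral_eq)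
qed

text \<open>Sources that emitted at least \<eta> before \<open>t0\<close> see the kernel away from
  its singularity. There \<open>decay_compare\<close> supplies a majorant independent of
  \<open>n\<close>, and pointwise convergence is the continuity of \<open>g\<close>.\<close>

lemma small_time_difference:
  assumes w: "w \<in> words_upto m" and t0: "0 < t0" "ereal t0 < T" and \<eta>: "0 < \<eta>"
    and xs: "\<And>n. dist (xs n) x0 \<le> (\<eta> powr (1 / d))" "xs \<longlonglongrightarrow> x0"
    and ts: "\<And>n. \<bar>ts n - t0\<bar> \<le> \<eta> / 2" "ts \<longlonglongrightarrow> t0" "\<And>n. 0 < ts n" "\<And>n. ereal (ts n) < T"
  shows "(\<lambda>n. \<integral>\<^sup>+\<omega>. ennreal (\<bar>gz w (xs n) (Y \<omega>) (ts n - \<sigma> \<omega>) - gz w x0 (Y \<omega>) (t0 - \<sigma> \<omega>)\<bar> * B \<omega>)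
      * indicator {\<omega>. \<sigma> \<omega> \<le> t0 - \<eta>} \<omega> \<partial>M) \<longlonglongrightarrow> 0"
proof -
  let ?j = "length w"
  let ?C = "2 powr (real ?j / d) * (2 * 2 powr (1 / d)) powr (real DIM('a) + 2 * L)"
  let ?f = "\<lambda>n \<omega>. ennreal (\<bar>gz w (xs n) (Y \<omega>) (ts n - \<sigma> \<omega>) - gz w x0 (Y \<omega>) (t0 - \<sigma> \<omega>)\<bar> * B \<omega>)
      * indicator {\<omega>. \<sigma> \<omega> \<le> t0 - \<eta>} \<omega>"
  let ?W = "\<lambda>\<omega>. ennreal (CG * (?C + 1)) * ennreal (decay ?j x0 (Y \<omega>) (t0 - \<sigma> \<omega>) * B \<omega>)"
  have C0: "0 \<le> ?C" by simp
  have m1 [measurable]: "(\<lambda>\<omega>. gz w x (Y \<omega>) (t - \<sigma> \<omega>)) \<in> borel_measurable M" for x t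
    by (intro gz_measurable[OF w]) auto
  have "(\<lambda>n. \<integral>\<^sup>+\<omega>. ?f n \<omega> \<partial>M) \<longlonglongrightarrow> (\<integral>\<^sup>+\<omega>. 0 \<partial>M)"
  proof (rule nn_integral_dominated_convergence[where w = ?W])
    show "?f n \<in> borel_measurable M" for n by measurable
    show "?W \<in> borel_measurable M" by measurable
    have "(\<integral>\<^sup>+\<omega>. ?W \<omega> \<partial>M) = ennreal (CG * (?C + 1)) * (\<integral>\<^sup>+\<omega>. ennreal (decay ?j x0 (Y \<omega>) (t0 - \<sigma> \<omega>) * B \<omega>) \<partial>M)"
      by (rule nn_integral_cmult) measurable
    also have "\<dots> \<le> ennreal (CG * (?C + 1)) * ennreal (Q ?j t0)"
      using total[OF length_le[OF w] t0] by (intro mult_left_mono) auto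
    also have "\<dots> < \<infinity>" by (simp add: ennreal_mult_less_top)
    finally show "(\<integral>\<^sup>+\<omega>. ?W \<omega> \<partial>M) < \<infinity>" .
    show "AE \<omega> in M. ?f n \<omega> \<le> ?W \<omega>" for n
    proof (rule AE_I2)
      fix \<omega>
      show "?f n \<omega> \<le> ?W \<omega>"
      proof (cases "\<sigma> \<omega> \<le> t0 - \<eta>")
        case True
        let ?\<tau> = "t0 - \<sigma> \<omega>" and ?D = "decay ?j x0 (Y \<omega>) (t0 - \<sigma> \<omega>)"
        have \<tau>: "0 < ?\<tau>" "\<eta> \<le> ?\<tau>" using True \<eta> by auto
        have "\<eta> powr (1 / d) \<le> ?\<tau> powr (1 / d)"
          using \<tau> \<eta> d_pos by (intro powr_mono2) auto
        then have dx: "dist (xs n) x0 \<le> ?\<tau> powr (1 / d)" using xs(1)[of n] by linarith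
        \<comment> \<open>The elapsed time is at least \<eta> and moves by at most
          \<open>\<eta> / 2\<close>, hence stays within a factor two.\<close>
        have tb: "?\<tau> / 2 \<le> ts n - \<sigma> \<omega>" "ts n - \<sigma> \<omega> \<le> 2 * ?\<tau>"
          using ts(1)[of n] \<tau> unfolding abs_le_iff by argo+
        have "\<bar>gz w (xs n) (Y \<omega>) (ts n - \<sigma> \<omega>)\<bar> \<le> CG * decay ?j (xs n) (Y \<omega>) (ts n - \<sigma> \<omega>)"
          by (rule gz_bound[OF w])
        also have "\<dots> \<le> CG * (?C * ?D)"
          using CG by (intro mult_left_mono decay_compare[OF \<tau>(1) tb dx]) auto
        finally have 1: "\<bar>gz w (xs n) (Y \<omega>) (ts n - \<sigma> \<omega>)\<bar> \<le> CG * (?C * ?D)" .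
        have 2: "\<bar>gz w x0 (Y \<omega>) ?\<tau>\<bar> \<le> CG * ?D" by (rule gz_bound[OF w])
        have "\<bar>gz w (xs n) (Y \<omega>) (ts n - \<sigma> \<omega>) - gz w x0 (Y \<omega>) ?\<tau>\<bar> \<le> CG * (?C * ?D) + CG * ?D"
          using 1 2 by linarith
        also have "\<dots> = CG * (?C + 1) * ?D" by (simp only: distrib_left distrib_right mult.assoc mult_1)
        finally have "\<bar>gz w (xs n) (Y \<omega>) (ts n - \<sigma> \<omega>) - gz w x0 (Y \<omega>) ?\<tau>\<bar> * B \<omega> \<le> (CG * (?C + 1) * ?D) * B \<omega>"
          using B_nonneg by (intro mult_right_mono) auto
        then have "ennreal (\<bar>gz w (xs n) (Y \<omega>) (ts n - \<sigma> \<omega>) - gz w x0 (Y \<omega>) ?\<tau>\<bar> * B \<omega>) \<le> ennreal (CG * (?C + 1) * (?D * B \<omega>))"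
          by (simp only: mult.assoc ennreal_leI)
        also have "\<dots> = ?W \<omega>"
          using CG C0 B_nonneg by (intro ennreal_mult) auto
        finally show ?thesis using True by simp
      next
        case False
        then show ?thesis by simp
      qed
    qed
    show "AE \<omega> in M. (\<lambda>n. ?f n \<omega>) \<longlonglongrightarrow> 0"
    proof (rule AE_I2)
      fix \<omega>
      show "(\<lambda>n. ?f n \<omega>) \<longlonglongrightarrow> 0"
      proof (cases "\<sigma> \<omega> \<le> t0 - \<eta>")
        case True
        let ?S = "{(x, y, t) |x y t. 0 < t \<and> ereal t < T} :: ('a \<times> 'a \<times> real) set"
        have pos: "0 < ts n - \<sigma> \<omega>" "ereal (ts n - \<sigma> \<omega>) < T" for n
        proof -
          show "0 < ts n - \<sigma> \<omega>" using True ts(1)[of n] \<eta> unfolding abs_le_iff by argo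
          have "ereal (ts n - \<sigma> \<omega>) \<le> ereal (ts n)" using \<sigma>_nonneg by simp
          then show "ereal (ts n - \<sigma> \<omega>) < T" using ts(4) by (rule order.strict_trans1)
        qed
        have pos0: "0 < t0 - \<sigma> \<omega>" "ereal (t0 - \<sigma> \<omega>) < T"
        proof -
          show "0 < t0 - \<sigma> \<omega>" using True \<eta> by auto
          have "ereal (t0 - \<sigma> \<omega>) \<le> ereal t0" using \<sigma>_nonneg by simp
          then show "ereal (t0 - \<sigma> \<omega>) < T" using t0(2) by (rule order.strict_trans1)
        qed
        have "(\<lambda>n. (xs n, Y \<omega>, ts n - \<sigma> \<omega>)) \<longlonglongrightarrow> (x0, Y \<omega>, t0 - \<sigma> \<omega>)"
          by (intro tendsto_intros xs ts)
        then have "(\<lambda>n. (case (xs n, Y \<omega>, ts n - \<sigma> \<omega>) of (x, y, t) \<Rightarrow> g w x y t))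
          \<longlonglongrightarrow> (case (x0, Y \<omega>, t0 - \<sigma> \<omega>) of (x, y, t) \<Rightarrow> g w x y t)"
          using pos pos0 by (intro continuous_on_tendsto_compose[OF g_cont[OF w]]) auto
        then have "(\<lambda>n. gz w (xs n) (Y \<omega>) (ts n - \<sigma> \<omega>)) \<longlonglongrightarrow> gz w x0 (Y \<omega>) (t0 - \<sigma> \<omega>)"
          using pos pos0 by (simp add: gz_def)
        then have "(\<lambda>n. \<bar>gz w (xs n) (Y \<omega>) (ts n - \<sigma> \<omega>) - gz w x0 (Y \<omega>) (t0 - \<sigma> \<omega>)\<bar> * B \<omega>)
          \<longlonglongrightarrow> \<bar>gz w x0 (Y \<omega>) (t0 - \<sigma> \<omega>) - gz w x0 (Y \<omega>) (t0 - \<sigma> \<omega>)\<bar> * B \<omega>"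
          by (intro tendsto_intros)
        then have "(\<lambda>n. ennreal (\<bar>gz w (xs n) (Y \<omega>) (ts n - \<sigma> \<omega>) - gz w x0 (Y \<omega>) (t0 - \<sigma> \<omega>)\<bar> * B \<omega>)) \<longlonglongrightarrow> ennreal 0"
          by (intro tendsto_ennrealI) simp
        then show ?thesis using True by simp
      next
        case False
        then show ?thesis by simp
      qed
    qed
  qed measurable
  then show ?thesis by simp
qed

text \<open>Continuity of the kernel in the L1 space weighted by \<open>B\<close>. The sources are
  split at the emission time \<open>t0 - \<eta>\<close>: for the late ones both kernels are small
  separately by \<open>tail\<close>, for the early ones dominated convergence applies.\<close>

lemma kernel_difference_small:
  assumes w: "w \<in> words_upto m" and t0: "0 < t0" "ereal t0 < T" and \<epsilon>: "0 < \<epsilon>"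
  shows "\<exists>\<delta>>0. \<forall>x t. dist x x0 < \<delta> \<longrightarrow> \<bar>t - t0\<bar> < \<delta> \<longrightarrow> 0 < t \<and> ereal t < T \<longrightarrow>
     (\<integral>\<^sup>+\<omega>. ennreal (\<bar>gz w x (Y \<omega>) (t - \<sigma> \<omega>) - gz w x0 (Y \<omega>) (t0 - \<sigma> \<omega>)\<bar> * B \<omega>) \<partial>M) \<le> ennreal \<epsilon>"
proof -
  let ?j = "length w"
  let ?D = "\<lambda>x t \<omega>. \<bar>gz w x (Y \<omega>) (t - \<sigma> \<omega>) - gz w x0 (Y \<omega>) (t0 - \<sigma> \<omega>)\<bar> * B \<omega>"
  have m1 [measurable]: "(\<lambda>\<omega>. gz w x (Y \<omega>) (t - \<sigma> \<omega>)) \<in> borel_measurable M" for x t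
    by (intro gz_measurable[OF w]) auto
  \<comment> \<open>Two tails, each multiplied by \<open>CG\<close>, add up to
    \<open>\<epsilon> / 2\<close>.\<close>
  define e where "e = \<epsilon> / (4 * CG)"
  have e: "0 < e" using \<epsilon> CG by (simp add: e_def)
  obtain \<eta> where \<eta>: "0 < \<eta>" and tail_\<eta>: "\<And>x t. \<bar>t - t0\<bar> < \<eta> \<Longrightarrow>
      (\<integral>\<^sup>+\<omega>. ennreal (decay ?j x (Y \<omega>) (t - \<sigma> \<omega>) * B \<omega>) * indicator {\<omega>. t0 - \<eta> < \<sigma> \<omega>} \<omega> \<partial>M) \<le> ennreal e"
    using tail[OF length_le[OF w] t0 e] by blast
  let ?A = "{\<omega>. \<sigma> \<omega> \<le> t0 - \<eta>}"
  have late: "(\<integral>\<^sup>+\<omega>. ennreal (?D x t \<omega>) * indicator {\<omega>. t0 - \<eta> < \<sigma> \<omega>} \<omega> \<partial>M) \<le> ennreal (\<epsilon> / 2)"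
    if t: "\<bar>t - t0\<bar> < \<eta>" for x t
  proof -
    let ?d = "\<lambda>x t \<omega>. ennreal (decay ?j x (Y \<omega>) (t - \<sigma> \<omega>) * B \<omega>) * indicator {\<omega>. t0 - \<eta> < \<sigma> \<omega>} \<omega>"
    have "(\<integral>\<^sup>+\<omega>. ennreal (?D x t \<omega>) * indicator {\<omega>. t0 - \<eta> < \<sigma> \<omega>} \<omega> \<partial>M)
      \<le> (\<integral>\<^sup>+\<omega>. ennreal CG * (?d x t \<omega> + ?d x0 t0 \<omega>) \<partial>M)"
    proof (intro nn_integral_mono)
      fix \<omega>
      let ?a = "decay ?j x (Y \<omega>) (t - \<sigma> \<omega>)" and ?b = "decay ?j x0 (Y \<omega>) (t0 - \<sigma> \<omega>)"
      have "\<bar>gz w x (Y \<omega>) (t - \<sigma> \<omega>) - gz w x0 (Y \<omega>) (t0 - \<sigma> \<omega>)\<bar> \<le> CG * ?a + CG * ?b"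
        using gz_bound[OF w, of x "Y \<omega>" "t - \<sigma> \<omega>"] gz_bound[OF w, of x0 "Y \<omega>" "t0 - \<sigma> \<omega>"] by linarith
      then have "?D x t \<omega> \<le> (CG * ?a + CG * ?b) * B \<omega>"
        using B_nonneg by (intro mult_right_mono) auto
      also have "\<dots> = CG * (?a * B \<omega> + ?b * B \<omega>)" by (simp add: algebra_simps)
      finally have "ennreal (?D x t \<omega>) \<le> ennreal (CG * (?a * B \<omega> + ?b * B \<omega>))" by (rule ennreal_leI)
      also have "\<dots> = ennreal CG * (ennreal (?a * B \<omega>) + ennreal (?b * B \<omega>))"
        using CG B_nonneg by (simp add: ennreal_mult ennreal_plus)
      finally show "ennreal (?D x t \<omega>) * indicator {\<omega>. t0 - \<eta> < \<sigma> \<omega>} \<omega> \<le> ennreal CG * (?d x t \<omega> + ?d x0 t0 \<omega>)"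
        by (auto simp: indicator_def)
    qed
    also have "\<dots> = ennreal CG * ((\<integral>\<^sup>+\<omega>. ?d x t \<omega> \<partial>M) + (\<integral>\<^sup>+\<omega>. ?d x0 t0 \<omega> \<partial>M))"
      by (simp add: nn_integral_cmult nn_integral_add)
    also have "\<dots> \<le> ennreal CG * (ennreal e + ennreal e)"
      using t \<eta> by (intro mult_left_mono add_mono tail_\<eta>) auto
    also have "\<dots> = ennreal (\<epsilon> / 2)"
      using CG e by (simp add: e_def field_simps flip: ennreal_mult ennreal_plus)
    finally show ?thesis .
  qed
  have early: "\<exists>\<delta>>0. \<forall>x t. dist x x0 < \<delta> \<longrightarrow> \<bar>t - t0\<bar> < \<delta> \<longrightarrow> 0 < t \<and> ereal t < T \<longrightarrow>
     (\<integral>\<^sup>+\<omega>. ennreal (?D x t \<omega>) * indicator ?A \<omega> \<partial>M) \<le> ennreal (\<epsilon> / 2)"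
  proof (rule ccontr)
    assume neg: "\<not> ?thesis"
    \<comment> \<open>Dominated convergence speaks about sequences, so a failing neighbourhood is
      turned into a sequence of counterexamples. The choice of \<mu> places every term within time
      \<open>\<eta>/2\<close> and distance \<open>\<eta> powr (1/d)\<close> of the limit, as the
      preceding lemma requires.\<close>
    define \<mu> where "\<mu> = min (\<eta> / 2) (\<eta> powr (1 / d))"
    have \<mu>: "0 < \<mu>" using \<eta> by (simp add: \<mu>_def)
    have "\<exists>x t. dist x x0 < \<mu> / real (Suc n) \<and> \<bar>t - t0\<bar> < \<mu> / real (Suc n) \<and> 0 < t \<and> ereal t < T \<and>
       ennreal (\<epsilon> / 2) < (\<integral>\<^sup>+\<omega>. ennreal (?D x t \<omega>) * indicator ?A \<omega> \<partial>M)" for n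
    proof -
      have "0 < \<mu> / real (Suc n)" using \<mu> by simp
      with neg show ?thesis unfolding not_ex de_Morgan_conj not_le[symmetric] by blast
    qed
    then have "\<forall>n. \<exists>q. dist (fst q) x0 < \<mu> / real (Suc n) \<and> \<bar>snd q - t0\<bar> < \<mu> / real (Suc n) \<and> 0 < snd q \<and> ereal (snd q) < T \<and>
       ennreal (\<epsilon> / 2) < (\<integral>\<^sup>+\<omega>. ennreal (?D (fst q) (snd q) \<omega>) * indicator ?A \<omega> \<partial>M)"
      by simp
    from choice[OF this] obtain q where q: "\<forall>n. dist (fst (q n)) x0 < \<mu> / real (Suc n) \<and> \<bar>snd (q n) - t0\<bar> < \<mu> / real (Suc n)
       \<and> 0 < snd (q n) \<and> ereal (snd (q n)) < T \<and>
       ennreal (\<epsilon> / 2) < (\<integral>\<^sup>+\<omega>. ennreal (?D (fst (q n)) (snd (q n)) \<omega>) * indicator ?A \<omega> \<partial>M)"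
      by blast
    define xs ts where "xs n = fst (q n)" and "ts n = snd (q n)" for n
    have xt: "\<And>n. dist (xs n) x0 < \<mu> / real (Suc n)" "\<And>n. \<bar>ts n - t0\<bar> < \<mu> / real (Suc n)"
      "\<And>n. 0 < ts n" "\<And>n. ereal (ts n) < T"
      "\<And>n. ennreal (\<epsilon> / 2) < (\<integral>\<^sup>+\<omega>. ennreal (?D (xs n) (ts n) \<omega>) * indicator ?A \<omega> \<partial>M)"
      using q by (simp_all add: xs_def ts_def)
    have lim0: "(\<lambda>n. \<mu> / real (Suc n)) \<longlonglongrightarrow> 0"
      by (rule LIMSEQ_Suc[OF lim_const_over_n])
    have le: "\<mu> / real (Suc n) \<le> \<mu>" for n
      using \<mu> by (simp add: divide_le_eq_1 field_simps)
    have "(\<lambda>n. \<integral>\<^sup>+\<omega>. ennreal (?D (xs n) (ts n) \<omega>) * indicator ?A \<omega> \<partial>M) \<longlonglongrightarrow> 0"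
    proof (rule small_time_difference[OF w t0 \<eta>])
      show "dist (xs n) x0 \<le> \<eta> powr (1 / d)" for n
        using order_trans[OF less_imp_le[OF xt(1)[of n]] le[of n]] by (simp add: \<mu>_def)
      show "\<bar>ts n - t0\<bar> \<le> \<eta> / 2" for n
        using order_trans[OF less_imp_le[OF xt(2)[of n]] le[of n]] by (simp add: \<mu>_def)
      show "xs \<longlonglongrightarrow> x0"
        unfolding tendsto_dist_iff[of xs]
        by (rule tendsto_sandwich[OF _ _ tendsto_const lim0]) (auto intro!: always_eventually less_imp_le xt(1) simp del: of_nat_Suc)
      have "(\<lambda>n. \<bar>ts n - t0\<bar>) \<longlonglongrightarrow> 0"
        by (rule tendsto_sandwich[OF _ _ tendsto_const lim0]) (auto intro!: always_eventually less_imp_le xt(2) simp del: of_nat_Suc)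
      then show "ts \<longlonglongrightarrow> t0" by (simp add: tendsto_dist_iff[of ts] dist_real_def)
    qed (fact xt)+
    then have "eventually (\<lambda>n. (\<integral>\<^sup>+\<omega>. ennreal (?D (xs n) (ts n) \<omega>) * indicator ?A \<omega> \<partial>M) < ennreal (\<epsilon> / 2)) sequentially"
      using \<epsilon> by (intro order_tendstoD(2)) auto
    then obtain n where "(\<integral>\<^sup>+\<omega>. ennreal (?D (xs n) (ts n) \<omega>) * indicator ?A \<omega> \<partial>M) < ennreal (\<epsilon> / 2)"
      by (auto simp: eventually_sequentially)
    with xt(5)[of n] show False by simp
  qed
  then obtain \<delta> where \<delta>: "0 < \<delta>" and early': "\<And>x t. dist x x0 < \<delta> \<Longrightarrow> \<bar>t - t0\<bar> < \<delta> \<Longrightarrow> 0 < t \<Longrightarrow> ereal t < T \<Longrightarrow>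
     (\<integral>\<^sup>+\<omega>. ennreal (?D x t \<omega>) * indicator ?A \<omega> \<partial>M) \<le> ennreal (\<epsilon> / 2)"
    by blast
  show ?thesis
  proof (intro exI[of _ "min \<delta> \<eta>"] conjI allI impI)
    show "0 < min \<delta> \<eta>" using \<delta> \<eta> by simp
    fix x t assume h: "dist x x0 < min \<delta> \<eta>" "\<bar>t - t0\<bar> < min \<delta> \<eta>" "0 < t \<and> ereal t < T"
    have "(\<integral>\<^sup>+\<omega>. ennreal (?D x t \<omega>) \<partial>M) = (\<integral>\<^sup>+\<omega>. ennreal (?D x t \<omega>) * indicator ?A \<omega>
        + ennreal (?D x t \<omega>) * indicator {\<omega>. t0 - \<eta> < \<sigma> \<omega>} \<omega> \<partial>M)"
      by (intro nn_integral_cong) (auto simp: indicator_def)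
    also have "\<dots> = (\<integral>\<^sup>+\<omega>. ennreal (?D x t \<omega>) * indicator ?A \<omega> \<partial>M)
        + (\<integral>\<^sup>+\<omega>. ennreal (?D x t \<omega>) * indicator {\<omega>. t0 - \<eta> < \<sigma> \<omega>} \<omega> \<partial>M)"
      by (rule nn_integral_add) measurable
    also have "\<dots> \<le> ennreal (\<epsilon> / 2) + ennreal (\<epsilon> / 2)"
      using h by (intro add_mono early' late) auto
    also have "\<dots> = ennreal \<epsilon>" using \<epsilon> by (simp flip: ennreal_plus)
    finally show "(\<integral>\<^sup>+\<omega>. ennreal (?D x t \<omega>) \<partial>M) \<le> ennreal \<epsilon>" .
  qed
qed

text \<open>Since \<psi> is at most \<open>B\<close> in modulus, the difference is controlled by the
  weighted L1 distance of the kernels, in which \<psi> does not occur. The modulus is therefore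
  chosen before \<psi>, and this uniformity carries the whole compactness argument.\<close>

lemma pot_equicontinuous:
  assumes w: "w \<in> words_upto m" and t0: "0 < t0" "ereal t0 < T" and \<epsilon>: "0 < \<epsilon>"
  shows "\<exists>\<delta>>0. \<forall>x t \<psi>. dominated \<psi> \<longrightarrow> dist x x0 < \<delta> \<longrightarrow> \<bar>t - t0\<bar> < \<delta> \<longrightarrow> 0 < t \<and> ereal t < T \<longrightarrow>
     \<bar>pot w \<psi> x t - pot w \<psi> x0 t0\<bar> \<le> \<epsilon>"
proof -
  obtain \<delta> where \<delta>: "0 < \<delta>" and le: "\<And>x t. dist x x0 < \<delta> \<Longrightarrow> \<bar>t - t0\<bar> < \<delta> \<Longrightarrow> 0 < t \<and> ereal t < T \<Longrightarrow>
     (\<integral>\<^sup>+\<omega>. ennreal (\<bar>gz w x (Y \<omega>) (t - \<sigma> \<omega>) - gz w x0 (Y \<omega>) (t0 - \<sigma> \<omega>)\<bar> * B \<omega>) \<partial>M) \<le> ennreal \<epsilon>"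
    using kernel_difference_small[OF w t0 \<epsilon>] by blast
  have "\<bar>pot w \<psi> x t - pot w \<psi> x0 t0\<bar> \<le> \<epsilon>"
    if \<psi>: "dominated \<psi>" and xt: "dist x x0 < \<delta>" "\<bar>t - t0\<bar> < \<delta>" "0 < t \<and> ereal t < T" for x t \<psi>
  proof -
    let ?h = "\<lambda>\<omega>. gz w x (Y \<omega>) (t - \<sigma> \<omega>) * \<psi> \<omega> - gz w x0 (Y \<omega>) (t0 - \<sigma> \<omega>) * \<psi> \<omega>"
    have i: "integrable M (\<lambda>\<omega>. gz w x (Y \<omega>) (t - \<sigma> \<omega>) * \<psi> \<omega>)" "integrable M (\<lambda>\<omega>. gz w x0 (Y \<omega>) (t0 - \<sigma> \<omega>) * \<psi> \<omega>)"
      using xt t0 by (auto intro: integrable_integrand[OF w \<psi>])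
    have ih: "integrable M ?h" using i by simp
    have "pot w \<psi> x t - pot w \<psi> x0 t0 = (\<integral>\<omega>. ?h \<omega> \<partial>M)"
      unfolding pot_def using i by simp
    then have "ennreal \<bar>pot w \<psi> x t - pot w \<psi> x0 t0\<bar> \<le> (\<integral>\<^sup>+\<omega>. ennreal \<bar>?h \<omega>\<bar> \<partial>M)"
      using integral_norm_bound_ennreal[OF ih] by simp
    also have "\<dots> \<le> (\<integral>\<^sup>+\<omega>. ennreal (\<bar>gz w x (Y \<omega>) (t - \<sigma> \<omega>) - gz w x0 (Y \<omega>) (t0 - \<sigma> \<omega>)\<bar> * B \<omega>) \<partial>M)"
      using \<psi> by (intro nn_integral_mono ennreal_leI)
        (auto simp: dominated_def abs_mult simp flip: left_diff_distrib intro: mult_left_mono)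
    also have "\<dots> \<le> ennreal \<epsilon>" by (rule le[OF xt])
    finally show ?thesis using \<epsilon> by simp
  qed
  then show ?thesis using \<delta> by blast
qed

lemma continuous_on_pot:
  assumes w: "w \<in> words_upto m" and \<psi>: "dominated \<psi>"
  shows "continuous_on (UNIV \<times> {t. 0 < t \<and> ereal t < T}) (\<lambda>(x, t). pot w \<psi> x t)"
  unfolding continuous_on_iff
proof (intro ballI allI impI)
  fix p :: "'a \<times> real" and \<epsilon> :: real
  assume p: "p \<in> UNIV \<times> {t. 0 < t \<and> ereal t < T}" and \<epsilon>: "0 < \<epsilon>"
  obtain x0 t0 where p0: "p = (x0, t0)" "0 < t0" "ereal t0 < T" using p by auto
  obtain \<delta> where \<delta>: "0 < \<delta>" and le: "\<And>x t \<psi>. dominated \<psi> \<Longrightarrow> dist x x0 < \<delta> \<Longrightarrow> \<bar>t - t0\<bar> < \<delta> \<Longrightarrow>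
      0 < t \<and> ereal t < T \<Longrightarrow> \<bar>pot w \<psi> x t - pot w \<psi> x0 t0\<bar> \<le> \<epsilon> / 2"
    using pot_equicontinuous[OF w p0(2,3), of "\<epsilon> / 2"] \<epsilon> by (metis half_gt_zero)
  show "\<exists>\<delta>>0. \<forall>q\<in>UNIV \<times> {t. 0 < t \<and> ereal t < T}. dist q p < \<delta> \<longrightarrow>
      dist (case q of (x, t) \<Rightarrow> pot w \<psi> x t) (case p of (x, t) \<Rightarrow> pot w \<psi> x t) < \<epsilon>"
  proof (intro exI[of _ \<delta>] conjI ballI impI \<delta>)
    fix q :: "'a \<times> real" assume q: "q \<in> UNIV \<times> {t. 0 < t \<and> ereal t < T}" "dist q p < \<delta>"
    obtain x t where qq: "q = (x, t)" by (cases q)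
    have "dist x x0 < \<delta>" "\<bar>t - t0\<bar> < \<delta>"
      using q(2) dist_fst_le[of q p] dist_snd_le[of q p] by (auto simp: qq p0 dist_real_def)
    then have "\<bar>pot w \<psi> x t - pot w \<psi> x0 t0\<bar> \<le> \<epsilon> / 2" using q(1) by (intro le \<psi>) (auto simp: qq)
    then show "dist (case q of (x, t) \<Rightarrow> pot w \<psi> x t) (case p of (x, t) \<Rightarrow> pot w \<psi> x t) < \<epsilon>"
      using \<epsilon> by (simp add: qq p0 dist_real_def)
  qed
qed

text \<open>Every source has either emitted, and \<open>g_deriv\<close> applies, or contributes zero
  for all \<open>h\<close>; so the integrand is differentiable without exceptional set. The
  continuity demanded of the integrated derivative is that of the potential of the longer
  word.\<close>

lemma pot_has_partial_derivative:
  assumes bw: "b # w \<in> words_upto m" and \<psi>: "dominated \<psi>" and t: "0 < t" "ereal t < T"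
  shows "((\<lambda>h. pot w \<psi> (x + h *\<^sub>R b) t) has_real_derivative pot (b # w) \<psi> x t) (at 0)"
proof -
  have w: "w \<in> words_upto m" using bw by (auto simp: words_upto_def)
  let ?f = "\<lambda>w h \<omega>. gz w (x + h *\<^sub>R b) (Y \<omega>) (t - \<sigma> \<omega>) * \<psi> \<omega>"
  have "((\<lambda>h. \<integral>\<omega>. ?f w h \<omega> \<partial>M) has_real_derivative (\<integral>\<omega>. ?f (b # w) 0 \<omega> \<partial>M)) (at 0)"
  proof (rule has_real_derivative_integral_parameter[where C = "CG * Q (length (b # w)) t" and f' = "?f (b # w)"])
    show "sigma_finite_measure M" by unfold_locales
    have sub: "ereal (t - \<sigma> \<omega>) < T" for \<omega>
      using \<sigma>_nonneg t(2) by (metis diff_le_eq ereal_less_eq(3) le_add_same_cancel1 order.strict_trans1)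
    have der: "((\<lambda>h. gz w (x + h *\<^sub>R b) (Y \<omega>) (t - \<sigma> \<omega>)) has_real_derivative gz (b # w) (x + h *\<^sub>R b) (Y \<omega>) (t - \<sigma> \<omega>)) (at h)" for h \<omega>
    proof (cases "0 < t - \<sigma> \<omega>")
      case True
      have "((\<lambda>k. g w ((x + h *\<^sub>R b) + k *\<^sub>R b) (Y \<omega>) (t - \<sigma> \<omega>)) has_real_derivative
          g (b # w) (x + h *\<^sub>R b) (Y \<omega>) (t - \<sigma> \<omega>)) (at 0)"
        by (rule g_deriv[OF bw True sub])
      then have "((\<lambda>k. (\<lambda>h. g w (x + h *\<^sub>R b) (Y \<omega>) (t - \<sigma> \<omega>)) (k + h)) has_real_derivative
          g (b # w) (x + h *\<^sub>R b) (Y \<omega>) (t - \<sigma> \<omega>)) (at 0)"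
        by (simp add: algebra_simps)
      then have "((\<lambda>h. g w (x + h *\<^sub>R b) (Y \<omega>) (t - \<sigma> \<omega>)) has_real_derivative
          g (b # w) (x + h *\<^sub>R b) (Y \<omega>) (t - \<sigma> \<omega>)) (at (0 + h))"
        by (subst DERIV_shift)
      then show ?thesis using True sub by (simp add: gz_def)
    next
      case False
      then show ?thesis by (simp add: gz_def)
    qed
    show "((\<lambda>h. ?f w h \<omega>) has_real_derivative ?f (b # w) h \<omega>) (at h)" for h \<omega>
      by (rule DERIV_cmult_right[OF der])
    show "continuous_on UNIV (\<lambda>h. ?f (b # w) h \<omega>)" for \<omega>
    proof (cases "0 < t - \<sigma> \<omega>")
      case True
      have "continuous_on UNIV ((\<lambda>(x, y, t). g (b # w) x y t) \<circ> (\<lambda>h. (x + h *\<^sub>R b, Y \<omega>, t - \<sigma> \<omega>)))"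
        using True sub by (intro continuous_on_compose continuous_intros continuous_on_subset[OF g_cont[OF bw]]) auto
      then show ?thesis using True sub by (auto simp: gz_def o_def intro!: continuous_intros)
    next
      case False
      then show ?thesis by (simp add: gz_def)
    qed
    show "(\<lambda>(h, \<omega>). ?f (b # w) h \<omega>) \<in> borel_measurable (lborel \<Otimes>\<^sub>M M)"
    proof -
      have [measurable]: "\<psi> \<in> borel_measurable M" using \<psi> by (simp add: dominated_def)
      have "(\<lambda>p. gz (b # w) (x + fst p *\<^sub>R b) (Y (snd p)) (t - \<sigma> (snd p))) \<in> borel_measurable (lborel \<Otimes>\<^sub>M M)"
        by (intro gz_measurable[OF bw]) measurable
      then show ?thesis by (simp add: case_prod_unfold)
    qed
    show "integrable M (?f w h)" for h by (rule integrable_integrand[OF w \<psi> t])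
    show "(\<integral>\<^sup>+\<omega>. ennreal \<bar>?f (b # w) h \<omega>\<bar> \<partial>M) \<le> ennreal (CG * Q (length (b # w)) t)" for h
    proof -
      have "(\<integral>\<^sup>+\<omega>. ennreal \<bar>?f (b # w) h \<omega>\<bar> \<partial>M) \<le> ennreal CG * ennreal (Q (length (b # w)) t)"
        by (rule order_trans[OF nn_integrand_bound[OF bw \<psi>] mult_left_mono[OF total[OF length_le[OF bw] t]]]) simp
      then show ?thesis using CG by (simp add: ennreal_mult')
    qed
    have "continuous_on UNIV ((\<lambda>(x, t). pot (b # w) \<psi> x t) \<circ> (\<lambda>h. (x + h *\<^sub>R b, t)))"
      using t by (intro continuous_on_compose continuous_intros continuous_on_subset[OF continuous_on_pot[OF bw \<psi>]]) auto
    then show "continuous_on UNIV (\<lambda>h. \<integral>\<omega>. ?f (b # w) h \<omega> \<partial>M)"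
      by (simp add: o_def pot_def)
  qed
  then show ?thesis by (simp add: pot_def)
qed

end

section \<open>Exponents and the Duhamel operator\<close>

lemma finite_words_upto: "finite (words_upto m :: 'a::euclidean_space list set)"
  unfolding words_upto_def by (rule finite_lists_length_le[OF finite_Basis])

lemma words_subset_upto: "j \<le> m \<Longrightarrow> words j \<subseteq> words_upto m"
  by (auto simp: words_def words_upto_def)

lemma finite_words: "finite (words j :: 'a::euclidean_space list set)"
  using finite_subset[OF words_subset_upto finite_words_upto] by blast

text \<open>Collects what depends neither on the data nor on \<open>T\<close>, so that the constants
  built here can determine \<gamma> and \<open>C\<close> in advance.\<close>

locale jet_parameters =
  fixes m :: nat and d L CG a0 A q r0 :: real and J :: "nat set" and p :: "nat \<Rightarrow> real"
    and F :: "'a::euclidean_space \<Rightarrow> real \<Rightarrow> ('a list \<Rightarrow> real) \<Rightarrow> real"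
  assumes d_gt: "real m < d" and L_pos: "0 < L" and CG_pos: "0 < CG"
    and struct_F: "structure_condition m d J p A F"
    and r0: "r0 = r_zero DIM('a) d J p A" and r0_pos: "0 < r0"
    and q: "1 < q" "q \<le> p_sum J p"
begin

definition mass :: real where "mass = kern_mass L TYPE('a)"

definition \<nu> :: real where "\<nu> = real DIM('a) / (d * r0)"
definition \<beta> :: real where "\<beta> = \<nu> * (q - 1)"
text \<open>In \<open>M0\<close> the first summand pays for the linear potential and the 1 is the
  allowance of the nonlinear one. \<open>cT\<close> is the cost of changing the time in \<theta> by
  a factor two. \<open>M1\<close> is \<open>M0\<close> enlarged for a jet evaluated at an earlier
  time not below \<open>s/2\<close>, and for estimating Euclidean norms by sums over components.
  \<open>Cn\<close> collects the composition of kernels, one change of time, and the time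
  integral.\<close>

definition M0 :: real where "M0 = CG * (mass + 1) + 1"
definition cT :: real where "cT = (2 powr (1 / d)) powr (real DIM('a) + 2 * L)"
definition M1 :: real where
  "M1 = real (card (words_upto m :: 'a list set)) * (2 powr (real m / d) * cT powr (1 / q)) * M0"
definition beta_sum :: real where "beta_sum = (\<Sum>j\<le>m. beta_const (real j / d) \<beta>)"
definition Cn :: real where
  "Cn = 3 powr (real DIM('a) + 2 * L) * (2 * mass) * cT * beta_sum"

lemma d_pos': "0 < d" using d_gt by linarith

lemma mass_pos: "0 < mass" unfolding mass_def by (rule kern_mass_pos[OF L_pos])

lemma \<nu>_pos: "0 < \<nu>" unfolding \<nu>_def using d_pos' r0_pos by simp

lemma \<beta>_pos: "0 < \<beta>" unfolding \<beta>_def using \<nu>_pos q by simp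

lemma M0_pos: "0 < M0" unfolding M0_def using CG_pos mass_pos by (simp add: add_pos_pos)

lemma cT_ge_1: "1 \<le> cT"
  unfolding cT_def using d_pos' L_pos by (intro ge_one_powr_ge_zero) auto

lemma j_over_d: "j \<le> m \<Longrightarrow> 0 \<le> real j / d \<and> real j / d < 1"
  using d_gt d_pos' by auto

lemma card_words_pos: "1 \<le> real (card (words_upto m :: 'a list set))"
proof -
  have "[] \<in> (words_upto m :: 'a list set)" by (simp add: words_upto_def)
  then have "0 < card (words_upto m :: 'a list set)" using finite_words_upto card_gt_0_iff by blast
  then show ?thesis by simp
qed

lemma M1_pos: "0 < M1"
  unfolding M1_def using card_words_pos M0_pos cT_ge_1 by (intro mult_pos_pos) auto

lemma beta_sum_ge: "j \<le> m \<Longrightarrow> beta_const (real j / d) \<beta> \<le> beta_sum"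
  unfolding beta_sum_def using j_over_d \<beta>_pos by (intro member_le_sum) (auto intro!: less_imp_le beta_const_pos)

lemma Cn_nonneg: "0 \<le> Cn"
proof -
  have "0 \<le> beta_sum"
    unfolding beta_sum_def using j_over_d \<beta>_pos by (intro sum_nonneg less_imp_le beta_const_pos) auto
  then show ?thesis unfolding Cn_def using mass_pos cT_ge_1 by simp
qed

text \<open>Equivalent to \<open>A - p_weight J p / d - \<nu> * p_sum J p = - \<nu> - 1\<close>, the
  scale invariance that singles out \<open>r0\<close>. Keeping one factor \<theta> instead of its
  bound \<open>s powr (-q\<nu>)\<close> saves \<open>q\<nu>\<close> in the exponent and leaves
  \<open>\<beta> - 1 > -1\<close>.\<close>

lemma exponent_identity:
  "A - p_weight J p / d - \<nu> * (p_sum J p - q) = \<beta> - 1"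
proof -
  have P: "1 < p_sum J p" "p_weight J p < d * (1 + A)"
    using struct_F by (auto simp: structure_condition_def)
  have r: "r0 = real DIM('a) * (p_sum J p - 1) / (d * (1 + A) - p_weight J p)"
    using r0 by (simp add: r_zero_def)
  have "r0 * (d * (1 + A) - p_weight J p) = real DIM('a) * (p_sum J p - 1)"
    using P unfolding r by simp
  then have "\<nu> * (p_sum J p - 1) = r0 * (d * (1 + A) - p_weight J p) / (d * r0)"
    unfolding \<nu>_def by simp
  also have "\<dots> = (d * (1 + A) - p_weight J p) / d" using r0_pos by simp
  also have "\<dots> = 1 + A - p_weight J p / d" using d_pos' by (simp add: diff_divide_distrib)
  finally show ?thesis unfolding \<beta>_def by (simp add: algebra_simps)
qed

text \<open>A pointwise bound of the jet by \<open>\<theta> powr (1/q)\<close> makes the nonlinearity linear in \<open>\<theta>\<close>: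
  the surplus power of \<open>\<theta>\<close> is absorbed by its decay in time.\<close>

lemma F_bound:
  assumes s: "0 < s" and \<theta>: "0 \<le> \<theta>" "\<theta> \<le> e * s powr (- q * \<nu>)" and e: "0 < e"
    and z: "z \<in> jet_space m"
    and zb: "\<And>w. w \<in> words_upto m \<Longrightarrow>
      \<bar>z w\<bar> \<le> 2 powr (real m / d) * cT powr (1 / q) * M0 * (s powr (- real (length w) / d) * \<theta> powr (1 / q))"
  shows "\<bar>F y s z\<bar> \<le> M1 powr p_sum J p * e powr (p_sum J p / q - 1) * (s powr (\<beta> - 1) * \<theta>)"
proof -
  have st: "\<bar>F y s z\<bar> \<le> s powr A * (\<Prod>j\<in>J. block_norm j z powr p j)" "J \<subseteq> {0..m}" "\<And>j. j \<in> J \<Longrightarrow> 0 < p j" "1 < p_sum J p"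
    using struct_F s z by (auto simp: structure_condition_def)
  have finJ: "finite J" using st(2) finite_subset by blast
  have bn: "block_norm j z \<le> M1 * (s powr (- real j / d) * \<theta> powr (1 / q))" if "j \<in> J" for j
  proof -
    have j: "j \<le> m" using that st(2) by auto
    let ?b = "2 powr (real m / d) * cT powr (1 / q) * M0 * (s powr (- real j / d) * \<theta> powr (1 / q))"
    have b0: "0 \<le> ?b" using M0_pos by simp
    have "block_norm j z \<le> (\<Sum>w\<in>words j. \<bar>z w\<bar>)"
      unfolding block_norm_def by (rule L2_set_le_sum_abs)
    also have "\<dots> \<le> (\<Sum>w\<in>(words j :: 'a list set). ?b)"
      using zb words_subset_upto[OF j] by (intro sum_mono) (force simp: words_def)
    also have "\<dots> = real (card (words j :: 'a list set)) * ?b" by simp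
    also have "\<dots> \<le> real (card (words_upto m :: 'a list set)) * ?b"
      using b0 words_subset_upto[OF j] finite_words_upto by (intro mult_right_mono) (auto intro: card_mono)
    also have "\<dots> = M1 * (s powr (- real j / d) * \<theta> powr (1 / q))"
      by (simp add: M1_def mult_ac)
    finally show ?thesis .
  qed
  have "\<bar>F y s z\<bar> \<le> s powr A * (\<Prod>j\<in>J. block_norm j z powr p j)" by (rule st(1))
  also have "\<dots> \<le> s powr A * (\<Prod>j\<in>J. (M1 * (s powr (- real j / d) * \<theta> powr (1 / q))) powr p j)"
    using bn st(3) by (intro mult_left_mono prod_mono conjI powr_mono2)
      (auto simp: block_norm_def L2_set_nonneg less_imp_le)
  also have "(\<Prod>j\<in>J. (M1 * (s powr (- real j / d) * \<theta> powr (1 / q))) powr p j)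
      = (\<Prod>j\<in>J. M1 powr p j * (s powr (- (real j * p j) / d) * (\<theta> powr (1 / q)) powr p j))"
    using M1_pos by (intro prod.cong refl) (simp add: powr_mult powr_powr)
  also have "\<dots> = M1 powr p_sum J p * (s powr (- p_weight J p / d) * (\<theta> powr (1 / q)) powr p_sum J p)"
  proof (cases "\<theta> = 0")
    case True
    \<comment> \<open>For \<theta> = 0 both sides must vanish, and the empty product would be 1; it
      is excluded by \<open>|p| > 1\<close>.\<close>
    have "J \<noteq> {}" using st(4) by (auto simp: p_sum_def)
    then show ?thesis using True finJ st(4) by (auto simp: prod_zero_iff)
  next
    case False
    have "(\<Sum>j\<in>J. - (real j * p j) / d) = - p_weight J p / d"
      unfolding p_weight_def by (simp only: sum_divide_distrib[symmetric] sum_negf)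
    then show ?thesis using M1_pos s finJ False
      by (simp add: prod.distrib p_sum_def flip: powr_sum)
  qed
  \<comment> \<open>The surplus exponent \<open>|p|/q - 1\<close> is nonnegative since
    \<open>q \<le> |p|\<close>, so the surplus power increases with \<theta> and the upper bound may
    be inserted.\<close>
  also have "(\<theta> powr (1 / q)) powr p_sum J p \<le> \<theta> * (e * s powr (- q * \<nu>)) powr (p_sum J p / q - 1)"
  proof (cases "\<theta> = 0")
    case True
    then show ?thesis by simp
  next
    case False
    then have "(\<theta> powr (1 / q)) powr p_sum J p = \<theta> powr 1 * \<theta> powr (p_sum J p / q - 1)"
      by (simp only: powr_powr powr_add[symmetric]) simp
    also have "\<dots> = \<theta> * \<theta> powr (p_sum J p / q - 1)" using \<theta> by simp
    also have "\<dots> \<le> \<theta> * (e * s powr (- q * \<nu>)) powr (p_sum J p / q - 1)"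
      using \<theta> q by (intro mult_left_mono powr_mono2) (auto simp: field_simps)
    finally show ?thesis .
  qed
  also have "(e * s powr (- q * \<nu>)) powr (p_sum J p / q - 1)
      = e powr (p_sum J p / q - 1) * s powr (- \<nu> * (p_sum J p - q))"
  proof -
    have "(- q * \<nu>) * (p_sum J p / q - 1) = - \<nu> * (p_sum J p - q)" using q by (simp add: field_simps)
    then show ?thesis using e by (simp only: powr_mult powr_powr)
  qed
  finally have "\<bar>F y s z\<bar> \<le> s powr A * (M1 powr p_sum J p * (s powr (- p_weight J p / d) *
      (\<theta> * (e powr (p_sum J p / q - 1) * s powr (- \<nu> * (p_sum J p - q))))))"
    by (simp add: mult_left_mono)
  also have "\<dots> = M1 powr p_sum J p * e powr (p_sum J p / q - 1) *
      ((s powr A * s powr (- p_weight J p / d) * s powr (- \<nu> * (p_sum J p - q))) * \<theta>)"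
    by (simp only: mult_ac)
  also have "s powr A * s powr (- p_weight J p / d) * s powr (- \<nu> * (p_sum J p - q)) = s powr (\<beta> - 1)"
  proof -
    have "A + - p_weight J p / d + - \<nu> * (p_sum J p - q) = \<beta> - 1"
      using exponent_identity by simp
    then show ?thesis by (simp only: powr_add[symmetric])
  qed
  finally show ?thesis .
qed

end

text \<open>The number \<open>e\<close> measures the data through their averages. In
  \<open>small\<close>, the exponent \<open>(|p| - 1)/q\<close> is the sum of
  \<open>|p|/q - 1\<close>, from the bound of the nonlinearity, and \<open>1 - 1/q\<close>, from the
  return from \<theta> to \<open>\<theta> powr (1/q)\<close>; the right-hand side 1 is the allowance
  in \<open>M0\<close>.\<close>

locale jet_problem = jet_parameters m d L CG a0 A q r0 J p F + jet_kernel m d L CG T g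
  for m d L CG a0 A q r0 J p and F :: "'a::euclidean_space \<Rightarrow> real \<Rightarrow> ('a list \<Rightarrow> real) \<Rightarrow> real"
    and T :: ereal and g :: "'a list \<Rightarrow> 'a \<Rightarrow> 'a \<Rightarrow> real \<Rightarrow> real" +
  fixes \<phi> :: "'a \<Rightarrow> real" and e :: real
  assumes \<phi>_measurable [measurable]: "\<phi> \<in> borel_measurable borel"
    and e_pos: "0 < e"
    and smear_le: "0 < t \<Longrightarrow> ereal t < T \<Longrightarrow>
      smear L (t powr (1 / d)) (\<lambda>y. \<bar>\<phi> y\<bar> powr q) x \<le> ennreal (e * t powr (- q * \<nu>))"
    and small: "\<bar>a0\<bar> * CG * (M1 powr p_sum J p * Cn * e powr ((p_sum J p - 1) / q)) \<le> 1"
begin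

section \<open>The profile of the data, and the linear and nonlinear sources\<close>

abbreviation times :: "real set" where "times \<equiv> {t. 0 < t \<and> ereal t < T}"

text \<open>Outside the time range the average may be infinite, and \<open>enn2real\<close> then
  returns 0; the value is identified with the average for \<open>0 < t < T\<close> only.\<close>

definition \<theta> :: "real \<Rightarrow> 'a \<Rightarrow> real" where
  "\<theta> t x = enn2real (smear L (t powr (1 / d)) (\<lambda>y. \<bar>\<phi> y\<bar> powr q) x)"

definition \<kappa> :: real where
  "\<kappa> = M1 powr p_sum J p * e powr (p_sum J p / q - 1)"

lemma \<kappa>_nonneg: "0 \<le> \<kappa>" by (simp add: \<kappa>_def)

lemma \<theta>_nonneg [simp]: "0 \<le> \<theta> t x" by (simp add: \<theta>_def)

lemma \<theta>_measurable [measurable]: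
  assumes [measurable]: "r \<in> borel_measurable M" "f \<in> borel_measurable M"
  shows "(\<lambda>z. \<theta> (r z) (f z)) \<in> borel_measurable M"
  unfolding \<theta>_def by measurable

lemma times_mono: "s \<le> t \<Longrightarrow> ereal t < T \<Longrightarrow> ereal s < T"
  using ereal_less_eq(3)[of s t] order.strict_trans1 by blast

lemma smear_eq_\<theta>:
  assumes "0 < t" "ereal t < T"
  shows "smear L (t powr (1 / d)) (\<lambda>y. \<bar>\<phi> y\<bar> powr q) x = ennreal (\<theta> t x)"
  unfolding \<theta>_def using smear_le[OF assms, of x] by (auto simp: ennreal_enn2real_if top_unique)

lemma \<theta>_le: "0 < t \<Longrightarrow> ereal t < T \<Longrightarrow> \<theta> t x \<le> e * t powr (- q * \<nu>)"
  using smear_le[of t x] smear_eq_\<theta>[of t x] e_pos by simp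

lemma \<theta>_root_le: "0 < t \<Longrightarrow> ereal t < T \<Longrightarrow> \<theta> t x powr (1 / q) \<le> e powr (1 / q) * t powr (- \<nu>)"
proof -
  assume t: "0 < t" "ereal t < T"
  have "\<theta> t x powr (1 / q) \<le> (e * t powr (- q * \<nu>)) powr (1 / q)"
    using \<theta>_le[OF t, of x] q by (intro powr_mono2) auto
  also have "\<dots> = e powr (1 / q) * t powr (- \<nu>)"
    using e_pos q by (simp add: powr_mult powr_powr)
  finally show ?thesis .
qed

text \<open>The surplus power \<open>1 - 1/q\<close> of \<theta> is at most
  \<open>e powr (1 - 1/q) * t powr (-\<beta>)\<close>, which \<open>t powr \<beta>\<close> cancels
  exactly. This brings the Duhamel term, estimated linearly in \<theta>, back to the form of the
  ansatz.\<close>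

lemma \<theta>_times_power_le:
  assumes t: "0 < t" "ereal t < T"
  shows "\<theta> t x * t powr \<beta> \<le> e powr (1 - 1 / q) * \<theta> t x powr (1 / q)"
proof (cases "\<theta> t x = 0")
  case False
  then have "\<theta> t x = \<theta> t x powr (1 / q) * \<theta> t x powr (1 - 1 / q)"
    by (simp flip: powr_add)
  also have "\<dots> \<le> \<theta> t x powr (1 / q) * (e * t powr (- q * \<nu>)) powr (1 - 1 / q)"
    using \<theta>_le[OF t, of x] q by (intro mult_left_mono powr_mono2) auto
  also have "(e * t powr (- q * \<nu>)) powr (1 - 1 / q) = e powr (1 - 1 / q) * t powr (- \<beta>)"
  proof -
    have "(- q * \<nu>) * (1 - 1 / q) = - \<beta>" using q by (simp add: \<beta>_def field_simps)
    then show ?thesis using e_pos by (simp only: powr_mult powr_powr)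
  qed
  finally have "\<theta> t x * t powr \<beta> \<le> (\<theta> t x powr (1 / q) * (e powr (1 - 1 / q) * t powr (- \<beta>))) * t powr \<beta>"
    by (intro mult_right_mono) auto
  also have "\<dots> = e powr (1 - 1 / q) * \<theta> t x powr (1 / q)"
    using t by (simp add: powr_minus)
  finally show ?thesis .
qed simp

lemma \<theta>_compare:
  assumes "0 < t" "ereal t < T" "t / 2 \<le> s" "s \<le> t"
  shows "\<theta> s x \<le> cT * \<theta> t x"
proof -
  have s: "0 < s" "ereal s < T" using assms times_mono[of s t] by auto
  have r: "s powr (1 / d) \<le> t powr (1 / d)" using s assms d_pos by (intro powr_mono2) auto
  have r': "t powr (1 / d) \<le> 2 powr (1 / d) * s powr (1 / d)"
    using s assms d_pos by (subst powr_mult[symmetric]) (auto intro!: powr_mono2)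
  have c1: "1 \<le> 2 powr (1 / d)" using d_pos by (simp add: ge_one_powr_ge_zero)
  have "s powr (1 / d) \<le> 2 powr (1 / d) * t powr (1 / d)"
    using r mult_right_mono[OF c1, of "t powr (1 / d)"] by simp
  then have "smear L (s powr (1 / d)) (\<lambda>y. \<bar>\<phi> y\<bar> powr q) x \<le> ennreal cT * smear L (t powr (1 / d)) (\<lambda>y. \<bar>\<phi> y\<bar> powr q) x"
    unfolding cT_def using s assms r' c1 L_pos by (intro smear_compare) auto
  then show ?thesis
    using smear_eq_\<theta>[OF s] smear_eq_\<theta>[OF assms(1,2)] cT_ge_1 by (simp flip: ennreal_mult)
qed

lemma linear_total:
  assumes "0 < t" "ereal t < T"
  shows "(\<integral>\<^sup>+y. ennreal (decay j x y t * \<bar>\<phi> y\<bar>) \<partial>lborel)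
    \<le> ennreal (t powr (- real j / d) * ((mass + 1) * \<theta> t x powr (1 / q)))"
proof -
  have "(\<integral>\<^sup>+y. ennreal (decay j x y t * \<bar>\<phi> y\<bar>) \<partial>lborel)
      = (\<integral>\<^sup>+y. ennreal (t powr (- real j / d)) * (ennreal (kern L (t powr (1 / d)) x y) * ennreal \<bar>\<phi> y\<bar>) \<partial>lborel)"
    using assms by (intro nn_integral_cong) (simp add: decay_def ennreal_mult mult.assoc)
  also have "\<dots> = ennreal (t powr (- real j / d)) * (\<integral>\<^sup>+y. ennreal (kern L (t powr (1 / d)) x y) * ennreal \<bar>\<phi> y\<bar> \<partial>lborel)"
    by (rule nn_integral_cmult) measurable
  also have "\<dots> \<le> ennreal (t powr (- real j / d)) * ennreal ((mass + 1) * \<theta> t x powr (1 / q))"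
    using assms q L_pos unfolding mass_def
    by (intro mult_left_mono nn_integral_kern_le_smear_powr smear_eq_\<theta>) auto
  also have "\<dots> = ennreal (t powr (- real j / d) * ((mass + 1) * \<theta> t x powr (1 / q)))"
    using mass_pos by (simp flip: ennreal_mult)
  finally show ?thesis .
qed

text \<open>The initial datum is a source that emits everything at time 0.\<close>

sublocale lin: jet_source m d L CG T g "lborel :: 'a measure" "\<lambda>_. 0" "\<lambda>y. y" "\<lambda>y. \<bar>\<phi> y\<bar>"
  "\<lambda>j t. t powr (- real j / d) * ((mass + 1) * (e powr (1 / q) * t powr (- \<nu>)))"
proof unfold_locales
  fix j x t assume t: "0 < t" "ereal t < T"
  have "(\<integral>\<^sup>+y. ennreal (decay j x y (t - 0) * \<bar>\<phi> y\<bar>) \<partial>lborel) \<le> ennreal (t powr (- real j / d) * ((mass + 1) * \<theta> t x powr (1 / q)))"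
    using linear_total[OF t] by simp
  also have "\<dots> \<le> ennreal (t powr (- real j / d) * ((mass + 1) * (e powr (1 / q) * t powr (- \<nu>))))"
    using \<theta>_root_le[OF t, of x] mass_pos by (intro ennreal_leI mult_left_mono) auto
  finally show "(\<integral>\<^sup>+y. ennreal (decay j x y (t - 0) * \<bar>\<phi> y\<bar>) \<partial>lborel) \<le> \<dots>" .
next
  \<comment> \<open>With \<eta> = \<open>t0\<close> the set of late emissions is empty.\<close>
  fix j :: nat and t0 \<epsilon> :: real assume "0 < t0"
  then show "\<exists>\<eta>>0. \<forall>x t. \<bar>t - t0\<bar> < \<eta> \<longrightarrow>
        (\<integral>\<^sup>+y. ennreal (decay j x y (t - 0) * \<bar>\<phi> y\<bar>) * indicator {y::'a. t0 - \<eta> < 0} y \<partial>lborel) \<le> ennreal \<epsilon>"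
    by (intro exI[of _ t0]) auto
qed auto

definition BB :: "'a \<times> real \<Rightarrow> real" where
  "BB \<omega> = (if 0 < snd \<omega> \<and> ereal (snd \<omega>) < T then \<kappa> * (snd \<omega> powr (\<beta> - 1) * \<theta> (snd \<omega>) (fst \<omega>)) else 0)"

lemma BB_measurable [measurable]: "BB \<in> borel_measurable borel"
proof -
  have "BB \<in> borel_measurable (borel \<Otimes>\<^sub>M borel)"
    unfolding BB_def by measurable
  then show ?thesis by (simp add: borel_prod)
qed

lemma BB_nonneg [simp]: "0 \<le> BB \<omega>"
  by (simp add: BB_def \<kappa>_nonneg)

lemma nn_integral_space_time:
  fixes f :: "'a \<times> real \<Rightarrow> ennreal"
  assumes "f \<in> borel_measurable borel"
  shows "(\<integral>\<^sup>+\<omega>. f \<omega> \<partial>lborel) = (\<integral>\<^sup>+s. (\<integral>\<^sup>+y. f (y, s) \<partial>lborel) \<partial>lborel)"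
proof -
  have "(\<lambda>(y, s). f (y, s)) \<in> borel_measurable (lborel \<Otimes>\<^sub>M lborel)"
    using assms by (simp add: lborel_prod)
  from lborel_pair.nn_integral_snd[OF this] show ?thesis by (simp add: lborel_prod)
qed

lemma decay_BB_measurable:
  "(\<lambda>\<omega>. ennreal (decay j x (fst \<omega>) (t - max 0 (snd \<omega>)) * BB \<omega>)) \<in> borel_measurable borel"
  by (intro measurable_compose[OF _ measurable_ennreal] borel_measurable_times decay_measurable
      borel_measurable_diff borel_measurable_max BB_measurable borel_measurable_const
      borel_measurable_continuous_onI continuous_intros)

text \<open>At fixed \<open>s\<close> the composition bound turns \<open>\<theta> s\<close> into the
  average at the larger of the two radii, which is comparable to \<open>t powr (1/d)\<close> because
  the larger of \<open>s\<close> and \<open>t - s\<close> is at least \<open>t/2\<close>. What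
  remains is a beta integral, convergent at \<open>s = t\<close> since \<open>j < d\<close> and at
  \<open>s = 0\<close> since \<open>\<beta> > 0\<close>.\<close>

lemma nonlinear_total:
  assumes j: "j \<le> m" and t: "0 < t" "ereal t < T"
  shows "(\<integral>\<^sup>+\<omega>. ennreal (decay j x (fst \<omega>) (t - max 0 (snd \<omega>)) * BB \<omega>) \<partial>lborel)
    \<le> ennreal (t powr (- real j / d) * (\<kappa> * Cn * e powr (1 - 1 / q) * \<theta> t x powr (1 / q)))"
proof -
  let ?\<alpha> = "real j / d"
  let ?K = "3 powr (real DIM('a) + 2 * L) * (2 * mass)"
  have K0: "0 \<le> ?K" using mass_pos by simp
  have inner: "(\<integral>\<^sup>+y. ennreal (decay j x y (t - max 0 s) * BB (y, s)) \<partial>lborel)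
      \<le> ennreal (\<kappa> * (?K * cT * \<theta> t x)) * (ennreal ((t - s) powr (- ?\<alpha>) * s powr (\<beta> - 1)) * indicator {0<..<t} s)" for s
  proof (cases "s \<in> {0<..<t}")
    case True
    then have s: "0 < s" "s < t" "ereal s < T" using times_mono[of s t] t by auto
    let ?a = "\<kappa> * ((t - s) powr (- ?\<alpha>) * s powr (\<beta> - 1))"
    let ?\<rho> = "(t - s) powr (1 / d)" and ?\<rho>' = "s powr (1 / d)"
    have a0: "0 \<le> ?a" using \<kappa>_nonneg by simp
    have "(\<integral>\<^sup>+y. ennreal (decay j x y (t - max 0 s) * BB (y, s)) \<partial>lborel)
        = (\<integral>\<^sup>+y. ennreal ?a * (ennreal (kern L ?\<rho> x y) * smear L ?\<rho>' (\<lambda>y. \<bar>\<phi> y\<bar> powr q) y) \<partial>lborel)"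
    proof (intro nn_integral_cong)
      fix y
      have "decay j x y (t - max 0 s) * BB (y, s) = ?a * (kern L ?\<rho> x y * \<theta> s y)"
        using s by (simp add: decay_def BB_def max_def mult_ac)
      then have "ennreal (decay j x y (t - max 0 s) * BB (y, s)) = ennreal (?a * (kern L ?\<rho> x y * \<theta> s y))"
        by simp
      also have "\<dots> = ennreal ?a * (ennreal (kern L ?\<rho> x y) * ennreal (\<theta> s y))"
        by (simp only: ennreal_mult'[OF a0] ennreal_mult'[OF kern_nonneg])
      finally show "ennreal (decay j x y (t - max 0 s) * BB (y, s)) = ennreal ?a * (ennreal (kern L ?\<rho> x y) * smear L ?\<rho>' (\<lambda>y. \<bar>\<phi> y\<bar> powr q) y)"
        using s by (simp add: smear_eq_\<theta>)
    qed
    also have "\<dots> = ennreal ?a * (\<integral>\<^sup>+y. ennreal (kern L ?\<rho> x y) * smear L ?\<rho>' (\<lambda>y. \<bar>\<phi> y\<bar> powr q) y \<partial>lborel)"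
      by (rule nn_integral_cmult) measurable
    also have "\<dots> \<le> ennreal ?a * (ennreal ?K * smear L (max ?\<rho> ?\<rho>') (\<lambda>y. \<bar>\<phi> y\<bar> powr q) x)"
      using s L_pos unfolding mass_def by (intro mult_left_mono nn_integral_kern_smear) auto
    also have "smear L (max ?\<rho> ?\<rho>') (\<lambda>y. \<bar>\<phi> y\<bar> powr q) x \<le> ennreal cT * smear L (t powr (1 / d)) (\<lambda>y. \<bar>\<phi> y\<bar> powr q) x"
    proof -
      have c1: "1 \<le> 2 powr (1 / d)" using d_pos by (simp add: ge_one_powr_ge_zero)
      have u: "max ?\<rho> ?\<rho>' = (max (t - s) s) powr (1 / d)"
      proof (cases "t - s \<le> s")
        case True
        then have "?\<rho> \<le> ?\<rho>'" using s d_pos by (intro powr_mono2) auto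
        then show ?thesis using True by (simp add: max_absorb2)
      next
        case False
        then have "?\<rho>' \<le> ?\<rho>" using s d_pos by (intro powr_mono2) auto
        then show ?thesis using False by (simp add: max_absorb1)
      qed
      have r: "max ?\<rho> ?\<rho>' \<le> t powr (1 / d)" unfolding u using s d_pos by (intro powr_mono2) auto
      have r': "t powr (1 / d) \<le> 2 powr (1 / d) * max ?\<rho> ?\<rho>'"
        unfolding u using s d_pos by (subst powr_mult[symmetric]) (auto intro!: powr_mono2 simp: max_def)
      have "max ?\<rho> ?\<rho>' \<le> 2 powr (1 / d) * t powr (1 / d)"
        using r mult_right_mono[OF c1, of "t powr (1 / d)"] by simp
      then show ?thesis
        unfolding cT_def using s r' c1 L_pos t by (intro smear_compare) (auto simp: less_max_iff_disj)
    qed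
    also have "ennreal ?a * (ennreal ?K * (ennreal cT * smear L (t powr (1 / d)) (\<lambda>y. \<bar>\<phi> y\<bar> powr q) x))
        = ennreal (?a * (?K * (cT * \<theta> t x)))"
      unfolding smear_eq_\<theta>[OF t]
      by (simp only: ennreal_mult'[OF a0] ennreal_mult'[OF K0] ennreal_mult'[OF order_trans[OF zero_le_one cT_ge_1]])
    also have "?a * (?K * (cT * \<theta> t x)) = (\<kappa> * (?K * cT * \<theta> t x)) * ((t - s) powr (- ?\<alpha>) * s powr (\<beta> - 1))"
      by (simp only: mult_ac)
    also have "ennreal \<dots> = ennreal (\<kappa> * (?K * cT * \<theta> t x)) * ennreal ((t - s) powr (- ?\<alpha>) * s powr (\<beta> - 1))"
      using K0 cT_ge_1 \<kappa>_nonneg by (intro ennreal_mult) auto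
    finally show ?thesis using True by (simp add: mult_left_mono)
  next
    case False
    then have "decay j x y (t - max 0 s) * BB (y, s) = 0" for y
      by (auto simp: decay_def BB_def)
    then have "(\<integral>\<^sup>+y. ennreal (decay j x y (t - max 0 s) * BB (y, s)) \<partial>lborel) = 0"
      by (simp only: ennreal_0 nn_integral_const mult_zero_left)
    then show ?thesis by simp
  qed
  note meas = decay_BB_measurable[of j x t]
  have "(\<integral>\<^sup>+\<omega>. ennreal (decay j x (fst \<omega>) (t - max 0 (snd \<omega>)) * BB \<omega>) \<partial>lborel)
     = (\<integral>\<^sup>+s. (\<integral>\<^sup>+y. ennreal (decay j x y (t - max 0 s) * BB (y, s)) \<partial>lborel) \<partial>lborel)"
    using nn_integral_space_time[OF meas] by simp
  also have "\<dots> \<le> (\<integral>\<^sup>+s. ennreal (\<kappa> * (?K * cT * \<theta> t x)) * (ennreal ((t - s) powr (- ?\<alpha>) * s powr (\<beta> - 1)) * indicator {0<..<t} s) \<partial>lborel)"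
    by (intro nn_integral_mono inner)
  also have "\<dots> = ennreal (\<kappa> * (?K * cT * \<theta> t x)) * (\<integral>\<^sup>+s. ennreal ((t - s) powr (- ?\<alpha>) * s powr (\<beta> - 1)) * indicator {0<..<t} s \<partial>lborel)"
    by (rule nn_integral_cmult) measurable
  also have "\<dots> \<le> ennreal (\<kappa> * (?K * cT * \<theta> t x)) * ennreal (beta_const ?\<alpha> \<beta> * t powr (\<beta> - ?\<alpha>))"
    using j_over_d[OF j] \<beta>_pos t by (intro mult_left_mono nn_integral_beta) auto
  also have "\<dots> \<le> ennreal (\<kappa> * (?K * cT * \<theta> t x)) * ennreal (beta_sum * t powr (\<beta> - ?\<alpha>))"
    using beta_sum_ge[OF j] by (intro mult_left_mono ennreal_leI mult_right_mono) auto
  also have "\<dots> = ennreal (\<kappa> * (?K * cT * \<theta> t x) * (beta_sum * t powr (\<beta> - ?\<alpha>)))"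
    using K0 cT_ge_1 \<kappa>_nonneg by (intro ennreal_mult'[symmetric]) auto
  also have "\<kappa> * (?K * cT * \<theta> t x) * (beta_sum * t powr (\<beta> - ?\<alpha>))
     = t powr (- real j / d) * (\<kappa> * Cn * (\<theta> t x * t powr \<beta>))"
  proof -
    have "t powr (\<beta> - ?\<alpha>) = t powr (- real j / d) * t powr \<beta>" by (simp flip: powr_add)
    then show ?thesis unfolding Cn_def by (simp only: mult_ac)
  qed
  also have "\<dots> \<le> t powr (- real j / d) * (\<kappa> * Cn * (e powr (1 - 1 / q) * \<theta> t x powr (1 / q)))"
    using \<kappa>_nonneg Cn_nonneg by (intro mult_left_mono \<theta>_times_power_le[OF t]) auto
  finally show ?thesis by (simp add: mult.assoc ennreal_leI)
qed

text \<open>Inserting the supremum of \<theta> produces the exponent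
  \<open>\<beta> - 1 - q\<nu> = -\<nu> - 1\<close>. This is useless near time 0, but gives a bound
  uniform in space at times bounded away from it.\<close>

lemma BB_le:
  assumes "0 < t0" "t0 / 2 \<le> s"
  shows "BB (y, s) \<le> \<kappa> * (e * (t0 / 2) powr (- \<nu> - 1))"
proof (cases "0 < s \<and> ereal s < T")
  case True
  have "s powr (\<beta> - 1) * \<theta> s y \<le> s powr (\<beta> - 1) * (e * s powr (- q * \<nu>))"
    using True by (intro mult_left_mono \<theta>_le) auto
  also have "\<dots> = e * (s powr (\<beta> - 1) * s powr (- q * \<nu>))" by simp
  also have "s powr (\<beta> - 1) * s powr (- q * \<nu>) = s powr (- \<nu> - 1)"
  proof -
    have "\<beta> - 1 + (- q * \<nu>) = - \<nu> - 1" by (simp add: \<beta>_def algebra_simps)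
    then show ?thesis by (simp only: powr_add[symmetric])
  qed
  also have "e * s powr (- \<nu> - 1) \<le> e * (t0 / 2) powr (- \<nu> - 1)"
    using assms \<nu>_pos e_pos by (intro mult_left_mono powr_mono2') auto
  finally show ?thesis using True \<kappa>_nonneg by (simp add: BB_def mult_left_mono)
next
  case False
  then show ?thesis using \<kappa>_nonneg e_pos by (auto simp: BB_def)
qed

text \<open>Late emissions seen at time \<open>t\<close> lie in the window from
  \<open>t - 2\<eta>\<close> to \<open>t\<close> and after \<open>t0/2\<close>. There the forcing is
  bounded, the space integral contributes \<open>mass\<close>, and the time singularity leaves a
  multiple of \<open>(2\<eta>) powr (1 - j/d)\<close>, small with \<eta> as
  \<open>j < d\<close>.\<close>

lemma nonlinear_tail:
  assumes j: "j \<le> m" and t0: "0 < t0" and \<epsilon>: "0 < \<epsilon>"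
  shows "\<exists>\<eta>>0. \<forall>x t. \<bar>t - t0\<bar> < \<eta> \<longrightarrow>
    (\<integral>\<^sup>+\<omega>. ennreal (decay j x (fst \<omega>) (t - max 0 (snd \<omega>)) * BB \<omega>) * indicator {\<omega>. t0 - \<eta> < max 0 (snd \<omega>)} \<omega> \<partial>lborel) \<le> ennreal \<epsilon>"
proof -
  let ?\<alpha> = "real j / d"
  have \<alpha>: "0 \<le> ?\<alpha>" "?\<alpha> < 1" using j_over_d[OF j] by auto
  define S where "S = \<kappa> * (e * (t0 / 2) powr (- \<nu> - 1))"
  have S0: "0 \<le> S" using \<kappa>_nonneg e_pos by (simp add: S_def)
  define Z where "Z = S * mass / (1 - ?\<alpha>)"
  have Z0: "0 \<le> Z" unfolding Z_def using S0 mass_pos \<alpha> by simp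
  \<comment> \<open>Chosen so that \<open>\<mu> powr (1 - j/d) = \<epsilon> / (Z + 1)\<close>; the
    added 1 permits \<open>Z = 0\<close>.\<close>
  define \<mu> where "\<mu> = (\<epsilon> / (Z + 1)) powr (1 / (1 - ?\<alpha>))"
  have \<mu>: "0 < \<mu>" using \<epsilon> Z0 by (simp add: \<mu>_def)
  define \<eta> where "\<eta> = min (t0 / 2) (\<mu> / 2)"
  have \<eta>: "0 < \<eta>" "\<eta> \<le> t0 / 2" "2 * \<eta> \<le> \<mu>" using t0 \<mu> by (auto simp: \<eta>_def)
  show ?thesis
  proof (intro exI[of _ \<eta>] conjI allI impI \<eta>(1))
    fix x t assume t: "\<bar>t - t0\<bar> < \<eta>"
    let ?f = "\<lambda>\<omega>. ennreal (decay j x (fst \<omega>) (t - max 0 (snd \<omega>)) * BB \<omega>) * indicator {\<omega>. t0 - \<eta> < max 0 (snd \<omega>)} \<omega>"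
    have r0: "0 \<le> 2 * \<eta>" using \<eta> by simp
    have inner: "(\<integral>\<^sup>+y. ?f (y, s) \<partial>lborel) \<le> ennreal (S * mass) * (ennreal ((t - s) powr (- ?\<alpha>)) * indicator {t - 2 * \<eta><..<t} s)" for s
    proof (cases "s \<in> {t - 2 * \<eta><..<t} \<and> t0 - \<eta> < s")
      case True
      then have s: "0 < s" "s < t" "t0 / 2 \<le> s" using \<eta> t0 by auto
      let ?k = "kern L ((t - s) powr (1 / d)) x"
      have "(\<integral>\<^sup>+y. ?f (y, s) \<partial>lborel) \<le> (\<integral>\<^sup>+y. ennreal (S * (t - s) powr (- ?\<alpha>)) * ennreal (?k y) \<partial>lborel)"
      proof (intro nn_integral_mono)
        fix y
        have "?f (y, s) \<le> ennreal (decay j x y (t - s) * BB (y, s))"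
          using s by (auto simp: indicator_def max_def)
        also have "\<dots> \<le> ennreal (decay j x y (t - s) * S)"
          unfolding S_def by (intro ennreal_leI mult_left_mono BB_le t0 s) auto
        also have "decay j x y (t - s) * S = (S * (t - s) powr (- ?\<alpha>)) * ?k y"
          using s by (simp add: decay_def)
        also have "ennreal \<dots> = ennreal (S * (t - s) powr (- ?\<alpha>)) * ennreal (?k y)"
          using S0 by (intro ennreal_mult) auto
        finally show "?f (y, s) \<le> \<dots>" .
      qed
      also have "\<dots> = ennreal (S * (t - s) powr (- ?\<alpha>)) * (\<integral>\<^sup>+y. ennreal (?k y) \<partial>lborel)"
        by (rule nn_integral_cmult) measurable
      also have "\<dots> \<le> ennreal (S * (t - s) powr (- ?\<alpha>)) * ennreal mass"
        unfolding mass_def using s L_pos by (intro mult_left_mono nn_integral_kern) auto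
      also have "\<dots> = ennreal (S * mass) * ennreal ((t - s) powr (- ?\<alpha>))"
        using S0 mass_pos by (simp add: mult_ac flip: ennreal_mult)
      finally show ?thesis using True by simp
    next
      case False
      have "?f (y, s) = 0" for y
      proof (cases "t0 - \<eta> < max 0 s \<and> s < t")
        case True
        then have "t0 - \<eta> < s" using \<eta> t0 by (auto simp: max_def split: if_splits)
        moreover have "t - 2 * \<eta> < s" using calculation t by linarith
        ultimately show ?thesis using False True by auto
      next
        case False
        then show ?thesis by (auto simp: decay_def)
      qed
      then have "(\<integral>\<^sup>+y. ?f (y, s) \<partial>lborel) = 0"
        by (simp only: nn_integral_const mult_zero_left)
      then show ?thesis by simp
    qed
    have meas: "?f \<in> borel_measurable borel"
      by (intro borel_measurable_times_ennreal decay_BB_measurable borel_measurable_indicator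
          borel_open open_Collect_less continuous_intros)
    have "(\<integral>\<^sup>+\<omega>. ?f \<omega> \<partial>lborel) = (\<integral>\<^sup>+s. (\<integral>\<^sup>+y. ?f (y, s) \<partial>lborel) \<partial>lborel)"
      by (rule nn_integral_space_time[OF meas])
    also have "\<dots> \<le> (\<integral>\<^sup>+s. ennreal (S * mass) * (ennreal ((t - s) powr (- ?\<alpha>)) * indicator {t - 2 * \<eta><..<t} s) \<partial>lborel)"
      by (intro nn_integral_mono inner)
    also have "\<dots> = ennreal (S * mass) * (\<integral>\<^sup>+s. ennreal ((t - s) powr (- ?\<alpha>)) * indicator {t - 2 * \<eta><..<t} s \<partial>lborel)"
      by (rule nn_integral_cmult) measurable
    also have "\<dots> = ennreal (S * mass) * ennreal ((2 * \<eta>) powr (1 - ?\<alpha>) / (1 - ?\<alpha>))"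
      using nn_integral_powr_to[OF \<alpha>(2) r0, of t] by simp
    also have "\<dots> = ennreal (Z * (2 * \<eta>) powr (1 - ?\<alpha>))"
      using S0 mass_pos \<alpha> by (simp add: Z_def flip: ennreal_mult)
    also have "\<dots> \<le> ennreal \<epsilon>"
    proof (rule ennreal_leI)
      have "(2 * \<eta>) powr (1 - ?\<alpha>) \<le> \<mu> powr (1 - ?\<alpha>)"
        using \<eta> \<alpha> by (intro powr_mono2) auto
      also have "\<dots> = \<epsilon> / (Z + 1)"
      proof -
        have "1 - ?\<alpha> \<noteq> 0" using \<alpha> by linarith
        then have "1 / (1 - ?\<alpha>) * (1 - ?\<alpha>) = 1" by (simp only: nonzero_eq_divide_eq[symmetric] divide_self_if times_divide_eq_left mult_1) simp
        then show ?thesis using \<epsilon> Z0 by (simp only: \<mu>_def powr_powr) simp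
      qed
      finally have "Z * (2 * \<eta>) powr (1 - ?\<alpha>) \<le> Z * (\<epsilon> / (Z + 1))" using Z0 by (intro mult_left_mono)
      also have "\<dots> \<le> \<epsilon>" using Z0 \<epsilon> by (simp add: field_simps)
      finally show "Z * (2 * \<eta>) powr (1 - ?\<alpha>) \<le> \<epsilon>" .
    qed
    finally show "(\<integral>\<^sup>+\<omega>. ?f \<omega> \<partial>lborel) \<le> ennreal \<epsilon>" .
  qed
qed

text \<open>The truncation by \<open>max 0\<close> only makes emission times nonnegative: \<open>BB\<close> vanishes for negative times.\<close>

sublocale non: jet_source m d L CG T g "lborel :: ('a \<times> real) measure" "\<lambda>\<omega>. max 0 (snd \<omega>)" fst BB
  "\<lambda>j t. t powr (- real j / d) * (\<kappa> * Cn * e powr (1 - 1 / q) * (e powr (1 / q) * t powr (- \<nu>)))"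
proof unfold_locales
  show "(\<lambda>\<omega>. max 0 (snd \<omega>)) \<in> borel_measurable (lborel :: ('a \<times> real) measure)"
    "fst \<in> borel_measurable (lborel :: ('a \<times> real) measure)" "BB \<in> borel_measurable lborel"
    by (auto intro!: borel_measurable_continuous_onI continuous_intros)
  fix j x t assume j: "j \<le> m" and t: "0 < t" "ereal t < T"
  have "(\<integral>\<^sup>+\<omega>. ennreal (decay j x (fst \<omega>) (t - max 0 (snd \<omega>)) * BB \<omega>) \<partial>lborel)
    \<le> ennreal (t powr (- real j / d) * (\<kappa> * Cn * e powr (1 - 1 / q) * \<theta> t x powr (1 / q)))"
    by (rule nonlinear_total[OF j t])
  also have "\<dots> \<le> ennreal (t powr (- real j / d) * (\<kappa> * Cn * e powr (1 - 1 / q) * (e powr (1 / q) * t powr (- \<nu>))))"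
    using \<theta>_root_le[OF t, of x] \<kappa>_nonneg Cn_nonneg by (intro ennreal_leI mult_left_mono) auto
  finally show "(\<integral>\<^sup>+\<omega>. ennreal (decay j x (fst \<omega>) (t - max 0 (snd \<omega>)) * BB \<omega>) \<partial>lborel) \<le> \<dots>" .
qed (use nonlinear_tail in auto)

text \<open>Here \<open>f\<close> stands for \<open>F\<close> composed with a jet.\<close>

definition duhamel :: "('a \<times> real \<Rightarrow> real) \<Rightarrow> 'a list \<Rightarrow> 'a \<Rightarrow> real \<Rightarrow> real" where
  "duhamel f w x t = lin.pot w \<phi> x t + a0 * non.pot w f x t"

definition jet_bounded :: "('a \<Rightarrow> real \<Rightarrow> 'a list \<Rightarrow> real) \<Rightarrow> bool" where
  "jet_bounded U \<longleftrightarrow> (\<forall>x t w. 0 < t \<longrightarrow> ereal t < T \<longrightarrow> w \<in> words_upto m \<longrightarrow>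
     \<bar>U x t w\<bar> \<le> M0 * (t powr (- real (length w) / d) * \<theta> t x powr (1 / q)))"

definition jet_continuous :: "('a \<Rightarrow> real \<Rightarrow> 'a list \<Rightarrow> real) \<Rightarrow> bool" where
  "jet_continuous U \<longleftrightarrow> (\<forall>w\<in>words_upto m. continuous_on (UNIV \<times> times) (\<lambda>(x, t). U x t w))"

lemma \<phi>_dominated: "lin.dominated \<phi>"
  by (simp add: lin.dominated_def)

text \<open>Any forcing below the majorant \<open>BB\<close> gives back the ansatz with the same
  \<open>M0\<close>, whatever jet it comes from: the linear part takes
  \<open>CG * (mass + 1)\<close> and \<open>small\<close> confines the nonlinear part to the
  remaining 1.\<close>

lemma duhamel_bound:
  assumes f: "non.dominated f" and w: "w \<in> words_upto m" and t: "0 < t" "ereal t < T"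
  shows "\<bar>duhamel f w x t\<bar> \<le> M0 * (t powr (- real (length w) / d) * \<theta> t x powr (1 / q))"
proof -
  let ?b = "t powr (- real (length w) / d) * \<theta> t x powr (1 / q)"
  have b0: "0 \<le> ?b" by simp
  have lw: "length w \<le> m" using w by (simp add: words_upto_def)
  have "ennreal \<bar>lin.pot w \<phi> x t\<bar> \<le> ennreal CG * ennreal (t powr (- real (length w) / d) * ((mass + 1) * \<theta> t x powr (1 / q)))"
    by (rule order_trans[OF lin.pot_bound[OF w \<phi>_dominated]]) (use linear_total[OF t] in \<open>simp add: mult_left_mono\<close>)
  also have "\<dots> = ennreal (CG * (mass + 1) * ?b)"
    using CG by (subst ennreal_mult'[symmetric]) (auto simp: mult_ac)
  finally have 1: "\<bar>lin.pot w \<phi> x t\<bar> \<le> CG * (mass + 1) * ?b"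
    using CG mass_pos by simp
  have "ennreal \<bar>non.pot w f x t\<bar> \<le> ennreal CG * ennreal (t powr (- real (length w) / d) * (\<kappa> * Cn * e powr (1 - 1 / q) * \<theta> t x powr (1 / q)))"
    by (rule order_trans[OF non.pot_bound[OF w f]]) (use nonlinear_total[OF lw t] in \<open>simp add: mult_left_mono\<close>)
  also have "\<dots> = ennreal (CG * (\<kappa> * Cn * e powr (1 - 1 / q)) * ?b)"
    using CG by (subst ennreal_mult'[symmetric]) (auto simp: mult_ac)
  finally have 2: "\<bar>non.pot w f x t\<bar> \<le> CG * (\<kappa> * Cn * e powr (1 - 1 / q)) * ?b"
    using CG \<kappa>_nonneg Cn_nonneg by simp
  have "\<kappa> * e powr (1 - 1 / q) = M1 powr p_sum J p * e powr ((p_sum J p - 1) / q)"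
  proof -
    have "p_sum J p / q - 1 + (1 - 1 / q) = (p_sum J p - 1) / q" by (simp add: diff_divide_distrib)
    then show ?thesis unfolding \<kappa>_def by (simp only: mult.assoc powr_add[symmetric])
  qed
  note \<kappa>_e = this
  have "\<bar>a0\<bar> * (CG * (\<kappa> * Cn * e powr (1 - 1 / q))) = \<bar>a0\<bar> * CG * Cn * (\<kappa> * e powr (1 - 1 / q))"
    by (simp only: mult_ac)
  also have "\<dots> = \<bar>a0\<bar> * CG * (M1 powr p_sum J p * Cn * e powr ((p_sum J p - 1) / q))"
    unfolding \<kappa>_e by (simp only: mult_ac)
  also have "\<dots> \<le> 1" by (rule small)
  finally have s: "\<bar>a0\<bar> * (CG * (\<kappa> * Cn * e powr (1 - 1 / q))) \<le> 1" .
  have "\<bar>a0 * non.pot w f x t\<bar> \<le> \<bar>a0\<bar> * (CG * (\<kappa> * Cn * e powr (1 - 1 / q)) * ?b)"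
    unfolding abs_mult by (intro mult_left_mono 2) auto
  also have "\<dots> = (\<bar>a0\<bar> * (CG * (\<kappa> * Cn * e powr (1 - 1 / q)))) * ?b" by (simp only: mult.assoc)
  also have "\<dots> \<le> 1 * ?b" by (intro mult_right_mono s b0)
  finally have 3: "\<bar>a0 * non.pot w f x t\<bar> \<le> 1 * ?b" .
  have "\<bar>duhamel f w x t\<bar> \<le> CG * (mass + 1) * ?b + 1 * ?b"
    unfolding duhamel_def using 1 3 by linarith
  also have "\<dots> = M0 * ?b" unfolding M0_def by (simp only: distrib_right)
  finally show ?thesis .
qed

lemma duhamel_continuous:
  assumes "non.dominated f" "w \<in> words_upto m"
  shows "continuous_on (UNIV \<times> times) (\<lambda>(x, t). duhamel f w x t)"
  using lin.continuous_on_pot[OF assms(2) \<phi>_dominated] non.continuous_on_pot[OF assms(2,1)]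
  unfolding duhamel_def case_prod_unfold by (intro continuous_intros)

lemma duhamel_equicontinuous:
  assumes w: "w \<in> words_upto m" and t0: "0 < t0" "ereal t0 < T" and \<epsilon>: "0 < \<epsilon>"
  shows "\<exists>\<delta>>0. \<forall>x t f. non.dominated f \<longrightarrow> dist x x0 < \<delta> \<longrightarrow> \<bar>t - t0\<bar> < \<delta> \<longrightarrow> 0 < t \<and> ereal t < T \<longrightarrow>
     \<bar>duhamel f w x t - duhamel f w x0 t0\<bar> \<le> \<epsilon>"
proof -
  define e' where "e' = \<epsilon> / (1 + \<bar>a0\<bar>)"
  have e': "0 < e'" using \<epsilon> by (simp add: e'_def add_pos_nonneg)
  obtain \<delta>1 where \<delta>1: "0 < \<delta>1" and le1: "\<And>x t \<psi>. lin.dominated \<psi> \<Longrightarrow> dist x x0 < \<delta>1 \<Longrightarrow> \<bar>t - t0\<bar> < \<delta>1 \<Longrightarrow>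
      0 < t \<and> ereal t < T \<Longrightarrow> \<bar>lin.pot w \<psi> x t - lin.pot w \<psi> x0 t0\<bar> \<le> e'"
    using lin.pot_equicontinuous[OF w t0 e', of x0] by blast
  obtain \<delta>2 where \<delta>2: "0 < \<delta>2" and le2: "\<And>x t \<psi>. non.dominated \<psi> \<Longrightarrow> dist x x0 < \<delta>2 \<Longrightarrow> \<bar>t - t0\<bar> < \<delta>2 \<Longrightarrow>
      0 < t \<and> ereal t < T \<Longrightarrow> \<bar>non.pot w \<psi> x t - non.pot w \<psi> x0 t0\<bar> \<le> e'"
    using non.pot_equicontinuous[OF w t0 e', of x0] by blast
  show ?thesis
  proof (intro exI[of _ "min \<delta>1 \<delta>2"] conjI allI impI)
    show "0 < min \<delta>1 \<delta>2" using \<delta>1 \<delta>2 by simp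
    fix x t f assume f: "non.dominated f" and h: "dist x x0 < min \<delta>1 \<delta>2" "\<bar>t - t0\<bar> < min \<delta>1 \<delta>2" "0 < t \<and> ereal t < T"
    have 1: "\<bar>lin.pot w \<phi> x t - lin.pot w \<phi> x0 t0\<bar> \<le> e'" using h by (intro le1 \<phi>_dominated) auto
    have 2: "\<bar>non.pot w f x t - non.pot w f x0 t0\<bar> \<le> e'" using h by (intro le2 f) auto
    have "duhamel f w x t - duhamel f w x0 t0
      = (lin.pot w \<phi> x t - lin.pot w \<phi> x0 t0) + a0 * (non.pot w f x t - non.pot w f x0 t0)"
      by (simp add: duhamel_def algebra_simps)
    also have "\<bar>\<dots>\<bar> \<le> e' + \<bar>a0\<bar> * e'"
      by (intro order_trans[OF abs_triangle_ineq] add_mono 1) (auto simp: abs_mult 2 mult_left_mono)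
    also have "\<dots> = (1 + \<bar>a0\<bar>) * e'" by (simp only: distrib_right mult_1)
    also have "\<dots> = \<epsilon>" unfolding e'_def by simp
    finally show "\<bar>duhamel f w x t - duhamel f w x0 t0\<bar> \<le> \<epsilon>" .
  qed
qed

lemma duhamel_has_partial_derivative:
  assumes bw: "b # w \<in> words_upto m" and f: "non.dominated f" and t: "0 < t" "ereal t < T"
  shows "((\<lambda>h. duhamel f w (x + h *\<^sub>R b) t) has_real_derivative duhamel f (b # w) x t) (at 0)"
  unfolding duhamel_def
  by (intro DERIV_add DERIV_cmult lin.pot_has_partial_derivative[OF bw \<phi>_dominated t]
      non.pot_has_partial_derivative[OF bw f t])

end

section \<open>Tonelli approximation\<close>

lemma tendsto_fun_componentwise:
  fixes f :: "'c \<Rightarrow> 'i \<Rightarrow> 'b::topological_space"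
  assumes "\<And>i. ((\<lambda>c. f c i) \<longlongrightarrow> l i) Fl"
  shows "(f \<longlongrightarrow> l) Fl"
proof -
  have "limitin (product_topology (\<lambda>i. euclidean) UNIV) f l Fl"
    using assms by (simp add: limitin_componentwise)
  then show ?thesis by (simp add: euclidean_product_topology)
qed

context jet_problem
begin

text \<open>Only the jet is delayed. The cutoff at \<open>2 * \<delta>\<close> ensures
  \<open>s - \<delta> \<ge> s/2\<close>, so that bounds at the earlier time transfer to
  \<open>s\<close> with constants independent of \<delta>. For \<open>\<delta> = 0\<close> the
  original nonlinearity on \<open>0 < s < T\<close> is recovered.\<close>

definition delayed :: "real \<Rightarrow> ('a \<Rightarrow> real \<Rightarrow> 'a list \<Rightarrow> real) \<Rightarrow> 'a \<times> real \<Rightarrow> real" where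
  "delayed \<delta> U \<omega> = (if 2 * \<delta> < snd \<omega> \<and> ereal (snd \<omega>) < T
     then F (fst \<omega>) (snd \<omega>) (U (fst \<omega>) (snd \<omega> - \<delta>)) else 0)"

definition admissible :: "('a \<Rightarrow> real \<Rightarrow> 'a list \<Rightarrow> real) \<Rightarrow> bool" where
  "admissible U \<longleftrightarrow> (\<forall>x t. U x t \<in> jet_space m) \<and> jet_bounded U \<and> jet_continuous U"

definition duhamel_jet :: "('a \<times> real \<Rightarrow> real) \<Rightarrow> 'a \<Rightarrow> real \<Rightarrow> 'a list \<Rightarrow> real" where
  "duhamel_jet f x t = (\<lambda>w\<in>words_upto m. duhamel f w x t)"

lemma admissible_duhamel_jet: "non.dominated f \<Longrightarrow> admissible (duhamel_jet f)"
  unfolding admissible_def jet_bounded_def jet_continuous_def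
  using duhamel_bound duhamel_continuous
  by (auto simp: duhamel_jet_def jet_space_def)

lemma F_continuous: "continuous_on (UNIV \<times> {0..} \<times> jet_space m) (\<lambda>(x, t, z). F x t z)"
  using struct_F by (simp add: structure_condition_def)

text \<open>The factors in \<open>M1\<close> beyond those of the undelayed estimate are exactly what
  the passage from \<open>s - \<delta>\<close> to \<open>s\<close> costs. Hence one majorant serves
  all delays, and measurability comes from continuity on the open set where the cutoff is
  inactive.\<close>

lemma delayed_dominated:
  assumes \<delta>: "0 \<le> \<delta>" and U: "admissible U"
  shows "non.dominated (delayed \<delta> U)"
  unfolding non.dominated_def
proof (intro conjI allI)
  let ?S = "{\<omega> :: 'a \<times> real. 2 * \<delta> < snd \<omega> \<and> ereal (snd \<omega>) < T}"
  have oS: "open ?S"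
    by (intro open_Collect_conj open_Collect_less continuous_intros)
  have sub: "0 < snd \<omega> - \<delta> \<and> ereal (snd \<omega> - \<delta>) < T" if "\<omega> \<in> ?S" for \<omega>
    using that \<delta> times_mono[of "snd \<omega> - \<delta>" "snd \<omega>"] by auto
  have cU: "continuous_on ?S (\<lambda>\<omega>. U (fst \<omega>) (snd \<omega> - \<delta>))"
  proof (rule continuous_on_coordinatewise_then_product)
    fix w
    show "continuous_on ?S (\<lambda>\<omega>. U (fst \<omega>) (snd \<omega> - \<delta>) w)"
    proof (cases "w \<in> words_upto m")
      case True
      then have "continuous_on (UNIV \<times> times) (\<lambda>(x, t). U x t w)"
        using U by (simp add: admissible_def jet_continuous_def)
      then have "continuous_on ?S (\<lambda>\<omega>. (\<lambda>(x, t). U x t w) (fst \<omega>, snd \<omega> - \<delta>))"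
        by (rule continuous_on_compose2) (use sub in \<open>auto intro!: continuous_intros\<close>)
      then show ?thesis by simp
    next
      case False
      \<comment> \<open>Outside \<open>words_upto m\<close> all elements of \<open>jet_space\<close>
        take this default value, so the coordinate is constant.\<close>
      then have "U x t w = undefined" for x t
        using U by (auto simp: admissible_def jet_space_def dest: PiE_arb)
      then show ?thesis by simp
    qed
  qed
  have "continuous_on ?S (\<lambda>\<omega>. (\<lambda>(x, t, z). F x t z) (fst \<omega>, snd \<omega>, U (fst \<omega>) (snd \<omega> - \<delta>)))"
    using U \<delta> by (intro continuous_on_compose2[OF F_continuous] continuous_intros cU) (auto simp: admissible_def)
  then have "(\<lambda>\<omega>. indicator ?S \<omega> *\<^sub>R F (fst \<omega>) (snd \<omega>) (U (fst \<omega>) (snd \<omega> - \<delta>))) \<in> borel_measurable borel"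
    using oS by (intro borel_measurable_continuous_on_indicator) (auto intro: borel_open)
  moreover have "(\<lambda>\<omega>. indicator ?S \<omega> *\<^sub>R F (fst \<omega>) (snd \<omega>) (U (fst \<omega>) (snd \<omega> - \<delta>))) = delayed \<delta> U"
    by (auto simp: delayed_def indicator_def)
  ultimately show "delayed \<delta> U \<in> borel_measurable lborel" by simp
  fix \<omega> :: "'a \<times> real"
  show "\<bar>delayed \<delta> U \<omega>\<bar> \<le> BB \<omega>"
  proof (cases "\<omega> \<in> ?S")
    case True
    obtain y s where \<omega>: "\<omega> = (y, s)" by (cases \<omega>)
    have s: "2 * \<delta> < s" "0 < s" "ereal s < T" using True \<delta> by (auto simp: \<omega>)
    have s': "0 < s - \<delta>" "ereal (s - \<delta>) < T" "s / 2 \<le> s - \<delta>" using sub[OF True] s by (auto simp: \<omega>)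
    have "\<bar>F y s (U y (s - \<delta>))\<bar> \<le> M1 powr p_sum J p * e powr (p_sum J p / q - 1) * (s powr (\<beta> - 1) * \<theta> s y)"
    proof (rule F_bound[OF s(2) \<theta>_nonneg \<theta>_le[OF s(2,3)] e_pos])
      show "U y (s - \<delta>) \<in> jet_space m" using U by (simp add: admissible_def)
      fix w :: "'a list" assume w: "w \<in> words_upto m"
      have lw: "length w \<le> m" using w by (simp add: words_upto_def)
      have "\<bar>U y (s - \<delta>) w\<bar> \<le> M0 * ((s - \<delta>) powr (- real (length w) / d) * \<theta> (s - \<delta>) y powr (1 / q))"
        using U w s' by (simp add: admissible_def jet_bounded_def)
      also have "\<dots> \<le> M0 * ((2 powr (real m / d) * s powr (- real (length w) / d)) * (cT powr (1 / q) * \<theta> s y powr (1 / q)))"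
      proof (intro mult_left_mono mult_mono)
        have "(s - \<delta>) powr (- real (length w) / d) \<le> (s / 2) powr (- real (length w) / d)"
          using s s' d_pos by (intro powr_mono2') auto
        also have "\<dots> = 2 powr (real (length w) / d) * s powr (- real (length w) / d)"
          using s by (simp add: powr_divide powr_minus field_simps)
        also have "\<dots> \<le> 2 powr (real m / d) * s powr (- real (length w) / d)"
          using lw d_pos by (intro mult_right_mono powr_mono) (auto simp: divide_right_mono)
        finally show "(s - \<delta>) powr (- real (length w) / d) \<le> 2 powr (real m / d) * s powr (- real (length w) / d)" .
        have "\<theta> (s - \<delta>) y powr (1 / q) \<le> (cT * \<theta> s y) powr (1 / q)"
          using \<theta>_compare[OF s(2,3) s'(3)] \<delta> q by (intro powr_mono2) auto
        also have "\<dots> = cT powr (1 / q) * \<theta> s y powr (1 / q)"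
          using cT_ge_1 by (simp add: powr_mult)
        finally show "\<theta> (s - \<delta>) y powr (1 / q) \<le> cT powr (1 / q) * \<theta> s y powr (1 / q)" .
      qed (use M0_pos in auto)
      also have "\<dots> = 2 powr (real m / d) * cT powr (1 / q) * M0 * (s powr (- real (length w) / d) * \<theta> s y powr (1 / q))"
        by (simp only: mult_ac)
      finally show "\<bar>U y (s - \<delta>) w\<bar> \<le> \<dots>" .
    qed
    then show ?thesis using s by (simp add: \<omega> delayed_def BB_def \<kappa>_def)
  next
    case False
    then have "delayed \<delta> U \<omega> = 0" by (auto simp: delayed_def)
    then show ?thesis by simp
  qed
qed

text \<open>The recursion counts iterations instead of gluing time slabs: every iterate is defined
  at all times, but only an initial stretch of it is final.\<close>

primrec tonelli :: "real \<Rightarrow> nat \<Rightarrow> 'a \<Rightarrow> real \<Rightarrow> 'a list \<Rightarrow> real" where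
  "tonelli \<delta> 0 = (\<lambda>x t. \<lambda>w\<in>words_upto m. 0)"
| "tonelli \<delta> (Suc k) = duhamel_jet (delayed \<delta> (tonelli \<delta> k))"

lemma admissible_tonelli: "0 \<le> \<delta> \<Longrightarrow> admissible (tonelli \<delta> k)"
proof (induction k)
  case 0
  have "continuous_on (UNIV \<times> times) (\<lambda>(x, t). tonelli \<delta> 0 x t w)" if "w \<in> words_upto m" for w
    using that by (simp add: case_prod_unfold)
  then show ?case using M0_pos by (auto simp: admissible_def jet_bounded_def jet_continuous_def jet_space_def)
next
  case (Suc k)
  then show ?case by (simp add: admissible_duhamel_jet delayed_dominated)
qed

text \<open>Sources at times \<open>s \<ge> t\<close> meet a vanishing kernel. Nonpositive times
  need their own hypothesis because the truncation moves them to emission time 0, where the kernel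
  does not vanish.\<close>

lemma non_pot_cong:
  assumes "\<And>y s. 0 < s \<Longrightarrow> s < t \<Longrightarrow> f (y, s) = f' (y, s)" "\<And>y s. s \<le> 0 \<Longrightarrow> f (y, s) = f' (y, s)"
  shows "non.pot w f x t = non.pot w f' x t"
  unfolding non.pot_def
proof (intro Bochner_Integration.integral_cong refl)
  fix \<omega> :: "'a \<times> real"
  obtain y s where \<omega>: "\<omega> = (y, s)" by (cases \<omega>)
  show "gz w x (fst \<omega>) (t - max 0 (snd \<omega>)) * f \<omega> = gz w x (fst \<omega>) (t - max 0 (snd \<omega>)) * f' \<omega>"
  proof (cases "s < t")
    case True
    then show ?thesis using assms[of s y] by (cases "0 < s") (auto simp: \<omega>)
  next
    case False
    then show ?thesis by (auto simp: \<omega> gz_def)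
  qed
qed

text \<open>Up to time \<open>(k + 1) * \<delta>\<close> the integral sees the previous iterate only
  at times \<open>s - \<delta> \<le> k * \<delta>\<close>, where it is already final. Thus each
  iteration settles one more step of length \<delta>, and no contraction is involved.\<close>

lemma tonelli_stable:
  assumes \<delta>: "0 < \<delta>" and t: "0 < t" "ereal t < T" "t \<le> real k * \<delta>"
  shows "tonelli \<delta> (Suc k) x t = tonelli \<delta> k x t"
  using t
proof (induction k arbitrary: x t)
  case 0
  then show ?case by simp
next
  case (Suc k)
  have "delayed \<delta> (tonelli \<delta> (Suc k)) (y, s) = delayed \<delta> (tonelli \<delta> k) (y, s)" if "0 < s" "s < t" for y s
  proof (cases "2 * \<delta> < s")
    case True
    have "s - \<delta> \<le> real k * \<delta>" using that Suc.prems(3) by (simp add: distrib_right)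
    then have "tonelli \<delta> (Suc k) y (s - \<delta>) = tonelli \<delta> k y (s - \<delta>)"
      using True that \<delta> Suc.prems times_mono[of "s - \<delta>" t] by (intro Suc.IH) auto
    then show ?thesis by (simp only: delayed_def fst_conv snd_conv)
  next
    case False
    then show ?thesis by (simp only: delayed_def snd_conv if_False simp_thms)
  qed
  moreover have "delayed \<delta> (tonelli \<delta> (Suc k)) (y, s) = delayed \<delta> (tonelli \<delta> k) (y, s)" if "s \<le> 0" for y s
    using that \<delta> by (simp add: delayed_def)
  ultimately have "non.pot w (delayed \<delta> (tonelli \<delta> (Suc k))) x t = non.pot w (delayed \<delta> (tonelli \<delta> k)) x t" for w
    by (rule non_pot_cong)
  then have "duhamel_jet (delayed \<delta> (tonelli \<delta> (Suc k))) x t = duhamel_jet (delayed \<delta> (tonelli \<delta> k)) x t"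
    unfolding duhamel_jet_def duhamel_def by simp
  then show ?case by (simp only: tonelli.simps(2))
qed

section \<open>Compactness of the approximations and passage to the limit\<close>

lemma duhamel_uniform_bound:
  assumes f: "non.dominated f" and w: "w \<in> words_upto m" and t: "0 < t" "ereal t < T"
  shows "\<bar>duhamel f w x t\<bar> \<le> M0 * e powr (1 / q) * t powr (- \<nu> - real (length w) / d)"
proof -
  have "\<bar>duhamel f w x t\<bar> \<le> M0 * (t powr (- real (length w) / d) * \<theta> t x powr (1 / q))"
    by (rule duhamel_bound[OF f w t])
  also have "\<dots> \<le> M0 * (t powr (- real (length w) / d) * (e powr (1 / q) * t powr (- \<nu>)))"
    using M0_pos by (intro mult_left_mono \<theta>_root_le t) auto
  also have "\<dots> = M0 * e powr (1 / q) * (t powr (- \<nu>) * t powr (- real (length w) / d))"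
    by (simp only: mult_ac)
  also have "t powr (- \<nu>) * t powr (- real (length w) / d) = t powr (- \<nu> - real (length w) / d)"
    by (simp flip: powr_add)
  finally show ?thesis .
qed

text \<open>The Arzela-Ascoli argument in pointwise form: a diagonal subsequence converges on a
  countable dense set, and the common modulus spreads convergence to every point. The limit inherits
  the bound and the modulus. Locally uniform convergence is not asked for, as dominated convergence
  follows.\<close>

lemma duhamel_subsequence:
  fixes f :: "nat \<Rightarrow> 'a \<times> real \<Rightarrow> real"
  assumes f: "\<And>n. non.dominated (f n)"
  obtains r U where "strict_mono (r :: nat \<Rightarrow> nat)" "admissible U"
    "\<And>w x t. w \<in> words_upto m \<Longrightarrow> 0 < t \<Longrightarrow> ereal t < T \<Longrightarrow> (\<lambda>n. duhamel (f (r n)) w x t) \<longlonglongrightarrow> U x t w"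
proof -
  obtain D :: "('a \<times> real) set" where D: "countable D" "\<And>X. open X \<Longrightarrow> X \<noteq> {} \<Longrightarrow> \<exists>d\<in>D. d \<in> X"
    using countable_dense_setE by blast
  define S where "S = (D \<inter> UNIV \<times> times) \<times> (words_upto m :: 'a list set)"
  have "countable (D \<inter> UNIV \<times> times)" using D(1) by (rule countable_subset[rotated]) auto
  then have S: "countable S" unfolding S_def
    by (intro countable_SIGMA countable_finite[OF finite_words_upto])
  \<comment> \<open>The weight removes the blow-up at time 0, so that one constant bounds all
    values, as the diagonal extraction requires.\<close>
  define h where "h n z = (case z of ((x, t), w) \<Rightarrow> duhamel (f n) w x t * t powr (\<nu> + real (length w) / d))" for n z
  have hb: "norm (h n z) \<le> M0 * e powr (1 / q)" if z: "z \<in> S" for n z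
  proof -
    obtain x t w where zz: "z = ((x, t), w)" by (metis surj_pair)
    have w: "w \<in> words_upto m" and t: "0 < t" "ereal t < T" using z by (auto simp: zz S_def)
    have "norm (h n z) = \<bar>duhamel (f n) w x t\<bar> * t powr (\<nu> + real (length w) / d)"
      by (simp add: h_def zz abs_mult)
    also have "\<dots> \<le> (M0 * e powr (1 / q) * t powr (- \<nu> - real (length w) / d)) * t powr (\<nu> + real (length w) / d)"
      by (intro mult_right_mono duhamel_uniform_bound f w t) auto
    also have "\<dots> = M0 * e powr (1 / q)"
      using t by (simp add: mult.assoc flip: powr_add)
    finally show ?thesis .
  qed
  obtain r :: "nat \<Rightarrow> nat" where r: "strict_mono r" and conv: "\<And>z. z \<in> S \<Longrightarrow> \<exists>l. (\<lambda>n. h (r n) z) \<longlonglongrightarrow> l"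
    using function_convergent_subsequence[OF S, where f = h, OF hb] by blast
  have conv_D: "convergent (\<lambda>n. duhamel (f (r n)) w x t)"
    if w: "w \<in> words_upto m" and xt: "(x, t) \<in> D" "0 < t" "ereal t < T" for w x t
  proof -
    obtain l where "(\<lambda>n. h (r n) ((x, t), w)) \<longlonglongrightarrow> l" using conv[of "((x, t), w)"] w xt by (auto simp: S_def)
    then have "(\<lambda>n. h (r n) ((x, t), w) * t powr (- (\<nu> + real (length w) / d))) \<longlonglongrightarrow> l * t powr (- (\<nu> + real (length w) / d))"
      by (intro tendsto_intros)
    moreover have "h (r n) ((x, t), w) * t powr (- (\<nu> + real (length w) / d)) = duhamel (f (r n)) w x t" for n
    proof -
      have "t powr (\<nu> + real (length w) / d) * t powr (- (\<nu> + real (length w) / d)) = 1"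
        using xt by (simp flip: powr_add)
      then show ?thesis unfolding h_def by (simp only: case_prod_conv mult.assoc mult_1_right)
    qed
    ultimately show ?thesis by (auto simp: convergent_def)
  qed
  have conv_all: "convergent (\<lambda>n. duhamel (f (r n)) w x t)"
    if w: "w \<in> words_upto m" and t: "0 < t" "ereal t < T" for w x t
  proof (rule Cauchy_convergent, rule metric_CauchyI)
    fix \<epsilon> :: real assume \<epsilon>: "0 < \<epsilon>"
    obtain \<delta> where \<delta>: "0 < \<delta>" and eq: "\<And>x' t' f. non.dominated f \<Longrightarrow> dist x' x < \<delta> \<Longrightarrow> \<bar>t' - t\<bar> < \<delta> \<Longrightarrow>
        0 < t' \<and> ereal t' < T \<Longrightarrow> \<bar>duhamel f w x' t' - duhamel f w x t\<bar> \<le> \<epsilon> / 4"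
      using duhamel_equicontinuous[OF w t, of "\<epsilon> / 4" x] \<epsilon> by (metis zero_less_divide_iff zero_less_numeral)
    have oX: "open (ball (x, t) \<delta> \<inter> {z. 0 < snd z \<and> ereal (snd z) < T})"
      by (intro open_Int open_ball open_Collect_conj open_Collect_less continuous_intros)
    have "(x, t) \<in> ball (x, t) \<delta> \<inter> {z. 0 < snd z \<and> ereal (snd z) < T}" using \<delta> t by simp
    then obtain z where "z \<in> D" "z \<in> ball (x, t) \<delta> \<inter> {z. 0 < snd z \<and> ereal (snd z) < T}"
      using D(2)[OF oX] by blast
    then obtain x' t' where x't': "(x', t') \<in> D" "(x', t') \<in> ball (x, t) \<delta>" "0 < t'" "ereal t' < T"
      by (cases z) auto
    have near: "dist x' x < \<delta>" "\<bar>t' - t\<bar> < \<delta>"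
      using x't'(2) dist_fst_le[of "(x', t')" "(x, t)"] dist_snd_le[of "(x', t')" "(x, t)"]
      by (auto simp: dist_commute dist_real_def)
    have "Cauchy (\<lambda>n. duhamel (f (r n)) w x' t')"
      using conv_D[OF w x't'(1,3,4)] by (rule convergent_Cauchy)
    then obtain n0 where n0: "\<And>i k. n0 \<le> i \<Longrightarrow> n0 \<le> k \<Longrightarrow> dist (duhamel (f (r i)) w x' t') (duhamel (f (r k)) w x' t') < \<epsilon> / 4"
      using metric_CauchyD[of "\<lambda>n. duhamel (f (r n)) w x' t'" "\<epsilon> / 4"] \<epsilon> by auto
    show "\<exists>M. \<forall>i\<ge>M. \<forall>k\<ge>M. dist (duhamel (f (r i)) w x t) (duhamel (f (r k)) w x t) < \<epsilon>"
    proof (intro exI[of _ n0] allI impI)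
      fix i k assume ik: "n0 \<le> i" "n0 \<le> k"
      have 1: "\<bar>duhamel (f (r i)) w x' t' - duhamel (f (r i)) w x t\<bar> \<le> \<epsilon> / 4"
        "\<bar>duhamel (f (r k)) w x' t' - duhamel (f (r k)) w x t\<bar> \<le> \<epsilon> / 4"
        by (rule eq[OF f near]; use x't' in simp)+
      show "dist (duhamel (f (r i)) w x t) (duhamel (f (r k)) w x t) < \<epsilon>"
        using 1 n0[OF ik] \<epsilon> unfolding dist_real_def by linarith
    qed
  qed
  define U where "U x t = (\<lambda>w\<in>words_upto m. lim (\<lambda>n. duhamel (f (r n)) w x t))" for x t
  have lim: "(\<lambda>n. duhamel (f (r n)) w x t) \<longlonglongrightarrow> U x t w"
    if "w \<in> words_upto m" "0 < t" "ereal t < T" for w x t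
    using conv_all[OF that] that(1) by (simp add: U_def convergent_LIMSEQ_iff)
  have "jet_bounded U"
    unfolding jet_bounded_def
  proof (intro allI impI)
    fix x t and w :: "'a list" assume t: "0 < t" "ereal t < T" and w: "w \<in> words_upto m"
    show "\<bar>U x t w\<bar> \<le> M0 * (t powr (- real (length w) / d) * \<theta> t x powr (1 / q))"
      by (rule LIMSEQ_le_const2[OF tendsto_rabs[OF lim[OF w t]]]) (use duhamel_bound[OF f w t] in auto)
  qed
  moreover have "jet_continuous U"
    unfolding jet_continuous_def continuous_on_iff
  proof (intro ballI allI impI)
    fix w :: "'a list" and p :: "'a \<times> real" and \<epsilon> :: real
    assume w: "w \<in> words_upto m" and p: "p \<in> UNIV \<times> times" and \<epsilon>: "0 < \<epsilon>"
    obtain x0 t0 where p0: "p = (x0, t0)" "0 < t0" "ereal t0 < T" using p by auto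
    obtain \<delta> where \<delta>: "0 < \<delta>" and eq: "\<And>x t f. non.dominated f \<Longrightarrow> dist x x0 < \<delta> \<Longrightarrow> \<bar>t - t0\<bar> < \<delta> \<Longrightarrow>
        0 < t \<and> ereal t < T \<Longrightarrow> \<bar>duhamel f w x t - duhamel f w x0 t0\<bar> \<le> \<epsilon> / 2"
      using duhamel_equicontinuous[OF w p0(2,3), of "\<epsilon> / 2" x0] \<epsilon> by (metis half_gt_zero)
    show "\<exists>\<delta>>0. \<forall>z\<in>UNIV \<times> times. dist z p < \<delta> \<longrightarrow>
        dist (case z of (x, t) \<Rightarrow> U x t w) (case p of (x, t) \<Rightarrow> U x t w) < \<epsilon>"
    proof (intro exI[of _ \<delta>] conjI ballI impI \<delta>)
      fix z :: "'a \<times> real" assume z: "z \<in> UNIV \<times> times" "dist z p < \<delta>"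
      obtain x t where zz: "z = (x, t)" by (cases z)
      have t: "0 < t" "ereal t < T" using z by (auto simp: zz)
      have near: "dist x x0 < \<delta>" "\<bar>t - t0\<bar> < \<delta>"
        using z(2) dist_fst_le[of z p] dist_snd_le[of z p] by (auto simp: zz p0 dist_real_def)
      have "\<bar>U x t w - U x0 t0 w\<bar> \<le> \<epsilon> / 2"
        by (rule LIMSEQ_le_const2[OF tendsto_rabs[OF tendsto_diff[OF lim[OF w t] lim[OF w p0(2,3)]]]])
           (use eq[OF f near] t in auto)
      then show "dist (case z of (x, t) \<Rightarrow> U x t w) (case p of (x, t) \<Rightarrow> U x t w) < \<epsilon>"
        using \<epsilon> by (simp add: zz p0 dist_real_def)
    qed
  qed
  ultimately have "admissible U" by (simp add: admissible_def U_def jet_space_def)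
  then show ?thesis using r lim that by blast
qed

lemma duhamel_tendsto:
  assumes fn: "\<And>n. non.dominated (fn n)" and f: "non.dominated f"
    and lim: "\<And>\<omega>. (\<lambda>n. fn n \<omega>) \<longlonglongrightarrow> f \<omega>" and w: "w \<in> words_upto m" and t: "0 < t" "ereal t < T"
  shows "(\<lambda>n. duhamel (fn n) w x t) \<longlonglongrightarrow> duhamel f w x t"
proof -
  have fn_le: "\<bar>fn n \<omega>\<bar> \<le> BB \<omega>" for n \<omega>
    using fn[of n] unfolding non.dominated_def by blast
  have "(\<lambda>n. non.pot w (fn n) x t) \<longlonglongrightarrow> non.pot w f x t"
    unfolding non.pot_def
  proof (rule integral_dominated_convergence[where w = "\<lambda>\<omega>. CG * (decay (length w) x (fst \<omega>) (t - max 0 (snd \<omega>)) * BB \<omega>)"])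
    let ?k = "\<lambda>\<omega>. decay (length w) x (fst \<omega>) (t - max 0 (snd \<omega>)) * BB \<omega>"
    show "(\<lambda>\<omega>. gz w x (fst \<omega>) (t - max 0 (snd \<omega>)) * f \<omega>) \<in> borel_measurable lborel"
      using f by (intro non.integrand_measurable[OF w]) (simp add: non.dominated_def)
    show "(\<lambda>\<omega>. gz w x (fst \<omega>) (t - max 0 (snd \<omega>)) * fn n \<omega>) \<in> borel_measurable lborel" for n
      using fn[of n] by (intro non.integrand_measurable[OF w]) (simp add: non.dominated_def)
    have "integrable lborel ?k"
    proof (rule integrableI_nonneg)
      show "?k \<in> borel_measurable lborel"
        by (intro borel_measurable_times decay_measurable non.meas borel_measurable_diff borel_measurable_const)
      show "AE \<omega> in lborel. 0 \<le> ?k \<omega>" by simp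
      show "(\<integral>\<^sup>+\<omega>. ennreal (?k \<omega>) \<partial>lborel) < \<infinity>"
        using non.total[OF non.length_le[OF w] t, of x] by (rule order.strict_trans1) simp
    qed
    then show "integrable lborel (\<lambda>\<omega>. CG * ?k \<omega>)" by simp
    show "AE \<omega> in lborel. (\<lambda>n. gz w x (fst \<omega>) (t - max 0 (snd \<omega>)) * fn n \<omega>) \<longlonglongrightarrow> gz w x (fst \<omega>) (t - max 0 (snd \<omega>)) * f \<omega>"
      by (intro AE_I2 tendsto_intros lim)
    show "AE \<omega> in lborel. norm (gz w x (fst \<omega>) (t - max 0 (snd \<omega>)) * fn n \<omega>) \<le> CG * ?k \<omega>" for n
      unfolding real_norm_def
      by (intro AE_I2 non.integrand_bound[OF w] fn_le)
  qed
  then show ?thesis unfolding duhamel_def by (intro tendsto_intros)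
qed

text \<open>Each approximation solves its delayed equation up to a time tending to infinity. Along
  the subsequence the delay disappears, the forcings converge pointwise by continuity of
  \<open>F\<close>, and dominated convergence identifies the limit.\<close>

lemma duhamel_fixed_point:
  "\<exists>U. admissible U \<and> (\<forall>w\<in>words_upto m. \<forall>x t. 0 < t \<longrightarrow> ereal t < T \<longrightarrow> U x t w = duhamel (delayed 0 U) w x t)"
proof -
  define \<delta> where "\<delta> n = 1 / real (Suc n)" for n
  have \<delta>: "0 < \<delta> n" for n by (simp add: \<delta>_def)
  have \<delta>0: "\<delta> \<longlonglongrightarrow> 0" unfolding \<delta>_def by (rule LIMSEQ_Suc[OF lim_1_over_n])
  \<comment> \<open>With step length \<open>1 / (n + 1)\<close>, the number \<open>(n + 1)^2\<close>
    of iterations makes the values up to time \<open>n + 1\<close> final; this also covers infinite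
    \<open>T\<close>.\<close>
  define V where "V n = tonelli (\<delta> n) ((Suc n)\<^sup>2)" for n
  define f where "f n = delayed (\<delta> n) (V n)" for n
  have f: "non.dominated (f n)" for n
    unfolding f_def V_def using \<delta>[of n] by (intro delayed_dominated admissible_tonelli) auto
  have V: "V n x t = duhamel_jet (f n) x t" if "0 < t" "ereal t < T" "t \<le> real (Suc n)" for n x t
  proof -
    have sq: "real ((Suc n)\<^sup>2) = real (Suc n) * real (Suc n)"
      by (simp only: power2_eq_square of_nat_mult)
    have "real ((Suc n)\<^sup>2) * \<delta> n = real (Suc n)"
      unfolding sq \<delta>_def by (simp del: of_nat_Suc)
    then have "t \<le> real ((Suc n)\<^sup>2) * \<delta> n" using that(3) by (simp only:)
    from tonelli_stable[OF \<delta> that(1,2) this, of x] show ?thesis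
      unfolding f_def V_def by (simp only: tonelli.simps(2))
  qed
  obtain r U where r: "strict_mono (r :: nat \<Rightarrow> nat)" and U: "admissible U"
    and lim: "\<And>w x t. w \<in> words_upto m \<Longrightarrow> 0 < t \<Longrightarrow> ereal t < T \<Longrightarrow> (\<lambda>n. duhamel (f (r n)) w x t) \<longlonglongrightarrow> U x t w"
    using duhamel_subsequence[of f, OF f] by blast
  have fr: "filterlim r at_top sequentially" by (rule filterlim_subseq[OF r])
  have \<delta>r: "(\<lambda>n. \<delta> (r n)) \<longlonglongrightarrow> 0" using LIMSEQ_subseq_LIMSEQ[OF \<delta>0 r] by (simp add: o_def)
  have f_lim: "(\<lambda>n. f (r n) \<omega>) \<longlonglongrightarrow> delayed 0 U \<omega>" for \<omega>
  proof -
    obtain y s where \<omega>: "\<omega> = (y, s)" by (cases \<omega>)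
    show ?thesis
    proof (cases "0 < s \<and> ereal s < T")
      case False
      have "f (r n) \<omega> = 0" for n
        using False \<delta>[of "r n"] by (auto simp: f_def delayed_def \<omega>)
      moreover have "delayed 0 U \<omega> = 0" using False by (auto simp: delayed_def \<omega>)
      ultimately show ?thesis by simp
    next
      case True
      have ev1: "eventually (\<lambda>n. \<delta> (r n) < s / 2) sequentially"
        using True by (intro order_tendstoD(2)[OF \<delta>r]) auto
      obtain k0 :: nat where k0: "s \<le> real k0" using real_arch_simple by blast
      have ev2: "eventually (\<lambda>n. k0 \<le> r n) sequentially"
        using fr by (simp add: filterlim_at_top)
      have ev: "eventually (\<lambda>n. 2 * \<delta> (r n) < s \<and> V (r n) y (s - \<delta> (r n)) = duhamel_jet (f (r n)) y (s - \<delta> (r n))) sequentially"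
        using ev1 ev2
      proof eventually_elim
        case (elim n)
        have "s - \<delta> (r n) \<le> real (Suc (r n))" using elim k0 \<delta>[of "r n"] by (smt (verit) of_nat_Suc of_nat_mono)
        then show ?case using elim True \<delta>[of "r n"] times_mono[of "s - \<delta> (r n)" s] by (intro conjI V) auto
      qed
      \<comment> \<open>The jets are evaluated at the moving times
        \<open>s - \<delta> (r n)\<close>. The modulus uniform in the forcing reduces this to
        convergence at the fixed time \<open>s\<close>.\<close>
      have comp: "(\<lambda>n. duhamel_jet (f (r n)) y (s - \<delta> (r n)) w) \<longlonglongrightarrow> U y s w" for w
      proof (cases "w \<in> words_upto m")
        case w: True
        have "(\<lambda>n. duhamel (f (r n)) w y (s - \<delta> (r n)) - duhamel (f (r n)) w y s) \<longlonglongrightarrow> 0"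
        proof (rule LIMSEQ_I)
          fix \<epsilon> :: real assume \<epsilon>: "0 < \<epsilon>"
          obtain \<eta> where \<eta>: "0 < \<eta>" and eq: "\<And>x t f. non.dominated f \<Longrightarrow> dist x y < \<eta> \<Longrightarrow> \<bar>t - s\<bar> < \<eta> \<Longrightarrow>
            0 < t \<and> ereal t < T \<Longrightarrow> \<bar>duhamel f w x t - duhamel f w y s\<bar> \<le> \<epsilon> / 2"
          using duhamel_equicontinuous[OF w, of s "\<epsilon> / 2" y] \<epsilon> True by (metis half_gt_zero)
          have "eventually (\<lambda>n. \<delta> (r n) < \<eta>) sequentially"
          using \<eta> by (intro order_tendstoD(2)[OF \<delta>r])
          with ev1 have "eventually (\<lambda>n. norm (duhamel (f (r n)) w y (s - \<delta> (r n)) - duhamel (f (r n)) w y s - 0) < \<epsilon>) sequentially"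
          proof eventually_elim
          case (elim n)
          have "\<bar>duhamel (f (r n)) w y (s - \<delta> (r n)) - duhamel (f (r n)) w y s\<bar> \<le> \<epsilon> / 2"
            using elim \<eta> True \<delta>[of "r n"] times_mono[of "s - \<delta> (r n)" s] by (intro eq f) auto
          then show ?case using \<epsilon> by simp
          qed
          then show "\<exists>no. \<forall>n\<ge>no. norm (duhamel (f (r n)) w y (s - \<delta> (r n)) - duhamel (f (r n)) w y s - 0) < \<epsilon>"
          by (simp add: eventually_sequentially)
        qed
        from tendsto_add[OF this lim[OF w, of s y]] True
        show ?thesis using w by (simp add: duhamel_jet_def)
      next
        case w: False
        then have "U y s w = undefined"
          using U by (auto simp: admissible_def jet_space_def dest: PiE_arb)
        then show ?thesis using w by (simp add: duhamel_jet_def)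
      qed
      have "(\<lambda>n. duhamel_jet (f (r n)) y (s - \<delta> (r n))) \<longlonglongrightarrow> U y s"
        by (rule tendsto_fun_componentwise[OF comp])
      then have "(\<lambda>n. (y, s, duhamel_jet (f (r n)) y (s - \<delta> (r n)))) \<longlonglongrightarrow> (y, s, U y s)"
        by (intro tendsto_intros)
      then have "(\<lambda>n. (\<lambda>(x, t, z). F x t z) (y, s, duhamel_jet (f (r n)) y (s - \<delta> (r n)))) \<longlonglongrightarrow> (\<lambda>(x, t, z). F x t z) (y, s, U y s)"
        using True U by (intro continuous_on_tendsto_compose[OF F_continuous])
          (auto simp: admissible_def duhamel_jet_def jet_space_def)
      then have "(\<lambda>n. F y s (duhamel_jet (f (r n)) y (s - \<delta> (r n)))) \<longlonglongrightarrow> delayed 0 U \<omega>"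
        using True by (simp add: delayed_def \<omega>)
      moreover have "eventually (\<lambda>n. F y s (duhamel_jet (f (r n)) y (s - \<delta> (r n))) = f (r n) \<omega>) sequentially"
        using ev by eventually_elim (use True in \<open>simp add: f_def delayed_def \<omega>\<close>)
      ultimately show ?thesis by (rule Lim_transform_eventually)
    qed
  qed
  have dU: "non.dominated (delayed 0 U)" by (rule delayed_dominated[OF _ U]) simp
  have "U x t w = duhamel (delayed 0 U) w x t" if w: "w \<in> words_upto m" and t: "0 < t" "ereal t < T" for w x t
    using LIMSEQ_unique[OF lim[OF w t] duhamel_tendsto[OF f dU f_lim w t]] .
  then show ?thesis using U by blast
qed

text \<open>The components of \<open>U\<close> are unrelated functions until the fixed point
  equation expresses each of them by \<open>duhamel\<close>; there, differentiation along
  \<open>b\<close> leads from the word \<open>w\<close> to \<open>b # w\<close>, and induction on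
  the word concludes.\<close>

lemma jets_are_derivatives:
  assumes U: "\<And>w x t. w \<in> words_upto m \<Longrightarrow> 0 < t \<Longrightarrow> ereal t < T \<Longrightarrow> U x t w = duhamel f w x t"
    and f: "non.dominated f" and t: "0 < t" "ereal t < T"
  shows "w \<in> words_upto m \<Longrightarrow> iter_partial w (\<lambda>x. U x t []) = (\<lambda>x. U x t w)"
    and "partials_exist_on m UNIV (\<lambda>x. U x t [])"
proof -
  have D: "((\<lambda>h. U (x + h *\<^sub>R b) t w) has_real_derivative U x t (b # w)) (at 0)" if "b # w \<in> words_upto m" for b w x
  proof -
    have "w \<in> words_upto m" using that by (auto simp: words_upto_def)
    then show ?thesis using duhamel_has_partial_derivative[OF that f t] U[OF _ t] that by simp
  qed
  show ip: "iter_partial w (\<lambda>x. U x t []) = (\<lambda>x. U x t w)" if "w \<in> words_upto m" for w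
    using that
  proof (induction w)
    case (Cons b w)
    have "w \<in> words_upto m" using Cons.prems by (auto simp: words_upto_def)
    then have "iter_partial w (\<lambda>x. U x t []) = (\<lambda>x. U x t w)" by (rule Cons.IH)
    then show ?case by (auto simp: partial_def fun_eq_iff intro!: DERIV_imp_deriv D[OF Cons.prems])
  qed simp
  show "partials_exist_on m UNIV (\<lambda>x. U x t [])"
    unfolding partials_exist_on_def
  proof (intro allI impI ballI)
    fix w b x assume bw: "b # w \<in> (words_upto m :: 'a list set)"
    have "w \<in> words_upto m" using bw by (auto simp: words_upto_def)
    then show "partial_differentiable b (iter_partial w (\<lambda>x. U x t [])) x"
      unfolding partial_differentiable_def using D[OF bw, of x]
      by (auto simp: ip real_differentiable_def)
  qed
qed

text \<open>Translates space-time potentials over Borel measures, with a Borel representative of the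
  datum, into the iterated Lebesgue integrals of the equation.\<close>

lemma duhamel_integral_equation:
  assumes f: "non.dominated f" and t: "0 < t" "ereal t < T"
    and \<phi>0: "\<phi>0 \<in> borel_measurable lebesgue" "AE y in lebesgue. \<phi>0 y = \<phi> y"
    and G: "\<forall>x y t. 0 < t \<longrightarrow> ereal t < T \<longrightarrow> g [] x y t = G x y t"
  shows "integrable lebesgue (\<lambda>y. G x y t * \<phi>0 y)" (is ?A)
    and "0 < s \<Longrightarrow> s < t \<Longrightarrow> integrable lebesgue (\<lambda>y. G x y (t - s) * f (y, s))" (is "_ \<Longrightarrow> _ \<Longrightarrow> ?B")
    and "set_integrable lebesgue {0<..<t} (\<lambda>s. LINT y|lebesgue. G x y (t - s) * f (y, s))" (is ?C)
    and "duhamel f [] x t = (LINT y|lebesgue. G x y t * \<phi>0 y)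
       + a0 * (LINT s:{0<..<t}|lebesgue. (LINT y|lebesgue. G x y (t - s) * f (y, s)))" (is ?D)
proof -
  have nil: "[] \<in> words_upto m" by (simp add: words_upto_def)
  have fm: "f \<in> borel_measurable borel"
    using f by (simp add: non.dominated_def)
  have fb: "\<bar>f \<omega>\<bar> \<le> BB \<omega>" for \<omega>
    using f unfolding non.dominated_def by blast
  let ?l = "\<lambda>y. gz [] x y (t - 0) * \<phi> y"
  have l_int: "integrable lborel ?l" by (rule lin.integrable_integrand[OF nil \<phi>_dominated t])
  have l_meas: "?l \<in> borel_measurable lborel" using l_int by simp
  have lG: "gz [] x y (t - 0) = G x y t" for y using t G by (simp add: gz_def)
  have G_meas: "(\<lambda>y. G x y t) \<in> borel_measurable lebesgue"
  proof -
    have "(\<lambda>y. gz [] x y (t - 0)) \<in> borel_measurable lborel"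
      by (rule gz_measurable[OF nil]) auto
    then have "(\<lambda>y. gz [] x y (t - 0)) \<in> borel_measurable lebesgue" by (rule measurable_completion)
    then show ?thesis unfolding lG .
  qed
  have ae: "AE y in lebesgue. G x y t * \<phi>0 y = ?l y"
    using \<phi>0(2) by eventually_elim (simp only: lG)
  have m1: "(\<lambda>y. G x y t * \<phi>0 y) \<in> borel_measurable lebesgue"
    by (intro borel_measurable_times G_meas \<phi>0)
  have l_leb: "integrable lebesgue ?l" using l_int integrable_completion[OF l_meas] by simp
  show ?A
    using integrable_cong_AE[OF m1 borel_measurable_integrable[OF l_leb] ae] l_leb by blast
  have lin_eq: "lin.pot [] \<phi> x t = (LINT y|lebesgue. G x y t * \<phi>0 y)"
    unfolding lin.pot_def integral_completion[OF l_meas, symmetric]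
    by (rule integral_cong_AE[OF borel_measurable_integrable[OF l_leb] m1]) (use ae in eventually_elim, simp)
  let ?h = "\<lambda>y s. gz [] x y (t - max 0 s) * f (y, s)"
  have hG: "?h y s = G x y (t - s) * f (y, s)" if "0 < s" "s < t" for y s
  proof -
    have "ereal (t - s) < T" using that times_mono[of "t - s" t] t by auto
    then show ?thesis using that G by (simp add: gz_def)
  qed
  \<comment> \<open>After time \<open>t\<close> the extended kernel vanishes; at nonpositive times
    the forcing does, because its majorant \<open>BB\<close> does.\<close>
  have h0: "?h y s = 0" if "s \<notin> {0<..<t}" for y s
  proof (cases "t \<le> s")
    case True
    then show ?thesis using t by (simp add: gz_def)
  next
    case False
    then have "f (y, s) = 0" using that fb[of "(y, s)"] by (auto simp: BB_def)
    then show ?thesis by simp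
  qed
  have "integrable lborel (\<lambda>\<omega>. gz [] x (fst \<omega>) (t - max 0 (snd \<omega>)) * f \<omega>)"
    by (rule non.integrable_integrand[OF nil f t])
  then have h_int: "integrable (lborel \<Otimes>\<^sub>M lborel) (\<lambda>(y, s). ?h y s)"
    by (simp add: lborel_prod case_prod_unfold)
  have h_meas: "(\<lambda>y. ?h y s) \<in> borel_measurable lborel" for s
  proof -
    have "(\<lambda>y. gz [] x y (t - max 0 s)) \<in> borel_measurable lborel"
      by (rule gz_measurable[OF nil]) auto
    moreover have "(\<lambda>y. f (y, s)) \<in> borel_measurable lborel"
      by (rule measurable_compose[OF _ fm]) (auto intro!: borel_measurable_continuous_onI continuous_intros)
    ultimately show ?thesis by (rule borel_measurable_times)
  qed
  have inner: "(LINT y|lborel. ?h y s) = indicator {0<..<t} s *\<^sub>R (LINT y|lebesgue. G x y (t - s) * f (y, s))" for s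
  proof (cases "s \<in> {0<..<t}")
    case True
    have "(LINT y|lborel. ?h y s) = (LINT y|lebesgue. ?h y s)"
      by (rule integral_completion[OF h_meas, symmetric])
    also have "\<dots> = (LINT y|lebesgue. G x y (t - s) * f (y, s))"
      using True by (intro Bochner_Integration.integral_cong refl hG) auto
    finally show ?thesis using True by simp
  next
    case False
    have "(LINT y|lborel. ?h y s) = (LINT y|(lborel :: 'a measure). 0)"
      by (intro Bochner_Integration.integral_cong refl h0 False)
    then show ?thesis using False by simp
  qed
  have o_int: "integrable lborel (\<lambda>s. LINT y|lborel. ?h y s)"
    by (rule lborel_pair.integrable_snd[OF h_int])
  have o_leb: "integrable lebesgue (\<lambda>s. LINT y|lborel. ?h y s)"
    using o_int integrable_completion[OF borel_measurable_integrable[OF o_int]] by simp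
  then show ?C unfolding set_integrable_def inner .
  have "non.pot [] f x t = integral\<^sup>L (lborel \<Otimes>\<^sub>M lborel) (\<lambda>(y, s). ?h y s)"
    unfolding non.pot_def by (simp add: lborel_prod case_prod_unfold)
  also have "\<dots> = (LINT s|lborel. LINT y|lborel. ?h y s)"
    by (rule lborel_pair.integral_snd[OF h_int, symmetric])
  also have "\<dots> = (LINT s|lebesgue. LINT y|lborel. ?h y s)"
    by (rule integral_completion[OF borel_measurable_integrable[OF o_int], symmetric])
  also have "\<dots> = (LINT s:{0<..<t}|lebesgue. (LINT y|lebesgue. G x y (t - s) * f (y, s)))"
    unfolding set_lebesgue_integral_def inner ..
  finally show ?D unfolding duhamel_def lin_eq by simp
  \<comment> \<open>Fubini would give integrability for almost every \<open>s\<close> only. At each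
    fixed \<open>s > 0\<close> the forcing is bounded in space by \<open>BB_le\<close>, and the
    kernel has finite mass.\<close>
  show ?B if s: "0 < s" "s < t"
  proof -
    let ?k = "kern L ((t - s) powr (1 / d)) x"
    let ?c = "\<kappa> * (e * (s / 2) powr (- \<nu> - 1))"
    have c0: "0 \<le> ?c" using \<kappa>_nonneg e_pos by simp
    have "integrable lborel (\<lambda>y. ?h y s)"
    proof (rule integrableI_bounded[OF h_meas])
      have "(\<integral>\<^sup>+y. ennreal (norm (?h y s)) \<partial>lborel)
          \<le> (\<integral>\<^sup>+y. ennreal (CG * ?c) * ennreal (?k y) \<partial>lborel)"
      proof (intro nn_integral_mono)
        fix y
        have "norm (?h y s) \<le> CG * (decay 0 x y (t - max 0 s) * BB (y, s))"
          using non.integrand_bound[where \<psi> = f and \<omega> = "(y, s)", OF nil fb, of x "t - max 0 s"] by simp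
        also have "\<dots> \<le> CG * (decay 0 x y (t - max 0 s) * ?c)"
          using CG s by (intro mult_left_mono BB_le) auto
        also have "\<dots> = CG * ?c * ?k y"
          using s by (simp add: decay_def)
        finally have "ennreal (norm (?h y s)) \<le> ennreal (CG * ?c * ?k y)"
          by (rule ennreal_leI)
        also have "\<dots> = ennreal (CG * ?c) * ennreal (?k y)"
          using CG c0 by (intro ennreal_mult) auto
        finally show "ennreal (norm (?h y s)) \<le> \<dots>" .
      qed
      also have "\<dots> = ennreal (CG * ?c) * (\<integral>\<^sup>+y. ennreal (?k y) \<partial>lborel)"
        by (rule nn_integral_cmult) measurable
      also have "\<dots> \<le> ennreal (CG * ?c) * ennreal mass"
        unfolding mass_def using s L_pos by (intro mult_left_mono nn_integral_kern) auto
      also have "\<dots> < \<infinity>" by (simp add: ennreal_mult_less_top)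
      finally show "(\<integral>\<^sup>+y. ennreal (norm (?h y s)) \<partial>lborel) < \<infinity>" .
    qed
    then have "integrable lebesgue (\<lambda>y. ?h y s)" using integrable_completion[OF h_meas] by simp
    then show ?thesis using hG[OF s] by simp
  qed
qed

lemma solution_exists:
  assumes \<phi>0: "\<phi>0 \<in> borel_measurable lebesgue" "AE y in lebesgue. \<phi>0 y = \<phi> y"
    and G: "\<forall>x y t. 0 < t \<longrightarrow> ereal t < T \<longrightarrow> g [] x y t = G x y t"
  shows "\<exists>u. is_solution m a0 G F \<phi>0 T u \<and>
    (\<forall>x t. \<forall>j\<le>m. 0 < t \<and> ereal t < T \<longrightarrow> nabla_norm j (\<lambda>x. u x t) x
       \<le> real (card (words_upto m :: 'a list set)) * (M0 * e powr (1 / q)) * t powr (- \<nu> - real j / d))"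
proof -
  obtain U where U: "admissible U"
    and fix_U: "\<And>w x t. w \<in> words_upto m \<Longrightarrow> 0 < t \<Longrightarrow> ereal t < T \<Longrightarrow> U x t w = duhamel (delayed 0 U) w x t"
    using duhamel_fixed_point by blast
  have f: "non.dominated (delayed 0 U)" by (rule delayed_dominated[OF _ U]) simp
  have ip1: "iter_partial w (\<lambda>x. U x t []) = (\<lambda>x. U x t w)" if "w \<in> words_upto m" "0 < t" "ereal t < T" for w t
    using jets_are_derivatives(1)[of U, OF _ f that(2,3,1)] fix_U by blast
  have ip2: "partials_exist_on m UNIV (\<lambda>x. U x t [])" if "0 < t" "ereal t < T" for t
    using jets_are_derivatives(2)[of U, OF _ f that] fix_U by blast
  define u where "u x t = U x t []" for x t
  have ipu: "iter_partial w (\<lambda>x. u x t) = (\<lambda>x. U x t w)" if "w \<in> words_upto m" "0 < t" "ereal t < T" for w t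
    unfolding u_def using ip1[OF that] .
  have bnd: "\<bar>U x t w\<bar> \<le> M0 * e powr (1 / q) * t powr (- \<nu> - real (length w) / d)"
    if "w \<in> words_upto m" "0 < t" "ereal t < T" for w x t
    using duhamel_uniform_bound[OF f that] fix_U[OF that] by simp
  \<comment> \<open>Equality of functions, including the default value outside
    \<open>words_upto m\<close>, since \<open>F\<close> receives the whole function.\<close>
  have jet_u: "jet m (\<lambda>y. u y s) y = U y s" if "0 < s" "ereal s < T" for y s
  proof
    fix w
    show "jet m (\<lambda>y. u y s) y w = U y s w"
    proof (cases "w \<in> words_upto m")
      case True
      then show ?thesis by (simp add: jet_def ipu[OF True that])
    next
      case False
      then have "U y s w = undefined"
        using U by (auto simp: admissible_def jet_space_def dest: PiE_arb)
      then show ?thesis using False by (simp add: jet_def)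
    qed
  qed
  have eq: "satisfies_integral_eq m a0 G F \<phi>0 u x t" if t: "0 < t" "ereal t < T" for x t
  proof -
    have fF: "F y s (jet m (\<lambda>y. u y s) y) = delayed 0 U (y, s)" if "0 < s" "s < t" for y s
    proof -
      have "ereal s < T" using that t times_mono[of s t] by auto
      then show ?thesis using that jet_u by (simp add: delayed_def)
    qed
    note D = duhamel_integral_equation[OF f t \<phi>0 G, where x = x]
    have set_eq: "set_integrable lebesgue {0<..<t} (\<lambda>s. LINT y|lebesgue. G x y (t - s) * F y s (jet m (\<lambda>y. u y s) y))"
      using D(3) by (rule set_integrable_cong[THEN iffD1, rotated -1]) (auto simp: fF)
    have int_eq: "(LINT s:{0<..<t}|lebesgue. (LINT y|lebesgue. G x y (t - s) * F y s (jet m (\<lambda>y. u y s) y)))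
        = (LINT s:{0<..<t}|lebesgue. (LINT y|lebesgue. G x y (t - s) * delayed 0 U (y, s)))"
      by (rule set_lebesgue_integral_cong) (auto simp: fF)
    have nil: "[] \<in> words_upto m" by (simp add: words_upto_def)
    have D2: "integrable lebesgue (\<lambda>y. G x y (t - s) * F y s (jet m (\<lambda>y. u y s) y))" if "0 < s \<and> s < t" for s
      using D(2)[of s] fF[of s] that by simp
    have D4: "u x t = (LINT y|lebesgue. G x y t * \<phi>0 y) + a0 *
        (LINT s:{0<..<t}|lebesgue. (LINT y|lebesgue. G x y (t - s) * delayed 0 U (y, s)))"
      unfolding u_def fix_U[OF nil t] by (rule D(4))
    show ?thesis
      unfolding satisfies_integral_eq_def int_eq
      by (intro conjI allI impI D(1) D2 set_eq D4) auto
  qed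
  have "is_solution m a0 G F \<phi>0 T u"
    unfolding is_solution_def
  proof (intro conjI allI impI ballI)
    fix \<tau> t assume "0 < \<tau> \<and> ereal \<tau> < T" "\<tau> < t \<and> ereal t < T"
    then show "partials_exist_on m UNIV (\<lambda>x. u x t)" unfolding u_def by (intro ip2) auto
  next
    fix \<tau> and w :: "'a list" assume \<tau>: "0 < \<tau> \<and> ereal \<tau> < T" and w: "w \<in> words_upto m"
    show "bounded ((\<lambda>(x, t). iter_partial w (\<lambda>x. u x t) x) ` (UNIV \<times> {t. \<tau> < t \<and> ereal t < T}))"
      unfolding bounded_iff
    proof (intro exI ballI)
      fix v assume "v \<in> (\<lambda>(x, t). iter_partial w (\<lambda>x. u x t) x) ` (UNIV \<times> {t. \<tau> < t \<and> ereal t < T})"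
      then obtain x t where v: "v = iter_partial w (\<lambda>x. u x t) x" "\<tau> < t" "ereal t < T" by auto
      have "norm v \<le> M0 * e powr (1 / q) * t powr (- \<nu> - real (length w) / d)"
        using v \<tau> bnd[OF w, of t x] by (simp add: ipu[OF w])
      also have "\<dots> \<le> M0 * e powr (1 / q) * \<tau> powr (- \<nu> - real (length w) / d)"
      proof (intro mult_left_mono powr_mono2')
        have "0 \<le> real (length w) / d" using d_pos by simp
        then show "- \<nu> - real (length w) / d \<le> 0" using \<nu>_pos by linarith
      qed (use M0_pos \<tau> v in auto)
      finally show "norm v \<le> M0 * e powr (1 / q) * \<tau> powr (- \<nu> - real (length w) / d)" .
    qed
    have "continuous_on (UNIV \<times> {t. \<tau> < t \<and> ereal t < T}) (\<lambda>(x, t). U x t w)"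
      using U w \<tau> unfolding admissible_def jet_continuous_def
      by (auto intro: continuous_on_subset)
    then show "continuous_on (UNIV \<times> {t. \<tau> < t \<and> ereal t < T}) (\<lambda>(x, t). iter_partial w (\<lambda>x. u x t) x)"
      by (rule continuous_on_eq) (use \<tau> ipu[OF w] in auto)
  next
    fix x t assume "0 < t \<and> ereal t < T"
    then show "satisfies_integral_eq m a0 G F \<phi>0 u x t" by (intro eq) auto
  qed
  moreover have "nabla_norm j (\<lambda>x. u x t) x
       \<le> real (card (words_upto m :: 'a list set)) * (M0 * e powr (1 / q)) * t powr (- \<nu> - real j / d)"
    if j: "j \<le> m" and t: "0 < t" "ereal t < T" for x t j
  proof -
    let ?b = "M0 * e powr (1 / q) * t powr (- \<nu> - real j / d)"
    have b0: "0 \<le> ?b" using M0_pos by simp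
    have "nabla_norm j (\<lambda>x. u x t) x \<le> (\<Sum>w\<in>words j. \<bar>iter_partial w (\<lambda>x. u x t) x\<bar>)"
      unfolding nabla_norm_def block_norm_def by (rule L2_set_le_sum_abs)
    also have "\<dots> \<le> (\<Sum>w\<in>(words j :: 'a list set). ?b)"
    proof (rule sum_mono)
      fix w :: "'a list" assume w: "w \<in> words j"
      then have w': "w \<in> words_upto m" "length w = j" using words_subset_upto[OF j] by (auto simp: words_def)
      show "\<bar>iter_partial w (\<lambda>x. u x t) x\<bar> \<le> ?b"
        using bnd[OF w'(1) t, of x] by (simp add: ipu[OF w'(1) t] w'(2))
    qed
    also have "\<dots> = real (card (words j :: 'a list set)) * ?b" by simp
    also have "\<dots> \<le> real (card (words_upto m :: 'a list set)) * ?b"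
      using b0 words_subset_upto[OF j] finite_words_upto by (intro mult_right_mono) (auto intro: card_mono)
    finally show ?thesis by (simp only: mult.assoc)
  qed
  ultimately show ?thesis by blast
qed

end

section \<open>Admissible kernels and Morrey data\<close>

text \<open>The smoothness of \<open>G\<close> is stated for all variables jointly; derivatives
  along the basis vectors \<open>(b, 0, 0)\<close> are the ones in \<open>x\<close>.\<close>

lemma iter_partial_slice:
  "iter_partial (map (\<lambda>b. (b, 0, 0)) w) (\<lambda>(x, y, t). G x y t) = (\<lambda>(x, y, t). iter_partial w (\<lambda>x. G x y t) x)"
  for G :: "'a::euclidean_space \<Rightarrow> 'a \<Rightarrow> real \<Rightarrow> real"
  by (induction w) (auto simp: partial_def fun_eq_iff)

lemma slice_in_words_upto:
  "w \<in> words_upto m \<Longrightarrow> map (\<lambda>b. (b, 0, 0)) w \<in> (words_upto m :: ('a::euclidean_space \<times> 'a \<times> real) list set)"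
  by (auto simp: words_upto_def Basis_prod_def zero_prod_def)

lemma abs_iter_partial_le_nabla_norm:
  fixes f :: "'a::euclidean_space \<Rightarrow> real"
  assumes "set w \<subseteq> Basis"
  shows "\<bar>iter_partial w f x\<bar> \<le> nabla_norm (length w) f x"
proof -
  have "w \<in> words (length w)" using assms by (simp add: words_def)
  then have "L2_set (\<lambda>w. \<bar>iter_partial w f x\<bar>) {w} \<le> L2_set (\<lambda>w. \<bar>iter_partial w f x\<bar>) (words (length w))"
    unfolding L2_set_def by (intro real_sqrt_le_mono sum_mono2 finite_words) auto
  then show ?thesis by (simp add: nabla_norm_def block_norm_def L2_set_def)
qed

text \<open>With \<rho> = \<open>t powr (1/d)\<close> the base of the spatial factor is
  \<open>(\<rho> + |x - y|) / \<rho> \<ge> 1\<close>, so its extra decay of order \<open>j\<close>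
  may be dropped. The remaining powers of \<rho> combine to
  \<open>\<rho> powr (L - j)\<close>.\<close>

lemma kernel_decay_le:
  fixes x y :: "'a::euclidean_space"
  assumes t: "0 < t" and d: "0 < d"
  shows "t powr (- (real DIM('a) + real j) / d) * (1 + t powr (- 1 / d) * norm (x - y)) powr (- real DIM('a) - L - real j)
    \<le> t powr (- real j / d) * kern L (t powr (1 / d)) x y"
proof -
  let ?\<rho> = "t powr (1 / d)" and ?N = "real DIM('a)"
  have \<rho>: "0 < ?\<rho>" using t by simp
  let ?a = "1 + t powr (- 1 / d) * norm (x - y)"
  have a: "?a = (?\<rho> + dist x y) / ?\<rho>"
    using t by (simp add: dist_norm powr_minus field_simps)
  have pos: "0 < ?\<rho> + dist x y" using \<rho> by (simp add: add_pos_nonneg)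
  have "1 \<le> ?a" by simp
  then have "?a powr (- ?N - L - real j) \<le> ?a powr (- (?N + L))"
    by (intro powr_mono) auto
  also have "\<dots> = (?\<rho> + dist x y) powr (- (?N + L)) * ?\<rho> powr (?N + L)"
    unfolding a using pos \<rho> powr_divide[of "?\<rho> + dist x y" ?\<rho> "- (?N + L)"] powr_minus_divide[of ?\<rho> "?N + L"]
    by simp
  finally have "t powr (- (?N + real j) / d) * ?a powr (- ?N - L - real j)
     \<le> t powr (- (?N + real j) / d) * ((?\<rho> + dist x y) powr (- (?N + L)) * ?\<rho> powr (?N + L))"
    by (intro mult_left_mono) auto
  also have "\<dots> = (t powr (- (?N + real j) / d) * t powr ((?N + L) / d)) * (?\<rho> + dist x y) powr (- (?N + L))"
    by (simp add: powr_powr)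
  also have "t powr (- (?N + real j) / d) * t powr ((?N + L) / d) = t powr (- real j / d) * t powr (L / d)"
  proof -
    have "- (?N + real j) / d + (?N + L) / d = - real j / d + L / d"
      by (simp add: add_divide_distrib diff_divide_distrib)
    then show ?thesis by (simp only: powr_add[symmetric])
  qed
  finally show ?thesis by (simp add: kern_def powr_powr mult_ac)
qed

text \<open>The constant is obtained before \<open>T\<close>, so that everything derived from it is
  uniform in \<open>T\<close>.\<close>

lemma admissible_kernel_jet:
  fixes G :: "'a::euclidean_space \<Rightarrow> 'a \<Rightarrow> real \<Rightarrow> real"
  assumes d: "real m < d" and L: "0 < L" and G: "admissible_kernel m d L Tstar G"
  obtains CG where "0 < CG"
    "\<And>T. T \<le> Tstar \<Longrightarrow> jet_kernel m d L CG T (\<lambda>w x y t. iter_partial w (\<lambda>x. G x y t) x)"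
proof -
  let ?S = "\<lambda>T. {(x, y, t) |x y t. 0 < t \<and> ereal t < T} :: ('a \<times> 'a \<times> real) set"
  let ?lift = "map (\<lambda>b. (b, 0, 0)) :: 'a list \<Rightarrow> ('a \<times> 'a \<times> real) list"
  have Ck: "Ck_on m (?S Tstar) (\<lambda>(x, y, t). G x y t)" using G by (simp add: admissible_kernel_def)
  obtain CG where CG: "0 < CG" and bound: "\<And>x y t j. j \<le> m \<Longrightarrow> 0 < t \<Longrightarrow> ereal t < Tstar \<Longrightarrow>
     nabla_norm j (\<lambda>x. G x y t) x \<le> CG * t powr (- (real DIM('a) + real j) / d)
             * (1 + t powr (- 1 / d) * norm (x - y)) powr (- real DIM('a) - L - real j)"
    using G unfolding admissible_kernel_def by blast
  have "jet_kernel m d L CG T (\<lambda>w x y t. iter_partial w (\<lambda>x. G x y t) x)" if T: "T \<le> Tstar" for T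
  proof
    show "real m < d" "0 < L" "0 < CG" by fact+
    fix w :: "'a list" assume w: "w \<in> words_upto m"
    have "continuous_on (?S Tstar) (iter_partial (?lift w) (\<lambda>(x, y, t). G x y t))"
      using Ck slice_in_words_upto[OF w] by (simp add: Ck_on_def)
    then show "continuous_on (?S T) (\<lambda>(x, y, t). iter_partial w (\<lambda>x. G x y t) x)"
      unfolding iter_partial_slice by (rule continuous_on_subset) (use T in \<open>auto intro: order.strict_trans2\<close>)
    fix x y :: 'a and t :: real assume t: "0 < t" "ereal t < T"
    have tS: "ereal t < Tstar" using t(2) T by (rule order.strict_trans2)
    have wB: "set w \<subseteq> Basis" "length w \<le> m" using w by (auto simp: words_upto_def)
    have dp: "0 < d" using d by linarith
    have "\<bar>iter_partial w (\<lambda>x. G x y t) x\<bar> \<le> nabla_norm (length w) (\<lambda>x. G x y t) x"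
      by (rule abs_iter_partial_le_nabla_norm[OF wB(1)])
    also have "\<dots> \<le> CG * (t powr (- (real DIM('a) + real (length w)) / d)
             * (1 + t powr (- 1 / d) * norm (x - y)) powr (- real DIM('a) - L - real (length w)))"
      using bound[OF wB(2) t(1) tS] by (simp only: mult.assoc)
    also have "\<dots> \<le> CG * (t powr (- real (length w) / d) * kern L (t powr (1 / d)) x y)"
      using CG by (intro mult_left_mono kernel_decay_le t dp) auto
    finally show "\<bar>iter_partial w (\<lambda>x. G x y t) x\<bar> \<le> CG * (t powr (- real (length w) / d) * kern L (t powr (1 / d)) x y)" .
  next
    fix b :: 'a and w :: "'a list" and x y :: 'a and t :: real
    assume bw: "b # w \<in> words_upto m" and t: "0 < t" "ereal t < T"
    have tS: "ereal t < Tstar" using t(2) T by (rule order.strict_trans2)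
    have "partial_differentiable (b, 0, 0) (iter_partial (?lift w) (\<lambda>(x, y, t). G x y t)) (x, y, t)"
      using Ck slice_in_words_upto[OF bw] t tS by (auto simp: Ck_on_def partials_exist_on_def)
    then have "(\<lambda>h. iter_partial w (\<lambda>x. G x y t) (x + h *\<^sub>R b)) differentiable (at 0)"
      by (simp add: partial_differentiable_def iter_partial_slice)
    then show "((\<lambda>h. iter_partial w (\<lambda>x. G x y t) (x + h *\<^sub>R b)) has_real_derivative iter_partial (b # w) (\<lambda>x. G x y t) x) (at 0)"
      using DERIV_imp_deriv by (force simp: real_differentiable_def partial_def)
  qed
  then show ?thesis using that CG by blast
qed

section \<open>Initial data under the Morrey condition\<close>

lemma locally_integrable_measurable:
  fixes \<phi> :: "'a::euclidean_space \<Rightarrow> real"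
  assumes "locally_integrable \<phi>"
  shows "\<phi> \<in> borel_measurable lebesgue"
proof (rule borel_measurable_LIMSEQ_real)
  fix n :: nat
  have "\<phi> absolutely_integrable_on cball 0 (real n)"
    using assms by (simp add: locally_integrable_def)
  then show "(\<lambda>y. indicator (cball 0 (real n)) y *\<^sub>R \<phi> y) \<in> borel_measurable lebesgue"
    unfolding set_integrable_def by (rule borel_measurable_integrable)
next
  fix y :: 'a
  obtain k :: nat where k: "norm y \<le> real k" using real_arch_simple by blast
  have "eventually (\<lambda>n. indicator (cball 0 (real n)) y *\<^sub>R \<phi> y = \<phi> y) sequentially"
    using eventually_ge_at_top[of k] by eventually_elim (use k in \<open>auto simp: indicator_def\<close>)
  then show "(\<lambda>n. indicator (cball 0 (real n)) y *\<^sub>R \<phi> y) \<longlonglongrightarrow> \<phi> y"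
    by (rule tendsto_eventually)
qed

lemma local_morrey_norm_ball:
  fixes \<phi> :: "'a::euclidean_space \<Rightarrow> real"
  assumes norm: "local_morrey_norm q r R \<phi> \<le> ennreal \<gamma>" and \<sigma>: "0 < \<sigma>" "ereal \<sigma> < R" and q: "1 < q" and \<gamma>: "0 < \<gamma>"
  shows "(\<lambda>y. \<bar>\<phi> y\<bar> powr q) absolutely_integrable_on ball x \<sigma>"
    and "(LINT y:ball x \<sigma>|lebesgue. \<bar>\<phi> y\<bar> powr q)
      \<le> measure lebesgue (ball x \<sigma>) * (\<gamma> * \<sigma> powr (- real DIM('a) / r)) powr q"
proof -
  let ?v = "\<lambda>x \<sigma>. if (\<lambda>y. \<bar>\<phi> y\<bar> powr q) absolutely_integrable_on ball x \<sigma>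
        then ennreal (\<sigma> powr (real DIM('a) / r)
               * (1 / measure lebesgue (ball x \<sigma>)
                   * (LINT y:ball x \<sigma>|lebesgue. \<bar>\<phi> y\<bar> powr q)) powr (1 / q))
        else \<infinity>"
  have "?v x \<sigma> \<le> (SUP \<sigma>\<in>{\<sigma>. 0 < \<sigma> \<and> ereal \<sigma> < R}. ?v x \<sigma>)"
    by (rule SUP_upper) (use \<sigma> in auto)
  also have "\<dots> \<le> (SUP x. SUP \<sigma>\<in>{\<sigma>. 0 < \<sigma> \<and> ereal \<sigma> < R}. ?v x \<sigma>)"
    by (rule SUP_upper) auto
  also have "\<dots> \<le> ennreal \<gamma>" using norm by (simp only: local_morrey_norm_def)
  finally have v: "?v x \<sigma> \<le> ennreal \<gamma>" .
  show int: "(\<lambda>y. \<bar>\<phi> y\<bar> powr q) absolutely_integrable_on ball x \<sigma>"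
    using v by (auto split: if_splits simp: top_unique)
  let ?I = "LINT y:ball x \<sigma>|lebesgue. \<bar>\<phi> y\<bar> powr q" and ?b = "measure lebesgue (ball x \<sigma>)"
  have b: "0 < ?b" using \<sigma> by (simp add: content_ball_pos)
  have I0: "0 \<le> ?I" unfolding set_lebesgue_integral_def by (intro Bochner_Integration.integral_nonneg) auto
  have "\<sigma> powr (real DIM('a) / r) * (1 / ?b * ?I) powr (1 / q) \<le> \<gamma>"
    using v int \<gamma> by simp
  then have "\<sigma> powr (- real DIM('a) / r) * (\<sigma> powr (real DIM('a) / r) * (1 / ?b * ?I) powr (1 / q)) \<le> \<sigma> powr (- real DIM('a) / r) * \<gamma>"
    by (intro mult_left_mono) auto
  moreover have "\<sigma> powr (- real DIM('a) / r) * \<sigma> powr (real DIM('a) / r) = 1"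
    using \<sigma> by (simp flip: powr_add)
  ultimately have "(1 / ?b * ?I) powr (1 / q) \<le> \<gamma> * \<sigma> powr (- real DIM('a) / r)"
    by (simp only: mult.assoc[symmetric] mult_1 mult.commute[of \<gamma>])
  then have "((1 / ?b * ?I) powr (1 / q)) powr q \<le> (\<gamma> * \<sigma> powr (- real DIM('a) / r)) powr q"
    using q by (intro powr_mono2) auto
  then have "1 / ?b * ?I \<le> (\<gamma> * \<sigma> powr (- real DIM('a) / r)) powr q"
    using q b I0 by (simp add: powr_powr)
  then show "?I \<le> ?b * (\<gamma> * \<sigma> powr (- real DIM('a) / r)) powr q"
    using b by (simp add: field_simps)
qed

text \<open>Lowers the exponent and passes to a Borel representative. It is Jensen's inequality up
  to the factor 2: in \<open>powr_le_one_plus\<close> the level is the bound of the mean of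
  \<open>|\<phi>| powr q\<close>, so each of the two summands contributes at most one volume of the
  ball.\<close>

lemma ball_average_le:
  fixes \<phi> \<phi>' :: "'a::euclidean_space \<Rightarrow> real"
  assumes norm: "local_morrey_norm q r R \<phi> \<le> ennreal \<gamma>" and \<sigma>: "0 < \<sigma>" "ereal \<sigma> < R"
    and q': "1 < q'" "q' \<le> q" and \<gamma>: "0 < \<gamma>"
    and \<phi>': "\<phi>' \<in> borel_measurable borel" "AE y in lebesgue. \<phi> y = \<phi>' y"
  shows "(\<integral>\<^sup>+y. ennreal (\<bar>\<phi>' y\<bar> powr q') * indicator (ball x \<sigma>) y \<partial>lborel)
    \<le> ennreal (2 * (\<gamma> * \<sigma> powr (- real DIM('a) / r)) powr q' * measure lborel (ball x \<sigma>))"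
proof -
  have q: "1 < q" using q' by simp
  note N = local_morrey_norm_ball[OF norm \<sigma> q \<gamma>, of x]
  let ?l = "\<gamma> * \<sigma> powr (- real DIM('a) / r)" and ?B = "ball x \<sigma>"
  let ?b = "measure lborel ?B"
  have b0: "0 \<le> ?b" by simp
  have l: "0 < ?l" using \<gamma> \<sigma> by simp
  have eb: "emeasure lborel ?B = ennreal ?b"
    using emeasure_eq_ennreal_measure[of lborel ?B] emeasure_lborel_ball_finite[of x \<sigma>] by (auto simp: less_top)
  have I: "(\<integral>\<^sup>+y. ennreal (\<bar>\<phi>' y\<bar> powr q) * indicator ?B y \<partial>lborel) \<le> ennreal (?b * ?l powr q)"
  proof -
    have "(\<integral>\<^sup>+y. ennreal (\<bar>\<phi>' y\<bar> powr q) * indicator ?B y \<partial>lborel)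
        = (\<integral>\<^sup>+y. ennreal (\<bar>\<phi>' y\<bar> powr q) * indicator ?B y \<partial>lebesgue)"
      by (simp add: nn_integral_completion)
    also have "\<dots> = (\<integral>\<^sup>+y. ennreal (indicator ?B y *\<^sub>R \<bar>\<phi> y\<bar> powr q) \<partial>lebesgue)"
      by (rule nn_integral_cong_AE) (use \<phi>'(2) in eventually_elim, auto simp: indicator_def)
    also have "\<dots> = ennreal (LINT y:?B|lebesgue. \<bar>\<phi> y\<bar> powr q)"
      unfolding set_lebesgue_integral_def
      by (rule nn_integral_eq_integral) (use N(1) in \<open>auto simp: set_integrable_def\<close>)
    also have "\<dots> \<le> ennreal (?b * ?l powr q)"
      using N(2) by (intro ennreal_leI) simp
    finally show ?thesis .
  qed
  have ennreal_affine: "ennreal (a * (1 + z * b)) = ennreal a * (1 + ennreal z * ennreal b)"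
    if "0 \<le> a" "0 \<le> z" "0 \<le> b" for a z b :: real
    using that by (simp add: ennreal_mult ennreal_plus)
  let ?v = "?l powr q"
  have v: "0 < ?v" unfolding powr_gt_zero using l by linarith
  have vq: "?v powr (q' / q) = ?l powr q'" using q by (simp add: powr_powr)
  have pt: "\<bar>a\<bar> powr q' \<le> ?l powr q' * (1 + 1 / ?v * \<bar>a\<bar> powr q)" for a :: real
  proof -
    have "(\<bar>a\<bar> powr q) powr (q' / q) \<le> ?v powr (q' / q) * (1 + \<bar>a\<bar> powr q / ?v)"
      using q' q by (intro powr_le_one_plus v) auto
    then show ?thesis unfolding vq using q by (simp add: powr_powr)
  qed
  have "(\<integral>\<^sup>+y. ennreal (\<bar>\<phi>' y\<bar> powr q') * indicator ?B y \<partial>lborel)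
      \<le> (\<integral>\<^sup>+y. ennreal (?l powr q') * (indicator ?B y + ennreal (1 / ?v) * (ennreal (\<bar>\<phi>' y\<bar> powr q) * indicator ?B y)) \<partial>lborel)"
  proof (intro nn_integral_mono)
    fix y
    have "ennreal (\<bar>\<phi>' y\<bar> powr q') \<le> ennreal (?l powr q' * (1 + 1 / ?v * \<bar>\<phi>' y\<bar> powr q))"
      by (intro ennreal_leI pt)
    also have "\<dots> = ennreal (?l powr q') * (1 + ennreal (1 / ?v) * ennreal (\<bar>\<phi>' y\<bar> powr q))"
      using v by (intro ennreal_affine) auto
    finally show "ennreal (\<bar>\<phi>' y\<bar> powr q') * indicator ?B y
       \<le> ennreal (?l powr q') * (indicator ?B y + ennreal (1 / ?v) * (ennreal (\<bar>\<phi>' y\<bar> powr q) * indicator ?B y))"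
      by (auto simp: indicator_def)
  qed
  also have "\<dots> = ennreal (?l powr q') * (emeasure lborel ?B + ennreal (1 / ?v) * (\<integral>\<^sup>+y. ennreal (\<bar>\<phi>' y\<bar> powr q) * indicator ?B y \<partial>lborel))"
  proof -
    have [measurable]: "(\<lambda>y. ennreal (\<bar>\<phi>' y\<bar> powr q) * indicator ?B y) \<in> borel_measurable lborel"
      using \<phi>'(1) by (intro borel_measurable_times_ennreal borel_measurable_indicator) auto
    have [measurable]: "(\<lambda>y. indicator ?B y :: ennreal) \<in> borel_measurable lborel"
      by (intro borel_measurable_indicator) auto
    show ?thesis by (simp add: nn_integral_cmult nn_integral_add)
  qed
  also have "\<dots> \<le> ennreal (?l powr q') * (ennreal ?b + ennreal (1 / ?v) * ennreal (?b * ?v))"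
    unfolding eb by (intro mult_left_mono add_left_mono I) auto
  also have "\<dots> = ennreal (2 * ?l powr q' * ?b)"
    using v b0 by (simp flip: ennreal_mult ennreal_plus)
  finally show ?thesis .
qed

theorem theorem1p4:
  fixes m :: nat and a0 d L A :: real and Tstar :: ereal
    and G :: "'a::euclidean_space \<Rightarrow> 'a \<Rightarrow> real \<Rightarrow> real"
    and F :: "'a \<Rightarrow> real \<Rightarrow> ('a list \<Rightarrow> real) \<Rightarrow> real"
    and J :: "nat set" and p :: "nat \<Rightarrow> real" and q r0 :: real
  assumes "d > real m" and "L > 0" and "0 < Tstar"
    and "admissible_kernel m d L Tstar G"
    and "structure_condition m d J p A F"
    and "r0 = r_zero DIM('a) d J p A"
    and "r0 > 1"
    and "q > 1"
  shows "\<exists>\<gamma>>0. \<forall>\<phi> :: 'a \<Rightarrow> real. locally_integrable \<phi> \<longrightarrow>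
           (\<exists>C>0. \<forall>T. 0 < T \<and> T \<le> Tstar
               \<and> local_morrey_norm q r0 (ereal_root d T) \<phi> \<le> ennreal \<gamma> \<longrightarrow>
             (\<exists>u. is_solution m a0 G F \<phi> T u \<and>
              (\<forall>x t. \<forall>j\<le>m. 0 < t \<and> ereal t < T \<longrightarrow>
                   nabla_norm j (\<lambda>x. u x t) x
                     \<le> C * t powr (- real DIM('a) / (d * r0) - real j / d))))"
proof -
  obtain CG where CG: "0 < CG"
    and kernel: "\<And>T. T \<le> Tstar \<Longrightarrow> jet_kernel m d L CG T (\<lambda>w x y t. iter_partial w (\<lambda>x. G x y t) x)"
    using admissible_kernel_jet[OF assms(1,2,4)] by blast
  \<comment> \<open>The largest exponent not above \<open>q\<close> for which the nonlinearity is
    still at least linear in \<theta>; it exceeds 1 because both \<open>q\<close> and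
    \<open>|p|\<close> do.\<close>
  define q' where "q' = min q (p_sum J p)"
  have P: "1 < p_sum J p" using assms(5) by (simp add: structure_condition_def)
  have q': "1 < q'" "q' \<le> q" "q' \<le> p_sum J p" using P assms(8) by (auto simp: q'_def)
  interpret jet_parameters m d L CG a0 A q' r0 J p F
    using assms CG q' by unfold_locales auto
  define X where "X = \<bar>a0\<bar> * CG * (M1 powr p_sum J p * Cn)"
  have X: "0 \<le> X" unfolding X_def using CG Cn_nonneg by simp
  \<comment> \<open>Solves \<open>e powr ((|p| - 1)/q') = 1/(X + 1)\<close>, which makes the left
    side of the smallness condition \<open>X/(X + 1)\<close>; the added 1 covers
    \<open>X = 0\<close>, as for \<open>a0 = 0\<close>.\<close>
  define e where "e = (1 / (X + 1)) powr (q' / (p_sum J p - 1))"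
  have e: "0 < e" using X by (simp add: e_def)
  have e_pow: "e powr ((p_sum J p - 1) / q') = 1 / (X + 1)"
  proof -
    have "q' / (p_sum J p - 1) * ((p_sum J p - 1) / q') = 1" using P q' by simp
    then show ?thesis using X by (simp only: e_def powr_powr) simp
  qed
  have small: "\<bar>a0\<bar> * CG * (M1 powr p_sum J p * Cn * e powr ((p_sum J p - 1) / q')) \<le> 1"
  proof -
    have "\<bar>a0\<bar> * CG * (M1 powr p_sum J p * Cn * e powr ((p_sum J p - 1) / q')) = X * (1 / (X + 1))"
      unfolding e_pow X_def by (simp only: mult.assoc)
    also have "\<dots> \<le> 1" using X by simp
    finally show ?thesis .
  qed
  \<comment> \<open>The constant of \<open>smear_le_average\<close> times the 2 of
    \<open>ball_average_le\<close>; \<gamma> below is the solution of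
    \<open>c * \<gamma> powr q' = e\<close>.\<close>
  define c where "c = 2 powr (real DIM('a) + 2 * L) * mass * 2"
  have c: "0 < c" unfolding c_def using mass_pos by simp
  define \<gamma> where "\<gamma> = (e / c) powr (1 / q')"
  have \<gamma>: "0 < \<gamma>" using e c by (simp add: \<gamma>_def)
  have \<gamma>_pow: "c * \<gamma> powr q' = e" using e c q' by (simp add: \<gamma>_def powr_powr)
  define C where "C = real (card (words_upto m :: 'a list set)) * (M0 * e powr (1 / q'))"
  have C: "0 < C" unfolding C_def using card_words_pos M0_pos e by (intro mult_pos_pos) auto
  \<comment> \<open>Both \<gamma> and \<open>C\<close> are fixed at this point; \<phi> and
    \<open>T\<close> enter only afterwards.\<close>
  show ?thesis
  proof (rule exI[of _ \<gamma>], intro conjI \<gamma> allI impI, rule exI[of _ C], intro conjI C allI impI)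
    fix \<phi> :: "'a \<Rightarrow> real" and T :: ereal
    assume \<phi>: "locally_integrable \<phi>"
      and T: "0 < T \<and> T \<le> Tstar \<and> local_morrey_norm q r0 (ereal_root d T) \<phi> \<le> ennreal \<gamma>"
    have \<phi>m: "\<phi> \<in> borel_measurable lebesgue" by (rule locally_integrable_measurable[OF \<phi>])
    \<comment> \<open>The datum is only Lebesgue measurable, while the potentials are built over
      Borel measures.\<close>
    obtain \<phi>' where \<phi>': "\<phi>' \<in> borel_measurable lborel" "AE y in lborel. \<phi> y = \<phi>' y"
      using completion_ex_borel_measurable_real[OF \<phi>m] by blast
    have \<phi>'m: "\<phi>' \<in> borel_measurable borel" using \<phi>'(1) by simp
    have ae: "AE y in lebesgue. \<phi> y = \<phi>' y" by (rule AE_completion[OF \<phi>'(2)])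
    interpret K: jet_kernel m d L CG T "\<lambda>w x y t. iter_partial w (\<lambda>x. G x y t) x"
      using T by (intro kernel) auto
    have smear: "smear L (t powr (1 / d)) (\<lambda>y. \<bar>\<phi>' y\<bar> powr q') x \<le> ennreal (e * t powr (- q' * \<nu>))"
      if t: "0 < t" "ereal t < T" for t x
    proof -
      let ?\<rho> = "t powr (1 / d)"
      have \<rho>: "0 < ?\<rho>" using t by simp
      have \<rho>T: "ereal ?\<rho> < ereal_root d T"
      proof (cases T)
        case (real s)
        then show ?thesis using t K.d_pos by (simp add: ereal_root_def powr_less_mono2)
      qed (use t in \<open>auto simp: ereal_root_def\<close>)
      let ?E = "2 * (\<gamma> * ?\<rho> powr (- real DIM('a) / r0)) powr q'"
      have "smear L ?\<rho> (\<lambda>y. \<bar>\<phi>' y\<bar> powr q') x \<le> ennreal (2 powr (real DIM('a) + 2 * L) * kern_mass L TYPE('a) * ?E)"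
        using T assms(2) \<phi>'m by (intro smear_le_average \<rho> ball_average_le[OF _ \<rho> \<rho>T q'(1,2) \<gamma> \<phi>'m ae]) auto
      also have "2 powr (real DIM('a) + 2 * L) * kern_mass L TYPE('a) * ?E
          = (c * \<gamma> powr q') * (?\<rho> powr (- real DIM('a) / r0)) powr q'"
        using \<gamma> by (simp add: c_def mass_def powr_mult)
      also have "(?\<rho> powr (- real DIM('a) / r0)) powr q' = t powr (- q' * \<nu>)"
        by (simp add: powr_powr \<nu>_def mult.commute)
      finally show ?thesis unfolding \<gamma>_pow .
    qed
    interpret jet_problem m d L CG a0 A q' r0 J p F T "\<lambda>w x y t. iter_partial w (\<lambda>x. G x y t) x" \<phi>' e
      using \<phi>'m e smear small by unfold_locales auto
    have "\<exists>u. is_solution m a0 G F \<phi> T u \<and>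
      (\<forall>x t. \<forall>j\<le>m. 0 < t \<and> ereal t < T \<longrightarrow> nabla_norm j (\<lambda>x. u x t) x \<le> C * t powr (- \<nu> - real j / d))"
      unfolding C_def by (rule solution_exists[OF \<phi>m ae]) auto
    then show "\<exists>u. is_solution m a0 G F \<phi> T u \<and>
      (\<forall>x t. \<forall>j\<le>m. 0 < t \<and> ereal t < T \<longrightarrow> nabla_norm j (\<lambda>x. u x t) x
         \<le> C * t powr (- real DIM('a) / (d * r0) - real j / d))"
      by (simp add: \<nu>_def)
  qed
qed

end
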